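(* Each of the $L_{\mathcal{O}}^p$-theories $T\big((\vec{0},\vec{0}),(\vec{0},\vec{0})\big)$, $T\big((\vec{0},\vec{\infty}),(\vec{0},\vec{0})\big)$ and $T\big((\vec{0},\vec{\infty}),(\vec{0},\vec{\infty})\big)$ has the VC $2$ property.
   Context: An oriented abelian group is an abelian group $(A,+,-,0)$ with a ternary relation $\mathcal{O}$ which is a translation-invariant cyclic order: for all $a,b,c,d$, $\mathcal{O}(a,b,c)\to\mathcal{O}(b,c,a)$; $\mathcal{O}(a,b,c)\to\neg\mathcal{O}(c,b,a)$; $\mathcal{O}(a,b,c)\wedge\mathcal{O}(a,c,d)\to\mathcal{O}(a,b,d)$; for pairwise distinct $a,b,c$, $\mathcal{O}(a,b,c)\vee\mathcal{O}(c,b,a)$; $\mathcal{O}(a,b,c)\to\mathcal{O}(a+d,b+d,c+d)$. Write $x<_0y$ for $x\neq y\wedge\mathcal{O}(0,x,y)$. Orientation intervals $(a,b)_{\mathcal{O}}=\{x:\mathcal{O}(a,x,b)\}$ form a basis of a group topology; "dense" refers to it. $A$ is regularly dense if for each prime $p$ and all $a,b$ with $\mathcal{O}(0,a,b)$ there is $c$ with $\mathcal{O}(a,pc,b)$ and $ic<_0(i+1)c$ for $i=1,\dots,p-1$. For a prime $p$, $[p]A=|A/pA|$, $\operatorname{Tor}_n(A)=\{a:na=0\}$, and $e(A,p)$ is the least $e\in\mathbb{N}$ with $\operatorname{Tor}_{p^{e+k}}(A)=\operatorname{Tor}_{p^e}(A)$ for all $k$ (where $\operatorname{Tor}_{p^0}(A)=\{0\}$),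 or $\infty$ if none exists. For sequences $\vec d,\vec e$ indexed by primes $p_i$ with values in $\mathbb{N}\cup\{\infty\}$, $T(\vec d,\vec e)$ is the theory in $L_{\mathcal{O}}=\{+,-,0,\mathcal{O}\}$ whose models are regularly dense oriented abelian groups with $[p_i]A=p_i^{d_i}$ and $e(A,p_i)=e_i$; $\vec0,\vec\infty$ are constant sequences. $L^p_{\mathcal{O}}=L_{\mathcal{O}}\cup\{V\}$, $V$ unary. $T\big((\vec d_1,\vec e_1),(\vec d_2,\vec e_2)\big)$ is the (complete) $L^p_{\mathcal{O}}$-theory whose models are pairs $(A,G)$ ($V$ interpreted as $G$) with $A\models T(\vec d_1,\vec e_1)$, $G$ a dense subgroup of $A$ with $G\models T(\vec d_2,\vec e_2)$ in the induced structure, and $A/G$ infinite. UDTFS: a finite set $\Delta(x;\vec y)$ of formulas in a single object variable $x$ has UDTFS with $d$ parameters in a model $M$ if there are finitely many families $(\psi^i_\varphi(\vec y;\vec y_1,\dots,\vec y_d))_{\varphi\in\Delta}$, $i\in I$, such that for every finite $B\subseteq M^{|\vec y|}$ with $|B|\ge2$ and every complete $\Delta$-type $q$ in $x$ over $B$ there are $\vec b_1,\dots,\vec b_d\in B$ and $i\in I$ with: for all $\varphi\in\Delta$, $\vec b\in B$, $\varphi(x;\vec b)\in q$ iff $M\models\psi^i_\varphi(\vec b;\vec b_1,\dots,\vec b_d)$. A complete theory has the VC $d$ property if every finite set of partitioned formulas in a single object variable has UDTFS with $d$ parameters. *)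

theory Defs
  imports
    "HOL-Algebra.Coset"
    "HOL-Analysis.Analysis"
    "HOL-Library.Extended_Nat"
    "HOL-Computational_Algebra.Primes"
begin

section \<open>Oriented abelian groups\<close>

text \<open>
  The library's groups are written multiplicatively: the group operation + is \<open>\<otimes>\<close>, the
  zero is \<open>\<one>\<close>, minus is \<open>inv\<close> and the multiple n x is \<open>x [^] n\<close>.
  Only the values of \<open>ori\<close> on the carrier matter.
\<close>

record 'a oriented_monoid = "'a monoid" +
  ori :: "'a \<Rightarrow> 'a \<Rightarrow> 'a \<Rightarrow> bool"

locale oriented_abelian_group = comm_group A
  for A :: "('a, 'b) oriented_monoid_scheme" (structure) +
  assumes ori_cyclic:
      "\<lbrakk>a \<in> carrier A; b \<in> carrier A; c \<in> carrier A; ori A a b c\<rbrakk> \<Longrightarrow> ori A b c a"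
    and ori_asym:
      "\<lbrakk>a \<in> carrier A; b \<in> carrier A; c \<in> carrier A; ori A a b c\<rbrakk> \<Longrightarrow> \<not> ori A c b a"
    and ori_trans:
      "\<lbrakk>a \<in> carrier A; b \<in> carrier A; c \<in> carrier A; d \<in> carrier A;
        ori A a b c; ori A a c d\<rbrakk> \<Longrightarrow> ori A a b d"
    and ori_total:
      "\<lbrakk>a \<in> carrier A; b \<in> carrier A; c \<in> carrier A; a \<noteq> b; b \<noteq> c; a \<noteq> c\<rbrakk>
        \<Longrightarrow> ori A a b c \<or> ori A c b a"
    and ori_translate:
      "\<lbrakk>a \<in> carrier A; b \<in> carrier A; c \<in> carrier A; d \<in> carrier A; ori A a b c\<rbrakk>
        \<Longrightarrow> ori A (a \<otimes> d) (b \<otimes> d) (c \<otimes> d)"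

definition less0 :: "('a, 'b) oriented_monoid_scheme \<Rightarrow> 'a \<Rightarrow> 'a \<Rightarrow> bool" where
  "less0 A x y \<longleftrightarrow> x \<noteq> y \<and> ori A \<one>\<^bsub>A\<^esub> x y"

definition ori_interval :: "('a, 'b) oriented_monoid_scheme \<Rightarrow> 'a \<Rightarrow> 'a \<Rightarrow> 'a set" where
  "ori_interval A a b = {x \<in> carrier A. ori A a x b}"

definition ori_topology :: "('a, 'b) oriented_monoid_scheme \<Rightarrow> 'a topology" where
  "ori_topology A =
     topology_generated_by {ori_interval A a b | a b. a \<in> carrier A \<and> b \<in> carrier A}"

definition ori_dense :: "('a, 'b) oriented_monoid_scheme \<Rightarrow> 'a set \<Rightarrow> bool" where
  "ori_dense A G \<longleftrightarrow> ori_topology A closure_of G = carrier A"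

definition regularly_dense :: "('a, 'b) oriented_monoid_scheme \<Rightarrow> bool" where
  "regularly_dense A \<longleftrightarrow>
     (\<forall>p::nat. prime p \<longrightarrow>
       (\<forall>a\<in>carrier A. \<forall>b\<in>carrier A. ori A \<one>\<^bsub>A\<^esub> a b \<longrightarrow>
         (\<exists>c\<in>carrier A. ori A a (c [^]\<^bsub>A\<^esub> p) b \<and>
           (\<forall>i\<in>{1..p - 1}. less0 A (c [^]\<^bsub>A\<^esub> i) (c [^]\<^bsub>A\<^esub> (i + 1))))))"

definition index :: "('a, 'b) monoid_scheme \<Rightarrow> nat \<Rightarrow> enat" where
  "index A p =
     (let Q = carrier (A Mod ((\<lambda>x. x [^]\<^bsub>A\<^esub> p) ` carrier A))
      in if finite Q then enat (card Q) else \<infinity>)"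

definition Tor :: "('a, 'b) monoid_scheme \<Rightarrow> nat \<Rightarrow> 'a set" where
  "Tor A n = {a \<in> carrier A. a [^]\<^bsub>A\<^esub> n = \<one>\<^bsub>A\<^esub>}"

definition tor_exponent :: "('a, 'b) monoid_scheme \<Rightarrow> nat \<Rightarrow> enat" where
  "tor_exponent A p =
     (let stable = (\<lambda>e. \<forall>k. Tor A (p ^ (e + k)) = Tor A (p ^ e))
      in if \<exists>e. stable e then enat (LEAST e. stable e) else \<infinity>)"

fun enat_power :: "nat \<Rightarrow> enat \<Rightarrow> enat" where
  "enat_power p (enat n) = enat (p ^ n)"
| "enat_power p \<infinity> = \<infinity>"

text \<open>
  The models of T(d, e). The sequences are indexed by the primes themselves; their values at
  non-primes play no role.
\<close>

definition models_T ::
    "(nat \<Rightarrow> enat) \<Rightarrow> (nat \<Rightarrow> enat) \<Rightarrow> ('a, 'b) oriented_monoid_scheme \<Rightarrow> bool" where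
  "models_T d e A \<longleftrightarrow>
     oriented_abelian_group A \<and> regularly_dense A \<and>
     (\<forall>p. prime p \<longrightarrow> index A p = enat_power p (d p) \<and> tor_exponent A p = e p)"


section \<open>Pairs\<close>

record 'a pair_structure = "'a oriented_monoid" +
  pred :: "'a set"

text \<open>
  The theory of pairs is represented by its class of models, which is how it is specified; here
  those whose elements are of type \<open>'a\<close>. The subgroup with the induced structure is
  \<open>M\<lparr>carrier := pred M\<rparr>\<close>.
\<close>

definition pair_theory ::
    "(nat \<Rightarrow> enat) \<times> (nat \<Rightarrow> enat) \<Rightarrow> (nat \<Rightarrow> enat) \<times> (nat \<Rightarrow> enat) \<Rightarrow> 'a pair_structure set"
where
  "pair_theory = (\<lambda>(d1, e1) (d2, e2).
     {M. models_T d1 e1 M \<and>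
         subgroup (pred M) M \<and> ori_dense M (pred M) \<and>
         models_T d2 e2 (M\<lparr>carrier := pred M\<rparr>) \<and>
         infinite (carrier (M Mod (pred M)))})"


section \<open>First-order formulas in the language of pairs\<close>

datatype tm =
    Var nat
  | Zero
  | Plus tm tm
  | Minus tm

datatype fm =
    Equal tm tm
  | Ori tm tm tm
  | Pred tm
  | Neg fm
  | Conj fm fm
  | Exi nat fm

primrec fv_tm :: "tm \<Rightarrow> nat set" where
  "fv_tm (Var n) = {n}"
| "fv_tm Zero = {}"
| "fv_tm (Plus s t) = fv_tm s \<union> fv_tm t"
| "fv_tm (Minus t) = fv_tm t"

primrec fv :: "fm \<Rightarrow> nat set" where
  "fv (Equal s t) = fv_tm s \<union> fv_tm t"
| "fv (Ori r s t) = fv_tm r \<union> fv_tm s \<union> fv_tm t"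
| "fv (Pred t) = fv_tm t"
| "fv (Neg \<phi>) = fv \<phi>"
| "fv (Conj \<phi> \<psi>) = fv \<phi> \<union> fv \<psi>"
| "fv (Exi n \<phi>) = fv \<phi> - {n}"

primrec eval :: "'a pair_structure \<Rightarrow> (nat \<Rightarrow> 'a) \<Rightarrow> tm \<Rightarrow> 'a" where
  "eval M v (Var n) = v n"
| "eval M v Zero = \<one>\<^bsub>M\<^esub>"
| "eval M v (Plus s t) = eval M v s \<otimes>\<^bsub>M\<^esub> eval M v t"
| "eval M v (Minus t) = inv\<^bsub>M\<^esub> (eval M v t)"

primrec sat :: "'a pair_structure \<Rightarrow> (nat \<Rightarrow> 'a) \<Rightarrow> fm \<Rightarrow> bool" where
  "sat M v (Equal s t) \<longleftrightarrow> eval M v s = eval M v t"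
| "sat M v (Ori r s t) \<longleftrightarrow> ori M (eval M v r) (eval M v s) (eval M v t)"
| "sat M v (Pred t) \<longleftrightarrow> eval M v t \<in> pred M"
| "sat M v (Neg \<phi>) \<longleftrightarrow> \<not> sat M v \<phi>"
| "sat M v (Conj \<phi> \<psi>) \<longleftrightarrow> sat M v \<phi> \<and> sat M v \<psi>"
| "sat M v (Exi n \<phi>) \<longleftrightarrow> (\<exists>a\<in>carrier M. sat M (v(n := a)) \<phi>)"

text \<open>
  Satisfaction by a tuple: the i-th entry is the value of variable i. Below, all free variables
  of \<open>\<phi>\<close> are below the length of the tuple, so the default value \<open>\<one>\<close> is immaterial.
\<close>

definition sat_tuple :: "'a pair_structure \<Rightarrow> 'a list \<Rightarrow> fm \<Rightarrow> bool" where
  "sat_tuple M xs \<phi> \<longleftrightarrow> sat M (\<lambda>i. if i < length xs then xs ! i else \<one>\<^bsub>M\<^esub>) \<phi>"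


section \<open>Uniform definability of types over finite sets\<close>

definition tuples :: "'a pair_structure \<Rightarrow> nat \<Rightarrow> 'a list set" where
  "tuples M m = {xs. length xs = m \<and> set xs \<subseteq> carrier M}"

text \<open>
  A partitioned formula \<open>\<phi>(x; y\<^sub>1, \<dots>, y\<^sub>m)\<close>: the object variable is variable 0 and
  the parameter variables are the variables 1, ..., m.
\<close>

definition partitioned :: "nat \<Rightarrow> fm \<Rightarrow> bool" where
  "partitioned m \<phi> \<longleftrightarrow> fv \<phi> \<subseteq> {..m}"

text \<open>
  The triple \<open>(\<phi>, b, True)\<close> stands for the instance \<open>\<phi>(x; b)\<close> and \<open>(\<phi>, b, False)\<close> for its
  negation. Consistency is finite satisfiability in \<open>M\<close>, that is, consistency with the
  elementary diagram of \<open>M\<close>.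
\<close>

definition complete_type ::
    "'a pair_structure \<Rightarrow> fm set \<Rightarrow> 'a list set \<Rightarrow> (fm \<times> 'a list \<times> bool) set \<Rightarrow> bool" where
  "complete_type M \<Delta> B q \<longleftrightarrow>
     q \<subseteq> \<Delta> \<times> B \<times> UNIV \<and>
     (\<forall>q0\<subseteq>q. finite q0 \<longrightarrow>
        (\<exists>a\<in>carrier M. \<forall>(\<phi>, b, s)\<in>q0. sat_tuple M (a # b) \<phi> \<longleftrightarrow> s)) \<and>
     (\<forall>\<phi>\<in>\<Delta>. \<forall>b\<in>B. (\<phi>, b, True) \<in> q \<or> (\<phi>, b, False) \<in> q)"

text \<open>
  In a defining formula \<open>\<psi>(y; y\<^sub>1, \<dots>, y\<^sub>d)\<close> the d + 1 blocks of m variables are numbered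
  consecutively from 0.
\<close>

definition UDTFS :: "'a pair_structure \<Rightarrow> nat \<Rightarrow> fm set \<Rightarrow> nat \<Rightarrow> bool" where
  "UDTFS M m \<Delta> d \<longleftrightarrow>
     (\<exists>(I :: nat set) (\<psi> :: nat \<Rightarrow> fm \<Rightarrow> fm).
        finite I \<and>
        (\<forall>i\<in>I. \<forall>\<phi>\<in>\<Delta>. fv (\<psi> i \<phi>) \<subseteq> {..<(d + 1) * m}) \<and>
        (\<forall>B q. finite B \<and> B \<subseteq> tuples M m \<and> card B \<ge> 2 \<and> complete_type M \<Delta> B q \<longrightarrow>
           (\<exists>bs. length bs = d \<and> set bs \<subseteq> B \<and>
             (\<exists>i\<in>I. \<forall>\<phi>\<in>\<Delta>. \<forall>b\<in>B.
                (\<phi>, b, True) \<in> q \<longleftrightarrow> sat_tuple M (b @ concat bs) (\<psi> i \<phi>)))))"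

text \<open>
  For a complete theory it is immaterial which model is used for UDTFS, since for given
  \<open>\<psi>\<close> the defining property is expressed by sentences; all models are required here.
\<close>

definition VC_property :: "'a pair_structure set \<Rightarrow> nat \<Rightarrow> bool" where
  "VC_property T d \<longleftrightarrow>
     (\<forall>m \<Delta>. finite \<Delta> \<and> (\<forall>\<phi>\<in>\<Delta>. partitioned m \<phi>) \<longrightarrow> (\<forall>M\<in>T. UDTFS M m \<Delta> d))"

end

theory Submission
  imports Defs "HOL-Library.Poly_Mapping" "HOL-Algebra.FiniteProduct"
begin

text \<open>
  All three theories only see that \<open>A\<close> and \<open>G\<close> are divisible, that every \<open>n G\<close> is dense (regular
  density), and that \<open>A / G\<close> is infinite. The cyclically ordered group \<open>A\<close> is unrolled to its
  universal cover \<open>U\<close>, an ordered abelian group with \<open>A = U / \<int>\<close>. A back-and-forth argument in \<open>U\<close>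
  shows that the truth of a formula at a tuple \<open>v\<close> of representatives in \<open>[0, 1)\<close> depends only on the
  signs of the integer combinations of \<open>v\<close> and \<open>1\<close> with coefficients bounded by some \<open>N\<close>, and on their
  membership in \<open>n U\<close> and \<open>n G\<close> for \<open>n \<le> N\<close>. With \<open>K = N!\<close>, the bounded combinations involving a
  further element \<open>x\<close> are controlled by the cut of \<open>K x\<close> among combinations of \<open>v\<close> and by the coset of
  \<open>x\<close> modulo \<open>K G\<close>, or modulo \<open>K U\<close> if \<open>K x\<close> avoids \<open>G\<close>-cosets of such combinations.

  Given a finite set \<open>B\<close> of parameters, a type over \<open>B\<close> is therefore determined by one tuple \<open>b\<^sub>1\<close>
  carrying the largest combination below \<open>K x\<close>, one tuple \<open>b\<^sub>2\<close> carrying the coset of \<open>K x\<close>, and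
  finitely many coefficients: \<open>\<phi>(x; b)\<close> holds iff \<open>\<phi>(x'; b)\<close> holds for all \<open>x'\<close> of that coset
  just to the right of the combination of \<open>b\<^sub>1\<close>.
\<close>

section \<open>Preordered groups with a unit\<close>

text \<open>Naming a type by both endpoints of the gap around \<open>K x\<close> and by a coset
  would cost three tuples. The right endpoint is saved by using a germ: the left endpoint is maximal
  over all of \<open>B\<close>, so for every \<open>b\<close> in \<open>B\<close> no bounded
  combination of \<open>b\<close> lies above it and at or below \<open>K x\<close>; hence the truth
  of \<open>\<phi>(x'; b)\<close> is constant on the elements of the right coset in that stretch,
  and "just to the right" is a quantifier. A left endpoint exists because the zero combination is
  available. A tuple is spent on the coset only if \<open>K x\<close> lies in the
  \<open>G\<close>-coset of some combination; otherwise genericity is asked over \<open>b\<close>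
  alone, which is at hand. The second obstacle is the unrolling. The unit of \<open>U\<close> need
  not be divisible, so divisibility in \<open>A\<close> gives division in \<open>U\<close> only up
  to an integer, and regular density, which speaks about multiples within one turn, has to be
  promoted to density of \<open>n G\<close> in all of \<open>U\<close>. Conversely \<open>U\<close>
  is not part of the structure: signs and divisibility in \<open>U\<close> must be defined in
  \<open>A\<close> by tracking carries.\<close>

lemma int_dvd_fact: "1 \<le> n \<Longrightarrow> n \<le> N \<Longrightarrow> n dvd (fact (nat N) :: int)"
proof -
  assume n: "1 \<le> n" "n \<le> N"
  then have "int (nat n) dvd int (fact (nat N))"
    by (subst int_dvd_int_iff) (auto intro!: dvd_fact)
  then show ?thesis using n by simp
qed

text \<open>Used with \<open>K = N!\<close> and \<open>a\<close> the coefficient of the object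
  variable: multiplying \<open>a x + c\<close> by the cofactor \<open>b\<close> gives
  \<open>K x + b c\<close>, and the bound on \<open>b\<close> keeps the coefficients of
  \<open>b c\<close> within \<open>K N\<close>.\<close>

lemma cofactor_bound:
  fixes a K :: int
  assumes "\<bar>a\<bar> dvd K" "a \<noteq> 0" "K > 0"
  obtains b where "K = a * b" "\<bar>b\<bar> \<le> K"
proof -
  obtain b where b: "K = a * b" using assms(1) by (auto elim: dvdE)
  have "K = \<bar>a\<bar> * \<bar>b\<bar>" using assms(3) unfolding abs_mult[symmetric] b[symmetric] by simp
  then have "\<bar>b\<bar> \<le> K" using assms(2) mult_right_mono[of 1 "\<bar>a\<bar>" "\<bar>b\<bar>"] by simp
  then show thesis using that b by blast
qed

text \<open>
  \<open>pos\<close> is strict positivity for a compatible total preorder. The elements that are neither positive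
  nor negative (the null elements) count as zero: the ordered group meant is the quotient by them.
\<close>

locale positive_cone =
  fixes pos :: "'t::comm_ring_1 \<Rightarrow> bool"
  assumes pos_add: "pos x \<Longrightarrow> pos y \<Longrightarrow> pos (x + y)"
    and nonpos_add: "\<not> pos x \<Longrightarrow> \<not> pos y \<Longrightarrow> \<not> pos (x + y)"
    and pos_asym: "pos x \<Longrightarrow> \<not> pos (- x)"
    and pos_one: "pos 1"
    and floor_ex: "\<exists>k::int. \<not> pos (of_int k - x) \<and> pos (of_int (k + 1) - x)"
begin

definition null :: "'t \<Rightarrow> bool" where
  "null x \<longleftrightarrow> \<not> pos x \<and> \<not> pos (- x)"

definition unit_rep :: "'t \<Rightarrow> bool" where
  "unit_rep x \<longleftrightarrow> \<not> pos (- x) \<and> pos (1 - x)"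

lemma not_pos_0 [simp]: "\<not> pos 0"
  using pos_asym[of 0] by auto

lemma null_0 [simp]: "null 0"
  by (simp add: null_def)

lemma null_minus [simp]: "null (- x) \<longleftrightarrow> null x"
  by (auto simp: null_def)

lemma null_add: "null x \<Longrightarrow> null y \<Longrightarrow> null (x + y)"
  using nonpos_add[of x y] nonpos_add[of "- x" "- y"] by (auto simp: null_def)

lemma null_diff: "null x \<Longrightarrow> null y \<Longrightarrow> null (x - y)"
  using null_add[of x "- y"] by auto

lemma null_diff_commute: "null (x - y) \<longleftrightarrow> null (y - x)"
  using null_minus[of "x - y"] by simp

lemma pos_add_nonneg: "pos x \<Longrightarrow> \<not> pos (- y) \<Longrightarrow> pos (x + y)"
  using nonpos_add[of "x + y" "- y"] by auto

lemma pos_cong: "null (x - y) \<Longrightarrow> pos x \<longleftrightarrow> pos y"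
  using pos_add_nonneg[of x "y - x"] pos_add_nonneg[of y "x - y"] by (auto simp: null_def)

lemma lt_trans: "pos (y - x) \<Longrightarrow> pos (z - y) \<Longrightarrow> pos (z - x)"
  using pos_add[of "y - x" "z - y"] by (simp add: algebra_simps)

lemma lt_leq_trans: "pos (y - x) \<Longrightarrow> \<not> pos (y - z) \<Longrightarrow> pos (z - x)"
  using pos_add_nonneg[of "y - x" "z - y"] by (simp add: algebra_simps)

lemma leq_lt_trans: "\<not> pos (x - y) \<Longrightarrow> pos (z - y) \<Longrightarrow> pos (z - x)"
  using pos_add_nonneg[of "z - y" "y - x"] by (simp add: algebra_simps)

lemma leq_trans: "\<not> pos (x - y) \<Longrightarrow> \<not> pos (y - z) \<Longrightarrow> \<not> pos (x - z)"
  using nonpos_add[of "x - y" "y - z"] by (simp add: algebra_simps)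

lemma lt_imp_leq: "pos (y - x) \<Longrightarrow> \<not> pos (x - y)"
  using pos_asym[of "y - x"] by simp

lemma pos_of_nat_mult: "pos x \<Longrightarrow> pos (of_nat (Suc n) * x)"
proof (induction n)
  case (Suc n)
  have "of_nat (Suc (Suc n)) * x = x + of_nat (Suc n) * x"
    by (simp add: distrib_right)
  then show ?case using Suc pos_add by simp
qed simp

lemma nonpos_of_nat_mult: "\<not> pos x \<Longrightarrow> \<not> pos (of_nat (Suc n) * x)"
proof (induction n)
  case (Suc n)
  have "of_nat (Suc (Suc n)) * x = x + of_nat (Suc n) * x"
    by (simp add: distrib_right)
  then show ?case using Suc nonpos_add by simp
qed simp

text \<open>Totality of the preorder excludes torsion: both the positive and the nonpositive
  elements are closed under sums, so a positive multiple keeps the sign.\<close>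

lemma pos_scale: assumes "n > (0::int)" shows "pos (of_int n * x) \<longleftrightarrow> pos x"
proof -
  obtain k where "n = int (Suc k)"
    using assms by (metis Suc_pred zero_less_imp_eq_int)
  then have "of_int n * x = of_nat (Suc k) * x" by simp
  then show ?thesis using pos_of_nat_mult nonpos_of_nat_mult by metis
qed

lemma null_scale: "n > (0::int) \<Longrightarrow> null (of_int n * x) \<longleftrightarrow> null x"
  using pos_scale[of n x] pos_scale[of n "- x"] by (simp add: null_def)

lemma null_mult: "null x \<Longrightarrow> null (of_int n * x)"
proof (cases n "0::int" rule: linorder_cases)
  case less
  assume "null x"
  then have "null (of_int (- n) * x)" using less null_scale[of "- n" x] by simp
  then show ?thesis by simp
qed (auto simp: null_scale)

lemma pos_of_int [simp]: "pos (of_int k) \<longleftrightarrow> k > 0"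
proof (cases k "0::int" rule: linorder_cases)
  case less
  then have "pos (of_int (- k) * 1)" using pos_one by (subst pos_scale) auto
  then show ?thesis using less pos_asym[of "- of_int k"] by simp
next
  case greater
  then have "pos (of_int k * 1)" using pos_one by (subst pos_scale) auto
  then show ?thesis using greater by simp
qed auto

lemma null_of_int [simp]: "null (of_int k) \<longleftrightarrow> k = 0"
  using pos_of_int[of k] pos_of_int[of "- k"] unfolding null_def of_int_minus by auto

lemma unit_rep_shift:
  obtains k :: int where "unit_rep (x - of_int k)"
proof -
  obtain k where "\<not> pos (of_int k - x)" "pos (of_int (k + 1) - x)" using floor_ex by blast
  then have "unit_rep (x - of_int k)" by (simp add: unit_rep_def algebra_simps)
  then show thesis by (rule that)
qed

text \<open>Two elements of [0, 1) differ by an element strictly between -1 and 1, where 0 is the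
  only integer.\<close>

lemma unit_rep_unique:
  assumes "unit_rep x" "unit_rep y" "null (x - y - of_int k)"
  shows "k = 0" "null (x - y)"
proof -
  have *: "pos (1 - (x - y))" "pos (1 + (x - y))"
    using assms(1,2) pos_add_nonneg[of "1 - x" y] pos_add_nonneg[of "1 - y" x]
    by (auto simp: unit_rep_def algebra_simps)
  have "(1 - (x - y)) - (1 - of_int k) = - (x - y - of_int k)" by simp
  then have "null ((1 - (x - y)) - (1 - of_int k))" using assms(3) by (simp only: null_minus)
  then have "pos (1 - of_int k)" using *(1) pos_cong by blast
  then have "pos (of_int (1 - k))" by simp
  then have "k < 1" unfolding pos_of_int by simp
  have "pos (1 + of_int k)"
    using *(2) pos_cong[of "1 + (x - y)" "1 + of_int k"] assms(3) by simp
  then have "pos (of_int (1 + k))" by simp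
  then have "k > -1" unfolding pos_of_int by simp
  then show "k = 0" using \<open>k < 1\<close> by simp
  then show "null (x - y)" using assms(3) by simp
qed

lemma finite_max:
  assumes "finite S" "S \<noteq> {}"
  shows "\<exists>s\<in>S. \<forall>t\<in>S. \<not> pos (f t - f s)"
  using assms
proof (induction S rule: finite_ne_induct)
  case (insert a S)
  then obtain s where s: "s \<in> S" "\<forall>t\<in>S. \<not> pos (f t - f s)" by blast
  show ?case
  proof (cases "pos (f a - f s)")
    case True
    then have "\<forall>t\<in>S. \<not> pos (f t - f a)"
      using s(2) lt_imp_leq leq_trans by metis
    then show ?thesis by auto
  next
    case False
    then show ?thesis using s by auto
  qed
qed auto

section \<open>Divisibility up to null elements and integer combinations\<close>

definition multiple :: "int \<Rightarrow> 't set \<Rightarrow> 't \<Rightarrow> bool" where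
  "multiple n W x \<longleftrightarrow> (\<exists>g\<in>W. null (x - of_int n * g))"

lemma multiple_null: "null (x - y) \<Longrightarrow> multiple n W x \<longleftrightarrow> multiple n W y"
proof -
  have "multiple n W y" if h: "null (x - y)" "multiple n W x" for x y
  proof -
    obtain g where "g \<in> W" "null (x - of_int n * g)" using h(2) by (auto simp: multiple_def)
    moreover have "y - of_int n * g = (x - of_int n * g) - (x - y)" by simp
    ultimately show ?thesis using h(1) null_diff unfolding multiple_def by metis
  qed
  then show "null (x - y) \<Longrightarrow> ?thesis" using null_diff_commute by blast
qed

text \<open>Clears denominators: without torsion modulo null elements, divisibility of
  \<open>x\<close> can be read off from a multiple of \<open>x\<close>. This is what allows
  \<open>x\<close> to be traded for \<open>K x\<close>.\<close>

lemma multiple_scale: "k > 0 \<Longrightarrow> multiple (k * n) W (of_int k * x) \<longleftrightarrow> multiple n W x"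
proof -
  assume k: "k > 0"
  have "null (of_int k * x - of_int (k * n) * g) \<longleftrightarrow> null (x - of_int n * g)" for g
  proof -
    have "of_int k * x - of_int (k * n) * g = of_int k * (x - of_int n * g)"
      by (simp add: algebra_simps)
    then show ?thesis using null_scale[OF k] by simp
  qed
  then show ?thesis by (simp add: multiple_def)
qed

text \<open>The sum includes the top index \<open>m\<close>, at which the valuations below carry the
  value \<open>1\<close>; integer constants are then ordinary coefficients.\<close>

definition lin :: "nat \<Rightarrow> (nat \<Rightarrow> int) \<Rightarrow> (nat \<Rightarrow> 't) \<Rightarrow> 't" where
  "lin m c v = (\<Sum>i\<le>m. of_int (c i) * v i)"

lemma lin_add: "lin m (\<lambda>i. c i + d i) v = lin m c v + lin m d v"
  by (simp add: lin_def algebra_simps sum.distrib)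

lemma lin_diff: "lin m (\<lambda>i. c i - d i) v = lin m c v - lin m d v"
  by (simp add: lin_def algebra_simps sum_subtractf)

lemma lin_scale: "lin m (\<lambda>i. k * c i) v = of_int k * lin m c v"
  by (simp add: lin_def sum_distrib_left algebra_simps)

lemma lin_cong: "(\<And>i. i \<le> m \<Longrightarrow> c i = d i) \<Longrightarrow> (\<And>i. i \<le> m \<Longrightarrow> v i = w i) \<Longrightarrow> lin m c v = lin m d w"
  by (simp add: lin_def)

lemma lin_upd: "j \<le> m \<Longrightarrow> lin m c (v(j := x)) = of_int (c j) * x + lin m (c(j := 0)) v"
proof -
  assume j: "j \<le> m"
  have "lin m c (v(j := x)) = of_int (c j) * x + (\<Sum>i\<in>{..m} - {j}. of_int (c i) * v i)"
    unfolding lin_def using j by (subst sum.remove[of _ j]) auto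
  also have "(\<Sum>i\<in>{..m} - {j}. of_int (c i) * v i) = lin m (c(j := 0)) v"
    unfolding lin_def using j by (subst (2) sum.remove[of _ j]) auto
  finally show ?thesis .
qed

lemma lin_upd_coeff: "j \<le> m \<Longrightarrow> lin m (c(j := c j + a)) v = lin m c v + of_int a * v j"
proof -
  assume j: "j \<le> m"
  have "lin m (c(j := c j + a)) v = lin m (\<lambda>i. c i + (if i = j then a else 0)) v"
    by (rule lin_cong) auto
  also have "\<dots> = lin m c v + of_int a * v j"
    using j by (simp only: lin_add)
      (simp add: lin_def if_distrib[of of_int] if_distrib[of "\<lambda>x. x * _"] cong: if_cong)
  finally show ?thesis .
qed

lemma lin_zero [simp]: "lin m (\<lambda>i. 0) v = 0"
  by (simp add: lin_def)

end

text \<open>\<open>divisible\<close> is division in the quotient by the integers. In the cover an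
  integer remainder is left, because \<open>1\<close> can be a multiple of \<open>n\<close> only if
  the quotient has an element of order \<open>n\<close>. This remainder is why residues
  \<open>k\<close> and the test \<open>multiple n UNIV\<close> occur throughout.\<close>

locale dense_cover = positive_cone pos for pos :: "'t::comm_ring_1 \<Rightarrow> bool" +
  fixes G :: "'t set"
  assumes G_add: "x \<in> G \<Longrightarrow> y \<in> G \<Longrightarrow> x + y \<in> G"
    and G_uminus: "x \<in> G \<Longrightarrow> - x \<in> G"
    and G_one: "1 \<in> G"
    and G_null: "null x \<Longrightarrow> x \<in> G"
    and divisible: "W \<in> {UNIV, G} \<Longrightarrow> x \<in> W \<Longrightarrow> n > 0 \<Longrightarrow>
          \<exists>y\<in>W. \<exists>k::int. null (x - of_int n * y - of_int k)"
    and dense: "pos (y - x) \<Longrightarrow> n > 0 \<Longrightarrow> \<exists>g\<in>G. pos (of_int n * g - x) \<and> pos (y - of_int n * g)"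
    and infinite_index: "finite F \<Longrightarrow> \<exists>x. \<forall>y\<in>F. x - y \<notin> G"
begin

lemma G_diff: "x \<in> G \<Longrightarrow> y \<in> G \<Longrightarrow> x - y \<in> G"
  using G_add[of x "- y"] G_uminus by simp

lemma G_zero: "0 \<in> G"
  using G_null by simp

lemma G_of_nat_mult: "x \<in> G \<Longrightarrow> of_nat n * x \<in> G"
  by (induction n) (auto simp: distrib_right G_zero intro: G_add)

lemma G_of_int_mult: "x \<in> G \<Longrightarrow> of_int k * x \<in> G"
proof (cases k)
  case (neg n)
  assume "x \<in> G"
  then have "- (of_nat (Suc n) * x) \<in> G" by (intro G_uminus G_of_nat_mult)
  moreover have "of_int k * x = - (of_nat (Suc n) * x)"
    unfolding neg by (simp add: algebra_simps)
  ultimately show ?thesis by simp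
qed (simp add: G_of_nat_mult)

lemma G_of_int: "of_int k \<in> G"
  using G_of_int_mult[OF G_one] by simp

lemma G_cong: "x - y \<in> G \<Longrightarrow> x \<in> G \<longleftrightarrow> y \<in> G"
  using G_diff[of x "x - y"] G_add[of "x - y" y] by auto

lemma multiple_imp_G: "multiple n G x \<Longrightarrow> x \<in> G"
  unfolding multiple_def using G_null G_of_int_mult G_cong by metis

lemma multiple_1: "multiple 1 G x \<longleftrightarrow> x \<in> G"
proof
  assume "x \<in> G"
  then show "multiple 1 G x" unfolding multiple_def by (intro bexI[of _ x]) auto
qed (rule multiple_imp_G)

text \<open>The quotient of the integer remainder by \<open>n\<close> moves into \<open>y\<close>,
  so every coset of \<open>n W\<close> in \<open>W\<close> is named by one of the residues below
  \<open>n\<close>.\<close>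

lemma divisible_mod:
  assumes "W \<in> {UNIV, G}" "x \<in> W" "n > 0"
  obtains y k where "y \<in> W" "0 \<le> k" "k < n" "null (x - of_int n * y - of_int k)"
proof -
  obtain y k where y: "y \<in> W" "null (x - of_int n * y - of_int k)"
    using divisible[OF assms] by blast
  have "y + of_int (k div n) \<in> W"
    using y(1) assms(1) G_add G_of_int by auto
  moreover have "(of_int k :: 't) = of_int (n * (k div n) + k mod n)" by simp
  then have "x - of_int n * (y + of_int (k div n)) - of_int (k mod n) = x - of_int n * y - of_int k"
    unfolding of_int_add of_int_mult by (simp add: algebra_simps)
  ultimately show thesis
    using that[of "y + of_int (k div n)" "k mod n"] assms(3) y(2)
    by (metis pos_mod_sign pos_mod_bound)
qed

lemma multiple_shift:
  assumes "W \<in> {UNIV, G}" "n dvd k" "g \<in> W" "null (x - y - of_int k * g)"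
  shows "multiple n W x \<longleftrightarrow> multiple n W y"
proof -
  have *: "multiple n W x"
    if h: "multiple n W y" "g \<in> W" "null (x - y - of_int k * g)" for x y g
  proof -
    obtain h where "h \<in> W" "null (y - of_int n * h)" using h by (auto simp: multiple_def)
    moreover obtain b where "k = n * b" using assms(2) by blast
    then have "x - of_int n * (h + of_int b * g)
        = (y - of_int n * h) + (x - y - of_int k * g)"
      by (simp add: algebra_simps)
    moreover have "h + of_int b * g \<in> W"
      using \<open>h \<in> W\<close> h(2) assms(1) G_add G_of_int_mult by auto
    ultimately show ?thesis unfolding multiple_def using h(3) null_add by metis
  qed
  have "- g \<in> W" using assms(1,3) G_uminus by auto
  moreover have "y - x - of_int k * (- g) = - (x - y - of_int k * g)" by simp
  then have "null (y - x - of_int k * (- g))" using assms(4) by (simp only: null_minus)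
  ultimately show ?thesis using * assms(3,4) by blast
qed

text \<open>Density of \<open>K M G\<close>, applied to the interval translated by
  \<open>- K z\<close>: the coset \<open>z + M G\<close> remains dense after multiplication by
  \<open>K\<close>.\<close>

lemma dense_coset:
  assumes "pos (\<beta> - \<alpha>)" "K > 0" "M > 0"
  obtains g where "g \<in> G" "pos (of_int K * (z + of_int M * g) - \<alpha>)"
    "pos (\<beta> - of_int K * (z + of_int M * g))"
proof -
  have "pos ((\<beta> - of_int K * z) - (\<alpha> - of_int K * z))" using assms(1) by simp
  moreover have "K * M > 0" using assms by simp
  ultimately obtain g where "g \<in> G" "pos (of_int (K * M) * g - (\<alpha> - of_int K * z))"
    "pos ((\<beta> - of_int K * z) - of_int (K * M) * g)"
    using dense by blast
  then show thesis using that[of g] by (simp add: algebra_simps)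
qed

text \<open>Infinite index gives an \<open>x\<close> outside all cosets \<open>f + G\<close>.
  Dividing \<open>x\<close> by \<open>K * K\<close> leaves an integer, and integers lie in
  \<open>G\<close>, so \<open>K (K y + j)\<close> is in \<open>x + G\<close> for every
  \<open>j\<close>; the residue \<open>j\<close> is therefore free. A shift of
  \<open>K y + j\<close> by an element of \<open>K G\<close> then reaches the interval without
  leaving the coset of \<open>G\<close>.\<close>

lemma dense_generic:
  assumes "pos (\<beta> - \<alpha>)" "K > 0" "finite F"
  obtains y where "pos (of_int K * (of_int K * y + of_int j) - \<alpha>)"
    "pos (\<beta> - of_int K * (of_int K * y + of_int j))"
    "\<And>f. f \<in> F \<Longrightarrow> of_int K * (of_int K * y + of_int j) - f \<notin> G"
proof -
  obtain x where x: "\<And>f. f \<in> F \<Longrightarrow> x - f \<notin> G"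
    using infinite_index[OF assms(3)] by blast
  have "K * K > 0" using assms(2) by simp
  then obtain y k where y: "null (x - of_int (K * K) * y - of_int k)"
    using divisible[of UNIV x "K * K"] by auto
  obtain g where g: "g \<in> G" "pos (of_int K * ((of_int K * y + of_int j) + of_int K * g) - \<alpha>)"
    "pos (\<beta> - of_int K * ((of_int K * y + of_int j) + of_int K * g))"
    using dense_coset[OF assms(1,2,2)] by blast
  let ?X = "of_int K * (of_int K * (y + g) + of_int j) :: 't"
  have "of_int (K * K) * g + of_int (K * j - k) - (x - of_int (K * K) * y - of_int k) \<in> G"
    using G_diff[OF G_add[OF G_of_int_mult[OF g(1)] G_of_int] G_null[OF y]] .
  moreover have "of_int (K * K) * g + of_int (K * j - k) - (x - of_int (K * K) * y - of_int k)
      = (?X - f) - (x - f)" for f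
    by (simp add: algebra_simps)
  ultimately have "?X - f \<notin> G" if "f \<in> F" for f
    using x[OF that] G_cong by metis
  then show thesis using that[of "y + g"] g(2,3) by (simp add: algebra_simps)
qed

section \<open>Bounded equivalence of valuations and its extension by one coordinate\<close>

definition eqv :: "nat \<Rightarrow> int \<Rightarrow> (nat \<Rightarrow> 't) \<Rightarrow> (nat \<Rightarrow> 't) \<Rightarrow> bool" where
  "eqv m N v w \<longleftrightarrow> (\<forall>c. (\<forall>i\<le>m. \<bar>c i\<bar> \<le> N) \<longrightarrow>
     (pos (lin m c v) \<longleftrightarrow> pos (lin m c w)) \<and>
     (\<forall>n\<in>{1..N}. \<forall>W\<in>{UNIV, G}. multiple n W (lin m c v) \<longleftrightarrow> multiple n W (lin m c w)))"

lemma eqv_pos: "eqv m N v w \<Longrightarrow> (\<And>i. i \<le> m \<Longrightarrow> \<bar>c i\<bar> \<le> N) \<Longrightarrow> pos (lin m c v) \<longleftrightarrow> pos (lin m c w)"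
  by (simp add: eqv_def)

lemma eqv_multiple:
  "eqv m N v w \<Longrightarrow> (\<And>i. i \<le> m \<Longrightarrow> \<bar>c i\<bar> \<le> N) \<Longrightarrow> 1 \<le> n \<Longrightarrow> n \<le> N \<Longrightarrow> W \<in> {UNIV, G} \<Longrightarrow>
    multiple n W (lin m c v) \<longleftrightarrow> multiple n W (lin m c w)"
  unfolding eqv_def by (meson atLeastAtMost_iff)

lemma eqv_mono: "eqv m N' v w \<Longrightarrow> N \<le> N' \<Longrightarrow> eqv m N v w"
  unfolding eqv_def by (meson atLeastAtMost_iff order_trans)

lemma eqv_sym: "eqv m N v w \<Longrightarrow> eqv m N w v"
  unfolding eqv_def by blast

lemma eqv_refl: "eqv m N v v"
  unfolding eqv_def by blast

text \<open>The sign of \<open>a x + c\<close> is that of \<open>b (a x + c)\<close> for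
  \<open>b = K / \<bar>a\<bar>\<close>, hence a comparison of \<open>K x\<close> with a combination
  having coefficients up to \<open>K N\<close>. So the cut of the single element \<open>K x\<close>
  settles the bounded signs for all \<open>a\<close> at once, and only divisibility remains as a
  separate hypothesis.\<close>

lemma eqv_updI:
  assumes j: "j \<le> m" and K: "K > 0" "\<And>n. 1 \<le> n \<Longrightarrow> n \<le> N \<Longrightarrow> n dvd K"
    and base: "eqv m N v w"
    and cut: "\<And>p. (\<And>i. i \<le> m \<Longrightarrow> \<bar>p i\<bar> \<le> K * N) \<Longrightarrow> p j = 0 \<Longrightarrow>
       (pos (of_int K * x - lin m p v) \<longleftrightarrow> pos (of_int K * x' - lin m p w)) \<and>
       (pos (lin m p v - of_int K * x) \<longleftrightarrow> pos (lin m p w - of_int K * x'))"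
    and div: "\<And>c a n W. (\<And>i. i \<le> m \<Longrightarrow> \<bar>c i\<bar> \<le> N) \<Longrightarrow> c j = 0 \<Longrightarrow> a \<noteq> 0 \<Longrightarrow> \<bar>a\<bar> \<le> N \<Longrightarrow>
       1 \<le> n \<Longrightarrow> n \<le> N \<Longrightarrow> W \<in> {UNIV, G} \<Longrightarrow>
       multiple n W (of_int a * x + lin m c v) \<longleftrightarrow> multiple n W (of_int a * x' + lin m c w)"
  shows "eqv m N (v(j := x)) (w(j := x'))"
  unfolding eqv_def
proof (intro allI impI)
  fix c :: "nat \<Rightarrow> int"
  assume c: "\<forall>i\<le>m. \<bar>c i\<bar> \<le> N"
  define c' where "c' = c(j := 0)"
  have c0: "\<bar>c' i\<bar> \<le> N" if "i \<le> m" for i using c that by (cases "i = j") (fastforce simp: c'_def)+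
  have c'j: "c' j = 0" by (simp add: c'_def)
  note upd = lin_upd[OF j, of c, folded c'_def]
  have mult: "multiple n W (lin m c (v(j := x))) \<longleftrightarrow> multiple n W (lin m c (w(j := x')))"
    if "1 \<le> n" "n \<le> N" "W \<in> {UNIV, G}" for n W
  proof (cases "c j = 0")
    case True
    then show ?thesis using eqv_multiple[OF base, of c' n W] c0 that by (simp add: upd)
  next
    case False
    then show ?thesis using div[of c' "c j", OF c0 c'j _ _ that] c j by (simp add: upd)
  qed
  have ps: "pos (lin m c (v(j := x))) \<longleftrightarrow> pos (lin m c (w(j := x')))"
  proof (cases "c j" "0::int" rule: linorder_cases)
    case equal
    then show ?thesis using eqv_pos[OF base, of c'] c0 by (simp add: upd)
  next
    case greater
    then obtain b where b: "K = c j * b" using K(2)[of "c j"] c j by (fastforce simp: dvd_def)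
    have b0: "b > 0" using b greater K(1) by (simp add: zero_less_mult_iff)
    have bK: "b \<le> K" using b b0 greater by simp
    have "\<bar>-b * c' i\<bar> \<le> K * N" if "i \<le> m" for i
      using mult_mono[OF bK c0[OF that]] b0 K(1) by (simp add: abs_mult)
    then have "pos (of_int K * x - lin m (\<lambda>i. -b * c' i) v)
       \<longleftrightarrow> pos (of_int K * x' - lin m (\<lambda>i. -b * c' i) w)"
      using c'j cut[of "\<lambda>i. -b * c' i"] by simp
    moreover have "pos (of_int K * y - lin m (\<lambda>i. -b * c' i) z)
       \<longleftrightarrow> pos (of_int (c j) * y + lin m c' z)" for y z
    proof -
      have "of_int K * y - lin m (\<lambda>i. -b * c' i) z = of_int b * (of_int (c j) * y + lin m c' z)"
        unfolding lin_scale b by (simp add: algebra_simps)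
      then show ?thesis using pos_scale[OF b0] by simp
    qed
    ultimately show ?thesis by (simp add: upd)
  next
    case less
    then obtain b where b: "K = - c j * b" using K(2)[of "- c j"] c j by (fastforce simp: dvd_def)
    have b0: "b > 0" using b less K(1) by (simp add: zero_less_mult_iff mult_less_0_iff)
    have "b \<le> - c j * b" using b0 less mult_right_mono[of 1 "- c j" b] by simp
    then have bK: "b \<le> K" using b by simp
    have "\<bar>b * c' i\<bar> \<le> K * N" if "i \<le> m" for i
      using mult_mono[OF bK c0[OF that]] b0 K(1) by (simp add: abs_mult)
    then have "pos (lin m (\<lambda>i. b * c' i) v - of_int K * x)
       \<longleftrightarrow> pos (lin m (\<lambda>i. b * c' i) w - of_int K * x')"
      using c'j cut[of "\<lambda>i. b * c' i"] by simp
    moreover have "pos (lin m (\<lambda>i. b * c' i) z - of_int K * y)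
       \<longleftrightarrow> pos (of_int (c j) * y + lin m c' z)" for y z
    proof -
      have "lin m (\<lambda>i. b * c' i) z - of_int K * y = of_int b * (of_int (c j) * y + lin m c' z)"
        unfolding lin_scale b by (simp add: algebra_simps)
      then show ?thesis using pos_scale[OF b0] by simp
    qed
    ultimately show ?thesis by (simp add: upd)
  qed
  show "(pos (lin m c (v(j := x))) \<longleftrightarrow> pos (lin m c (w(j := x')))) \<and>
     (\<forall>n\<in>{1..N}. \<forall>W\<in>{UNIV, G}.
        multiple n W (lin m c (v(j := x))) \<longleftrightarrow> multiple n W (lin m c (w(j := x'))))"
    using ps mult by auto
qed

text \<open>Extensional functions make this set finite; coordinate \<open>j\<close>, that of the
  variable being replaced, is kept out by the coefficient \<open>0\<close>.\<close>

definition combs :: "nat \<Rightarrow> nat \<Rightarrow> int \<Rightarrow> (nat \<Rightarrow> int) set" where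
  "combs m j B = {p \<in> {..m} \<rightarrow>\<^sub>E {-B..B}. p j = 0}"

lemma finite_combs: "finite (combs m j B)"
  unfolding combs_def by (rule finite_subset[of _ "{..m} \<rightarrow>\<^sub>E {-B..B}"]) (auto intro: finite_PiE)

lemma combsD: "p \<in> combs m j B \<Longrightarrow> p j = 0" "p \<in> combs m j B \<Longrightarrow> i \<le> m \<Longrightarrow> \<bar>p i\<bar> \<le> B"
  unfolding combs_def by (auto simp: PiE_def Pi_def abs_le_iff minus_le_iff)

lemma combs_ex:
  assumes "\<forall>i\<le>m. \<bar>p i\<bar> \<le> B" "p j = 0" "j \<le> m"
  shows "\<exists>q\<in>combs m j B. \<forall>v. lin m q v = lin m p v"
proof (intro bexI allI)
  show "restrict p {..m} \<in> combs m j B"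
    using assms by (force simp: combs_def PiE_def Pi_def abs_le_iff)
  show "lin m (restrict p {..m}) v = lin m p v" for v
    by (rule lin_cong) auto
qed


text \<open>The step of the back-and-forth; since \<open>eqv\<close> is symmetric it serves in both
  directions. The cases are: \<open>K x\<close> is a bounded combination, it lies in the
  \<open>G\<close>-coset of one, or it avoids all these cosets. In the first case \<open>x'\<close>
  is forced; in the others it only has to hit an open gap within a prescribed class, which is
  dense.\<close>

lemma eqv_extend:
  fixes N :: int
  assumes N: "N \<ge> 1" and jm: "j < m"
  shows "\<exists>N'\<ge>N. \<forall>v w x. v m = 1 \<longrightarrow> w m = 1 \<longrightarrow> eqv m N' v w \<longrightarrow> unit_rep x \<longrightarrow>
           (\<exists>x'. unit_rep x' \<and> eqv m N (v(j := x)) (w(j := x')))"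
proof -
  define K :: int where "K = fact (nat N)"
  have K1: "K \<ge> 1" unfolding K_def by simp
  have Kdvd: "n dvd K" if "1 \<le> n" "n \<le> N" for n
    unfolding K_def using that by (rule int_dvd_fact)
  \<comment> \<open>\<open>Q\<close> leaves room above \<open>K N\<close> for a residue modulo
    \<open>K * K\<close>, which the coset case adds to the coefficient of the unit.
    \<open>N'\<close> covers differences of two such combinations (\<open>2 * Q\<close>), the
    combinations \<open>a q + K c\<close> that decide divisibility (\<open>N * Q + K * N\<close>),
    and moduli up to \<open>K N\<close>.\<close>
  define Q where "Q = K * N + K * K"
  define N' where "N' = N * Q + K * N + 2 * Q"
  have Q0: "0 \<le> K * N" "K * N \<le> Q" "0 \<le> Q" "N + N * K \<le> N * Q" "N \<le> N * Q" "K \<le> K * N"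
    "Q \<le> N * Q"
  proof -
    show "0 \<le> K * N" using N K1 by simp
    then show "K * N \<le> Q" "0 \<le> Q" using K1 by (auto simp: Q_def)
    have "1 * 1 \<le> K * N" "K * 1 \<le> K * K" using N K1 by (intro mult_mono; simp)+
    then have "1 + K \<le> Q" by (simp add: Q_def)
    then have "N * (1 + K) \<le> N * Q" using N by (intro mult_left_mono) auto
    then show "N + N * K \<le> N * Q" by (simp add: algebra_simps)
    then show "N \<le> N * Q" using \<open>0 \<le> K * N\<close> by (simp add: mult.commute)
    show "K \<le> K * N" using N K1 by simp
    show "Q \<le> N * Q" using N \<open>0 \<le> Q\<close> mult_right_mono[of 1 N Q] by simp
  qed
  then have NN': "N \<le> N'" "2 * Q \<le> N'" "N * Q + K * N \<le> N'" "N + N * K \<le> N'" "K * N \<le> N'" "K \<le> N'"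
    using N unfolding N'_def by linarith+
  show ?thesis
  proof (intro exI[of _ N'] conjI allI impI)
    fix v w :: "nat \<Rightarrow> 't" and x
    assume vm: "v m = 1" and wm: "w m = 1" and E: "eqv m N' v w" and x: "unit_rep x"
    define P where "P p \<longleftrightarrow> (\<forall>i\<le>m. \<bar>p i\<bar> \<le> Q) \<and> p j = (0::int)" for p
    have cmp: "pos (lin m p v - lin m q v) \<longleftrightarrow> pos (lin m p w - lin m q w)" if "P p" "P q" for p q
    proof -
      have "\<bar>p i - q i\<bar> \<le> N'" if "i \<le> m" for i
        using \<open>P p\<close> \<open>P q\<close> that NN'(2) unfolding P_def
        by (smt (verit, best))
      then show ?thesis using eqv_pos[OF E, of "\<lambda>i. p i - q i"] unfolding lin_diff by simp
    qed
    \<comment> \<open>If \<open>K z\<close> is the combination \<open>q\<close>, then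
      \<open>a z + c\<close> lies in \<open>n W\<close> exactly if \<open>a q + K c\<close>, where
      \<open>z\<close> no longer occurs, lies in \<open>K n W\<close>.\<close>
    have transfer: "multiple n W (of_int a * z + lin m c v) \<longleftrightarrow> multiple n W (of_int a * z' + lin m c w)"
      if q: "P q" and z: "null (of_int K * z - lin m q v)" "null (of_int K * z' - lin m q w)"
        and c: "\<And>i. i \<le> m \<Longrightarrow> \<bar>c i\<bar> \<le> N" and a: "\<bar>a\<bar> \<le> N" and n: "1 \<le> n" "n \<le> N" and W: "W \<in> {UNIV, G}"
      for q z z' c a n W
    proof -
      let ?d = "\<lambda>i. a * q i + K * c i"
      have d: "\<bar>?d i\<bar> \<le> N'" if "i \<le> m" for i
      proof -
        have "\<bar>a * q i\<bar> \<le> N * Q" "\<bar>K * c i\<bar> \<le> K * N"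
          using mult_mono[OF a, of "\<bar>q i\<bar>" Q] q that N c[OF that] K1
          by (auto simp: P_def abs_mult)
        then show ?thesis using NN'(3) by linarith
      qed
      have red: "multiple n W (of_int a * y + lin m c u) \<longleftrightarrow> multiple (K * n) W (lin m ?d u)"
        if "null (of_int K * y - lin m q u)" for y u
      proof -
        have "null (of_int a * (of_int K * y - lin m q u))" using that by (rule null_mult)
        moreover have "of_int a * (of_int K * y - lin m q u)
            = of_int K * (of_int a * y + lin m c u) - lin m ?d u"
          unfolding lin_add lin_scale by (simp add: algebra_simps)
        ultimately have "null (of_int K * (of_int a * y + lin m c u) - lin m ?d u)" by simp
        then have "multiple (K * n) W (of_int K * (of_int a * y + lin m c u))
            \<longleftrightarrow> multiple (K * n) W (lin m ?d u)" by (rule multiple_null)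
        then show ?thesis using multiple_scale[of K n W] K1 by simp
      qed
      have "1 * 1 \<le> K * n"
        using K1 n by (intro mult_mono; simp)
      moreover have "K * n \<le> N'"
        using order_trans[OF mult_left_mono[OF n(2)] NN'(5)] K1 by simp
      ultimately show ?thesis
        using red[OF z(1)] red[OF z(2)] eqv_multiple[OF E, of ?d "K * n" W, OF d _ _ W] by simp
    qed
    \<comment> \<open>Membership of \<open>x'\<close> in [0, 1) is inherited: \<open>- x\<close> and
      \<open>1 - x\<close> are combinations with coefficients at most 1 in absolute value.\<close>
    have goalI: "\<exists>x'. unit_rep x' \<and> eqv m N (v(j := x)) (w(j := x'))"
      if "eqv m N (v(j := x)) (w(j := x'))" for x'
    proof (intro exI conjI)
      let ?a = "\<lambda>i. if i = j then -1 else 0::int" and ?b = "\<lambda>i. if i = j then -1 else if i = m then 1 else 0::int"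
      have a: "lin m ?a (u(j := y)) = - y" for u y
        using lin_upd[of j m ?a u y] jm by (simp add: fun_upd_def cong: if_cong)
      have b: "lin m ?b (u(j := y)) = 1 - y" if "u m = 1" for u y
      proof -
        have "lin m (?b(j := 0)) u = lin m ((\<lambda>i. 0)(m := (\<lambda>i. 0) m + 1)) u"
          using jm by (intro lin_cong) auto
        also have "\<dots> = 1" using that by (subst lin_upd_coeff) auto
        finally show ?thesis using lin_upd[of j m ?b u y] jm by simp
      qed
      have "pos (lin m ?a (v(j := x))) \<longleftrightarrow> pos (lin m ?a (w(j := x')))"
           "pos (lin m ?b (v(j := x))) \<longleftrightarrow> pos (lin m ?b (w(j := x')))"
        using N by (intro eqv_pos[OF that]; simp)+
      then show "unit_rep x'" using x unfolding unit_rep_def a b[of v, OF vm] b[of w, OF wm] by simp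
    qed (rule that)
    have updI: "eqv m N (v(j := x)) (w(j := x'))"
      if "\<And>p. P p \<Longrightarrow> (pos (of_int K * x - lin m p v) \<longleftrightarrow> pos (of_int K * x' - lin m p w)) \<and>
            (pos (lin m p v - of_int K * x) \<longleftrightarrow> pos (lin m p w - of_int K * x'))"
        and "\<And>c a n W. (\<And>i. i \<le> m \<Longrightarrow> \<bar>c i\<bar> \<le> N) \<Longrightarrow> c j = 0 \<Longrightarrow> a \<noteq> 0 \<Longrightarrow> \<bar>a\<bar> \<le> N \<Longrightarrow>
       1 \<le> n \<Longrightarrow> n \<le> N \<Longrightarrow> W \<in> {UNIV, G} \<Longrightarrow>
       multiple n W (of_int a * x + lin m c v) \<longleftrightarrow> multiple n W (of_int a * x' + lin m c w)"
      for x'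
    proof (rule eqv_updI[where K = K])
      show "eqv m N v w" using E NN'(1) by (rule eqv_mono)
      fix p assume "\<And>i. i \<le> m \<Longrightarrow> \<bar>p i\<bar> \<le> K * N" "p j = (0::int)"
      then have "P p" unfolding P_def using Q0(2) by fastforce
      then show "(pos (of_int K * x - lin m p v) \<longleftrightarrow> pos (of_int K * x' - lin m p w)) \<and>
            (pos (lin m p v - of_int K * x) \<longleftrightarrow> pos (lin m p w - of_int K * x'))"
        by (rule that(1))
    qed (use jm K1 Kdvd that(2) in auto)
    show "\<exists>x'. unit_rep x' \<and> eqv m N (v(j := x)) (w(j := x'))"
    proof (cases "\<exists>p. P p \<and> null (of_int K * x - lin m p v)")
      case True
      then obtain p where p: "P p" "null (of_int K * x - lin m p v)" by blast
      \<comment> \<open>Divisibility of the combination by \<open>K\<close> is part of the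
        equivalence, so it can be divided over \<open>w\<close> as well.\<close>
      have "multiple K UNIV (lin m p v)"
        unfolding multiple_def using p(2) null_diff_commute by blast
      moreover have pN: "\<bar>p i\<bar> \<le> N'" if "i \<le> m" for i using p(1) that NN'(2) Q0(3) unfolding P_def by fastforce
      ultimately have "multiple K UNIV (lin m p w)"
        using eqv_multiple[OF E, of p K UNIV] K1 NN'(6) by simp
      then obtain x' where x': "null (of_int K * x' - lin m p w)"
        unfolding multiple_def using null_diff_commute by blast
      have "eqv m N (v(j := x)) (w(j := x'))"
      proof (rule updI)
        fix q assume q: "P q"
        have n: "null ((of_int K * x - lin m q v) - (lin m p v - lin m q v))"
             "null ((lin m q v - of_int K * x) - (lin m q v - lin m p v))"
             "null ((of_int K * x' - lin m q w) - (lin m p w - lin m q w))"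
             "null ((lin m q w - of_int K * x') - (lin m q w - lin m p w))"
          using p(2) x' null_diff_commute by auto
        show "(pos (of_int K * x - lin m q v) \<longleftrightarrow> pos (of_int K * x' - lin m q w)) \<and>
            (pos (lin m q v - of_int K * x) \<longleftrightarrow> pos (lin m q w - of_int K * x'))"
          unfolding n[THEN pos_cong] using cmp[OF p(1) q] cmp[OF q p(1)] by simp
      qed (use transfer[OF p x'] in blast)
      then show ?thesis by (rule goalI)
    next
      case False
      \<comment> \<open>The combinations \<open>0\<close> and \<open>K\<close> enclose
        \<open>K x\<close>, because \<open>x\<close> is in [0, 1); so the gap around
        \<open>K x\<close> has an endpoint on either side.\<close>
      let ?z = "\<lambda>i. 0 :: int" and ?t = "\<lambda>i. if i = m then K else 0"
      have P0: "P ?z" using Q0(3) by (simp add: P_def)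
      have "K \<le> Q" using Q0(2,6) by linarith
      then have Pt: "P ?t" using Q0(3) K1 jm by (simp add: P_def)
      have t: "lin m ?t u = of_int K" if "u m = 1" for u
      proof -
        have "lin m ?t u = lin m (?z(m := ?z m + K)) u" by (rule lin_cong) auto
        then show ?thesis using that by (subst (asm) lin_upd_coeff) auto
      qed
      let ?S1 = "{p \<in> combs m j Q. pos (of_int K * x - lin m p v)}"
      let ?S2 = "{p \<in> combs m j Q. pos (lin m p v - of_int K * x)}"
      have PS: "\<exists>q. q \<in> combs m j Q \<and> lin m q v = lin m p v \<and> lin m q w = lin m p w" if "P p" for p
        using combs_ex[of m p Q j] that jm unfolding P_def by fastforce
      have SP: "P p" if "p \<in> combs m j Q" for p using that combsD unfolding P_def by blast
      have "\<not> pos (- x)" "\<not> null x" "pos (1 - x)"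
        using x False P0 null_scale[of K x] K1 by (auto simp: unit_rep_def)
      then have "pos (of_int K * x)" "pos (of_int K * (1 - x))"
        using K1 pos_scale[of K] by (auto simp: null_def)
      then have "pos (of_int K * x - lin m ?z v)" "pos (lin m ?t v - of_int K * x)"
        using t[of v, OF vm] by (auto simp: algebra_simps)
      then have "?S1 \<noteq> {}" "?S2 \<noteq> {}" using PS[OF P0] PS[OF Pt] by auto
      moreover have "finite ?S1" "finite ?S2" using finite_combs by auto
      ultimately obtain p1 p2 where p1: "p1 \<in> ?S1" "\<forall>p\<in>?S1. \<not> pos (lin m p v - lin m p1 v)"
        and p2: "p2 \<in> ?S2" "\<forall>p\<in>?S2. \<not> pos ((- lin m p v) - (- lin m p2 v))"
        using finite_max[of ?S1 "\<lambda>p. lin m p v"] finite_max[of ?S2 "\<lambda>p. - lin m p v"] by meson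
      have Pp: "P p1" "P p2" using p1 p2 SP by auto
      have "pos (lin m p2 v - lin m p1 v)" using p1(1) p2(1) lt_trans by blast
      then have gap: "pos (lin m p2 w - lin m p1 w)" using cmp Pp by simp
      have cut: "(pos (of_int K * x - lin m p v) \<longleftrightarrow> pos (of_int K * x' - lin m p w)) \<and>
            (pos (lin m p v - of_int K * x) \<longleftrightarrow> pos (lin m p w - of_int K * x'))"
        if p: "P p" and x': "pos (of_int K * x' - lin m p1 w)" "pos (lin m p2 w - of_int K * x')" for p x'
      proof (cases "pos (of_int K * x - lin m p v)")
        case True
        then have "\<not> pos (lin m p v - lin m p1 v)" using PS[OF p] p1(2) by auto
        then have "\<not> pos (lin m p w - lin m p1 w)" using cmp p Pp by simp
        then have "pos (of_int K * x' - lin m p w)" using x'(1) leq_lt_trans by blast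
        then show ?thesis using True lt_imp_leq by blast
      next
        case F: False
        then have T: "pos (lin m p v - of_int K * x)" using False p by (auto simp: null_def)
        then have "\<not> pos (lin m p2 v - lin m p v)" using PS[OF p] p2(2) by auto
        then have "\<not> pos (lin m p2 w - lin m p w)" using cmp p Pp by simp
        then have "pos (lin m p w - of_int K * x')" using x'(2) lt_leq_trans by blast
        then show ?thesis using T lt_imp_leq by blast
      qed
      show ?thesis
      proof (cases "\<exists>p. (\<forall>i\<le>m. \<bar>p i\<bar> \<le> K * N) \<and> p j = 0 \<and> of_int K * x - lin m p v \<in> G")
        case True
        then obtain p where p: "\<forall>i\<le>m. \<bar>p i\<bar> \<le> K * N" "p j = 0" "of_int K * x - lin m p v \<in> G" by blast
        \<comment> \<open>Division of the difference by \<open>K * K\<close> makes the correction of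
          \<open>x\<close> itself, \<open>K h\<close>, an element of \<open>K G\<close>. Then
          \<open>K z\<close> for \<open>z = x - K h\<close> is exactly the combination
          \<open>?q\<close>, which has absorbed the residue \<open>k\<close>.\<close>
        have "K * K > 0" using K1 by simp
        then obtain h k where h: "h \<in> G" "0 \<le> k" "k < K * K"
          "null (of_int K * x - lin m p v - of_int (K * K) * h - of_int k)"
          using divisible_mod[of G _ "K * K"] p(3) by blast
        let ?q = "p(m := p m + k)"
        have q: "P ?q" unfolding P_def
        proof (intro conjI allI impI)
          fix i assume "i \<le> m"
          then show "\<bar>?q i\<bar> \<le> Q" using p(1) h(2,3) unfolding Q_def by (smt (verit) fun_upd_apply le_refl)
        qed (use p jm in auto)
        define z where "z = x - of_int K * h"
        have "of_int K * z - lin m ?q v = of_int K * x - lin m p v - of_int (K * K) * h - of_int k"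
          using jm lin_upd_coeff[of m m p k v] vm by (simp add: z_def algebra_simps)
        then have z: "null (of_int K * z - lin m ?q v)" using h(4) by simp
        then have "multiple K UNIV (lin m ?q v)"
          unfolding multiple_def using null_diff_commute by blast
        moreover have qN: "\<bar>?q i\<bar> \<le> N'" if "i \<le> m" for i
          using q that NN'(2) Q0(3) unfolding P_def by (smt (verit))
        ultimately have "multiple K UNIV (lin m ?q w)"
          using eqv_multiple[OF E, of ?q K UNIV, OF qN] K1 NN'(6) by simp
        then obtain z' where z': "null (of_int K * z' - lin m ?q w)"
          unfolding multiple_def using null_diff_commute by blast
        \<comment> \<open>\<open>z'\<close> has the right divisibilities but perhaps the wrong
          position. A shift by \<open>K G\<close> moves it into the gap and changes no divisibility
          by an \<open>n\<close> dividing \<open>K\<close>.\<close>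
        obtain g where g: "g \<in> G" "pos (of_int K * (z' + of_int K * g) - lin m p1 w)"
          "pos (lin m p2 w - of_int K * (z' + of_int K * g))"
          using dense_coset[OF gap, of K K] K1 by auto
        have "eqv m N (v(j := x)) (w(j := z' + of_int K * g))"
        proof (rule updI)
          fix c a n and W :: "'t set"
          assume a: "\<And>i. i \<le> m \<Longrightarrow> \<bar>c i\<bar> \<le> N" "\<bar>a\<bar> \<le> N" "1 \<le> n" "n \<le> N" "W \<in> {UNIV, G}"
          have red: "multiple n W (of_int a * (y + of_int K * f) + s) \<longleftrightarrow> multiple n W (of_int a * y + s)"
            if "f \<in> G" for y f s
          proof (rule multiple_shift[OF a(5)])
            show "n dvd a * K" using Kdvd a by simp
            show "f \<in> W" using that a(5) by auto
            have "of_int a * (y + of_int K * f) + s - (of_int a * y + s) - of_int (a * K) * f = 0"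
              by (simp add: algebra_simps)
            then show "null (of_int a * (y + of_int K * f) + s - (of_int a * y + s) - of_int (a * K) * f)"
              by simp
          qed
          have "x = z + of_int K * h" by (simp add: z_def)
          then show "multiple n W (of_int a * x + lin m c v)
              \<longleftrightarrow> multiple n W (of_int a * (z' + of_int K * g) + lin m c w)"
            using red[OF h(1)] red[OF g(1)] transfer[OF q z z' a] by simp
        qed (rule cut[OF _ g(2,3)])
        then show ?thesis by (rule goalI)
      next
        case generic: False
        obtain y k where y: "null (x - of_int K * y - of_int k)" "0 \<le> k" "k < K"
          by (rule divisible_mod[of UNIV x K]) (use K1 in auto)
        let ?F = "(\<lambda>p. lin m p w) ` combs m j (K * N)"
        \<comment> \<open>\<open>x'\<close> receives the residue of \<open>x\<close> modulo
          \<open>K U\<close>, which settles \<open>W = UNIV\<close>, and avoids the finitely many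
          cosets, which makes divisibility in \<open>W = G\<close> fail on both sides.\<close>
        obtain y' where y': "pos (of_int K * (of_int K * y' + of_int k) - lin m p1 w)"
          "pos (lin m p2 w - of_int K * (of_int K * y' + of_int k))"
          and nG: "\<And>f. f \<in> ?F \<Longrightarrow> of_int K * (of_int K * y' + of_int k) - f \<notin> G"
          by (rule dense_generic[OF gap, of K ?F k]) (use K1 finite_combs in auto)
        define x' where "x' = of_int K * y' + (of_int k :: 't)"
        have nG': "of_int K * x' - lin m p w \<notin> G" if p: "\<forall>i\<le>m. \<bar>p i\<bar> \<le> K * N" "p j = 0" for p
        proof -
          obtain q where q: "q \<in> combs m j (K * N)" "lin m q w = lin m p w"
            using combs_ex[of m p "K * N" j] p jm by auto
          then have "lin m p w \<in> ?F" by (metis imageI)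
          then show ?thesis using nG unfolding x'_def by blast
        qed
        have "eqv m N (v(j := x)) (w(j := x'))"
        proof (rule updI)
          fix c a n and W :: "'t set"
          assume a: "\<And>i. i \<le> m \<Longrightarrow> \<bar>c i\<bar> \<le> N" "c j = 0" "a \<noteq> 0" "\<bar>a\<bar> \<le> N" "1 \<le> n" "n \<le> N" "W \<in> {UNIV, G}"
          show "multiple n W (of_int a * x + lin m c v) \<longleftrightarrow> multiple n W (of_int a * x' + lin m c w)"
          proof (cases "W = UNIV")
            case True
            let ?d = "c(m := c m + a * k)"
            have "\<bar>a * k\<bar> \<le> N * K" using mult_mono[OF a(4), of "\<bar>k\<bar>" K] y N by (auto simp: abs_mult)
            then have d: "\<bar>?d i\<bar> \<le> N'" if "i \<le> m" for i
              using a(1)[OF that] NN'(1,4) by auto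
            have red: "multiple n UNIV (of_int a * z + lin m c u) \<longleftrightarrow> multiple n UNIV (lin m ?d u)"
              if "null (z - of_int K * f - of_int k)" "u m = 1" for z f u
            proof (rule multiple_shift)
              show "n dvd a * K" using Kdvd a by simp
              have "of_int a * z + lin m c u - lin m ?d u - of_int (a * K) * f
                 = of_int a * (z - of_int K * f - of_int k)"
                using that(2) lin_upd_coeff[of m m c "a * k" u] by (simp add: algebra_simps)
              then show "null (of_int a * z + lin m c u - lin m ?d u - of_int (a * K) * f)"
                using null_mult[OF that(1)] by simp
            qed auto
            show ?thesis
              using red[of x y v, OF y(1) vm] red[of x' y' w] wm eqv_multiple[OF E, of ?d n UNIV, OF d] a NN'(1) True
              by (simp add: x'_def)
          next
            case False
            then have W: "W = G" using a by simp
            \<comment> \<open>A value \<open>a x + c\<close> in \<open>G\<close> would put its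
              multiple \<open>K x + b c\<close> into \<open>G\<close>, against genericity.\<close>
            have "\<bar>a\<bar> dvd K" using Kdvd[of "\<bar>a\<bar>"] a(3,4) by linarith
            then obtain b where b: "K = a * b" and bK: "\<bar>b\<bar> \<le> K"
              by (rule cofactor_bound) (use a(3) K1 in auto)
            let ?p = "\<lambda>i. (- b) * c i"
            have "\<bar>?p i\<bar> \<le> K * N" if "i \<le> m" for i
              using mult_mono[OF bK a(1)[OF that]] K1 by (simp add: abs_mult)
            moreover have "?p j = 0" using a(2) by simp
            ultimately have "of_int K * x - lin m ?p v \<notin> G" "of_int K * x' - lin m ?p w \<notin> G"
              using generic[unfolded not_ex, THEN spec, of ?p] nG'[of ?p] by simp_all
            moreover have "of_int K * u - lin m ?p s = of_int b * (of_int a * u + lin m c s)" for u s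
              unfolding lin_scale b by (simp add: algebra_simps)
            ultimately have "of_int b * (of_int a * x + lin m c v) \<notin> G"
              "of_int b * (of_int a * x' + lin m c w) \<notin> G" by simp_all
            then have "of_int a * x + lin m c v \<notin> G" "of_int a * x' + lin m c w \<notin> G"
              using G_of_int_mult by blast+
            then show ?thesis unfolding W using multiple_imp_G by blast
          qed
        qed (rule cut[OF _ y'[folded x'_def]])
        then show ?thesis by (rule goalI)
      qed
    qed
  qed (rule NN'(1))
qed

end

section \<open>Invariance of formulas\<close>

text \<open>Bound variables count too: coordinate \<open>m\<close> of a valuation is reserved for
  the unit, and a quantifier must not overwrite it.\<close>

primrec vars :: "fm \<Rightarrow> nat set" where
  "vars (Equal s t) = fv_tm s \<union> fv_tm t"
| "vars (Ori r s t) = fv_tm r \<union> fv_tm s \<union> fv_tm t"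
| "vars (Pred t) = fv_tm t"
| "vars (Neg \<phi>) = vars \<phi>"
| "vars (Conj \<phi> \<psi>) = vars \<phi> \<union> vars \<psi>"
| "vars (Exi n \<phi>) = insert n (vars \<phi>)"

lemma finite_fv_tm: "finite (fv_tm t)"
  by (induction t) auto

lemma finite_vars: "finite (vars \<phi>)"
  by (induction \<phi>) (auto simp: finite_fv_tm)

primrec tm_coeff :: "tm \<Rightarrow> nat \<Rightarrow> int" where
  "tm_coeff (Var n) = (\<lambda>i. if i = n then 1 else 0)"
| "tm_coeff Zero = (\<lambda>i. 0)"
| "tm_coeff (Plus s t) = (\<lambda>i. tm_coeff s i + tm_coeff t i)"
| "tm_coeff (Minus t) = (\<lambda>i. - tm_coeff t i)"

text \<open>\<open>proj\<close> is the quotient map by the integers, up to null elements, and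
  \<open>lift\<close> picks representatives in [0, 1). On these the cyclic order is the linear order
  read cyclically, which is all that \<open>proj_ori\<close> says; for other arguments integer parts
  have to be subtracted first.\<close>

locale cover_model = dense_cover pos G
  for pos :: "'t::comm_ring_1 \<Rightarrow> bool" and G :: "'t set" +
  fixes M :: "'a pair_structure" and proj :: "'t \<Rightarrow> 'a" and lift :: "'a \<Rightarrow> 't"
  assumes proj_closed: "proj x \<in> carrier M"
    and proj_add: "proj (x + y) = proj x \<otimes>\<^bsub>M\<^esub> proj y"
    and proj_zero: "proj 0 = \<one>\<^bsub>M\<^esub>"
    and proj_uminus: "proj (- x) = inv\<^bsub>M\<^esub> (proj x)"
    and proj_eq: "proj x = proj y \<longleftrightarrow> (\<exists>k::int. null (x - y - of_int k))"
    and proj_lift: "a \<in> carrier M \<Longrightarrow> proj (lift a) = a"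
    and unit_rep_lift: "a \<in> carrier M \<Longrightarrow> unit_rep (lift a)"
    and proj_ori: "unit_rep x \<Longrightarrow> unit_rep y \<Longrightarrow> unit_rep z \<Longrightarrow>
       ori M (proj x) (proj y) (proj z) \<longleftrightarrow>
         pos (y - x) \<and> pos (z - y) \<or> pos (z - y) \<and> pos (x - z) \<or> pos (x - z) \<and> pos (y - x)"
    and proj_pred: "proj x \<in> pred M \<longleftrightarrow> x \<in> G"
begin

lemma eval_proj: "fv_tm t \<subseteq> {..<m} \<Longrightarrow> eval M (proj \<circ> v) t = proj (lin m (tm_coeff t) v)"
proof (induction t)
  case (Var n)
  then have "lin m (tm_coeff (Var n)) v = v n"
    by (simp add: lin_def if_distrib[of of_int] if_distrib[of "\<lambda>x. x * _"] cong: if_cong)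
  then show ?case by simp
next
  case (Minus t)
  have "lin m (tm_coeff (Minus t)) v = - lin m (tm_coeff t) v"
    by (simp add: lin_def sum_negf)
  then show ?case using Minus by (simp add: proj_uminus)
qed (auto simp: proj_zero proj_add lin_add)

lemma proj_eq_unit: "unit_rep x \<Longrightarrow> unit_rep y \<Longrightarrow> proj x = proj y \<longleftrightarrow> null (x - y)"
  unfolding proj_eq using unit_rep_unique(2) by (metis diff_zero of_int_0)

section \<open>Integer parts of bounded combinations\<close>

lemma mult_unit_bound:
  assumes x: "\<not> pos (- x)" "\<not> pos (x - 1)" and c: "\<bar>c\<bar> \<le> B"
  shows "\<not> pos (of_int c * x - of_int B)"
proof (cases c "0::int" rule: linorder_cases)
  case less
  then have "\<not> pos (of_int (- c) * (- x))" using x pos_scale[of "- c" "- x"] by simp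
  moreover have "\<not> pos (of_int (- B))" unfolding pos_of_int using c by simp
  ultimately have "\<not> pos (of_int (- c) * (- x) + of_int (- B))" by (rule nonpos_add)
  then show ?thesis by simp
next
  case equal
  have "\<not> pos (of_int (- B))" unfolding pos_of_int using c by simp
  then show ?thesis using equal by simp
next
  case greater
  then have "\<not> pos (of_int c * (x - 1))" using x pos_scale[of c "x - 1"] by simp
  moreover have "\<not> pos (of_int (c - B))" unfolding pos_of_int using c by simp
  ultimately have "\<not> pos (of_int c * (x - 1) + of_int (c - B))" by (rule nonpos_add)
  then show ?thesis by (simp add: algebra_simps)
qed

lemma lin_bound:
  assumes v: "\<And>i. i < m \<Longrightarrow> unit_rep (v i)" "v m = 1" and c: "\<And>i. i \<le> m \<Longrightarrow> \<bar>c i\<bar> \<le> B"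
  shows "\<not> pos (lin m c v - of_int (B * (int m + 1)))"
proof -
  have "\<not> pos ((\<Sum>i\<in>S. of_int (c i) * v i) - of_int (B * int (card S)))"
    if "finite S" "S \<subseteq> {..m}" for S
    using that
  proof (induction S rule: finite_induct)
    case (insert i S)
    have vi: "\<not> pos (- v i)" "\<not> pos (v i - 1)"
    proof -
      have "unit_rep (v i) \<or> v i = 1" using v insert.prems by (cases "i = m") auto
      then show "\<not> pos (- v i)" "\<not> pos (v i - 1)"
        using pos_asym[OF pos_one] lt_imp_leq unfolding unit_rep_def by auto
    qed
    have "\<not> pos (of_int (c i) * v i - of_int B)"
      using mult_unit_bound[OF vi] c insert.prems by auto
    then have "\<not> pos ((of_int (c i) * v i - of_int B) +
       ((\<Sum>i\<in>S. of_int (c i) * v i) - of_int (B * int (card S))))"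
      using insert by (intro nonpos_add) auto
    then show ?case using insert(1,2) by (simp add: algebra_simps)
  qed simp
  from this[of "{..m}"] show ?thesis by (simp add: lin_def algebra_simps)
qed

text \<open>Coordinates in [0, 1) bound the integer part \<open>k\<close> of a bounded combination.
  Subtracting \<open>k\<close> from the unit coefficient gives \<open>d\<close>. That
  \<open>d\<close> lands in [0, 1) is a matter of the signs of \<open>- d\<close> and
  \<open>1 - d\<close>, so the equivalence carries it over to \<open>w\<close>, and the same
  \<open>d\<close> normalises both sides.\<close>

lemma floor_transfer:
  assumes v: "\<And>i. i < m \<Longrightarrow> unit_rep (v i)" "v m = 1" and w: "w m = 1"
    and E: "eqv m N v w" and N: "B * (int m + 2) + 2 \<le> N" and c: "\<And>i. i \<le> m \<Longrightarrow> \<bar>c i\<bar> \<le> B"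
  obtains d where "\<And>i. i \<le> m \<Longrightarrow> \<bar>d i\<bar> \<le> B * (int m + 2) + 1"
    "unit_rep (lin m d v)" "unit_rep (lin m d w)"
    "proj (lin m d v) = proj (lin m c v)" "proj (lin m d w) = proj (lin m c w)"
proof -
  define R where "R = B * (int m + 1)"
  obtain k where k: "unit_rep (lin m c v - of_int k)" by (rule unit_rep_shift)
  have le: "\<not> pos (lin m c v - of_int R)" unfolding R_def by (rule lin_bound[of m v, OF v c])
  have "\<not> pos (lin m (\<lambda>i. (-1) * c i) v - of_int R)"
    unfolding R_def using c by (intro lin_bound[of m v, OF v]) auto
  then have ge: "\<not> pos (- lin m c v - of_int R)" unfolding lin_scale by simp
  have "\<not> pos (of_int k - lin m c v)" using k by (simp add: unit_rep_def)
  then have "\<not> pos (of_int k - of_int R)" using le by (rule leq_trans)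
  then have "\<not> pos (of_int (k - R))" by simp
  then have kR: "k \<le> R" unfolding pos_of_int by simp
  have "pos ((1 + of_int k) - lin m c v)" using k by (simp add: unit_rep_def algebra_simps)
  moreover have "\<not> pos (- of_int R - lin m c v)" using ge by (simp only: diff_conv_add_uminus add.commute[of "- lin m c v"] not_False_eq_True)
  ultimately have "pos ((1 + of_int k) - (- of_int R))" using leq_lt_trans by blast
  then have "pos (of_int (1 + k + R))" by simp
  then have kR': "- R \<le> k" unfolding pos_of_int by simp
  have R0: "0 \<le> R" using kR kR' by simp
  define d where "d = c(m := c m + (- k))"
  have "B * (int m + 2) = B + R" by (simp add: R_def algebra_simps)
  then have d: "\<bar>d i\<bar> \<le> B * (int m + 2) + 1" if "i \<le> m" for i
    using c[OF that] kR kR' R0 by (auto simp: d_def)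
  have lin_d: "lin m d u = lin m c u - of_int k" if "u m = 1" for u
    using that unfolding d_def by (subst lin_upd_coeff) auto
  define e where "e = (\<lambda>i. (-1) * d i)"
  define f where "f = e(m := e m + 1)"
  have lin_e: "lin m e u = - lin m d u" for u unfolding e_def lin_scale by simp
  have lin_f: "lin m f u = 1 - lin m d u" if "u m = 1" for u
    using that unfolding f_def by (subst lin_upd_coeff) (auto simp: lin_e)
  have "\<bar>e i\<bar> \<le> N" "\<bar>f i\<bar> \<le> N" if "i \<le> m" for i
    using d[OF that] N by (auto simp: e_def f_def)
  then have "pos (lin m e v) \<longleftrightarrow> pos (lin m e w)" "pos (lin m f v) \<longleftrightarrow> pos (lin m f w)"
    by (auto intro!: eqv_pos[OF E])
  then have "unit_rep (lin m d v) \<longleftrightarrow> unit_rep (lin m d w)"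
    unfolding unit_rep_def lin_e lin_f[of v, OF v(2)] lin_f[of w, OF w] by simp
  moreover have "unit_rep (lin m d v)" using k lin_d[of v, OF v(2)] by simp
  moreover have "proj (lin m d u) = proj (lin m c u)" if "u m = 1" for u
    unfolding proj_eq by (rule exI[of _ "- k"]) (simp add: lin_d[of u, OF that])
  ultimately show thesis using that[of d] d v(2) w by blast
qed

lemma coeff_bound: "\<exists>B. \<forall>t\<in>set ts. \<forall>i\<le>m. \<bar>tm_coeff t i\<bar> \<le> B"
proof -
  let ?S = "(\<lambda>(t, i). \<bar>tm_coeff t i\<bar>) ` (set ts \<times> {..m})"
  have "\<forall>t\<in>set ts. \<forall>i\<le>m. \<bar>tm_coeff t i\<bar> \<le> Max ?S"
    by (auto intro!: Max_ge)
  then show ?thesis by blast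
qed

lemma lin_diff_transfer:
  assumes "eqv m (2 * A) v w" "\<And>i. i \<le> m \<Longrightarrow> \<bar>c i\<bar> \<le> A" "\<And>i. i \<le> m \<Longrightarrow> \<bar>d i\<bar> \<le> A"
  shows "pos (lin m c v - lin m d v) \<longleftrightarrow> pos (lin m c w - lin m d w)"
proof -
  have "\<bar>c i - d i\<bar> \<le> 2 * A" if "i \<le> m" for i using assms(2,3)[OF that] by linarith
  then show ?thesis using eqv_pos[OF assms(1), of "\<lambda>i. c i - d i"] unfolding lin_diff by simp
qed

definition sat_invariant :: "nat \<Rightarrow> int \<Rightarrow> fm \<Rightarrow> bool" where
  "sat_invariant m N \<phi> \<longleftrightarrow> (\<forall>v w. v m = 1 \<longrightarrow> w m = 1 \<longrightarrow> (\<forall>i<m. unit_rep (v i) \<and> unit_rep (w i)) \<longrightarrow>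
     eqv m N v w \<longrightarrow> (sat M (proj \<circ> v) \<phi> \<longleftrightarrow> sat M (proj \<circ> w) \<phi>))"

lemma sat_invariantD:
  "sat_invariant m N \<phi> \<Longrightarrow> v m = 1 \<Longrightarrow> w m = 1 \<Longrightarrow> (\<And>i. i < m \<Longrightarrow> unit_rep (v i)) \<Longrightarrow>
   (\<And>i. i < m \<Longrightarrow> unit_rep (w i)) \<Longrightarrow> eqv m N v w \<Longrightarrow> sat M (proj \<circ> v) \<phi> \<longleftrightarrow> sat M (proj \<circ> w) \<phi>"
  unfolding sat_invariant_def by blast

lemma sat_invariant_mono: "sat_invariant m N \<phi> \<Longrightarrow> N \<le> N' \<Longrightarrow> sat_invariant m N' \<phi>"
  unfolding sat_invariant_def using eqv_mono by blast

lemma sat_invariant_ex: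
  "vars \<phi> \<subseteq> {..<m} \<Longrightarrow> \<exists>N\<ge>1. sat_invariant m N \<phi>"
proof (induction \<phi>)
  case (Equal s t)
  obtain B where B: "\<forall>t\<in>set [s, t]. \<forall>i\<le>m. \<bar>tm_coeff t i\<bar> \<le> B" using coeff_bound by blast
  then have "0 \<le> B" by (auto dest!: spec[of _ m])
  \<comment> \<open>The bound on normalised combinations. Equivalence is required up to
    \<open>2 * A\<close> because an atom compares two of them.\<close>
  define A where "A = B * (int m + 2) + 1"
  have A: "A \<ge> 1" "B * (int m + 2) + 2 \<le> 2 * A" using \<open>0 \<le> B\<close> by (auto simp: A_def)
  have "sat_invariant m (2 * A) (Equal s t)"
    unfolding sat_invariant_def
  proof (intro allI impI)
    fix v w :: "nat \<Rightarrow> 't"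
    assume h: "v m = 1" "w m = 1" "\<forall>i<m. unit_rep (v i) \<and> unit_rep (w i)" "eqv m (2 * A) v w"
    note fl = floor_transfer[of m v w "2 * A" B, folded A_def]
    obtain c where c: "\<And>i. i \<le> m \<Longrightarrow> \<bar>c i\<bar> \<le> A" "unit_rep (lin m c v)" "unit_rep (lin m c w)"
      "proj (lin m c v) = proj (lin m (tm_coeff s) v)" "proj (lin m c w) = proj (lin m (tm_coeff s) w)"
      using fl[of "tm_coeff s"] h A B by auto
    obtain d where d: "\<And>i. i \<le> m \<Longrightarrow> \<bar>d i\<bar> \<le> A" "unit_rep (lin m d v)" "unit_rep (lin m d w)"
      "proj (lin m d v) = proj (lin m (tm_coeff t) v)" "proj (lin m d w) = proj (lin m (tm_coeff t) w)"
      using fl[of "tm_coeff t"] h A B by auto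
    have "null (lin m c v - lin m d v) \<longleftrightarrow> null (lin m c w - lin m d w)"
      using lin_diff_transfer[OF h(4) c(1) d(1)] lin_diff_transfer[OF h(4) d(1) c(1)]
      unfolding null_def by simp
    then have "proj (lin m (tm_coeff s) v) = proj (lin m (tm_coeff t) v) \<longleftrightarrow>
       proj (lin m (tm_coeff s) w) = proj (lin m (tm_coeff t) w)"
      using proj_eq_unit[OF c(2) d(2)] proj_eq_unit[OF c(3) d(3)] c(4,5) d(4,5) by simp
    then show "sat M (proj \<circ> v) (Equal s t) \<longleftrightarrow> sat M (proj \<circ> w) (Equal s t)"
      using Equal by (simp add: eval_proj[of _ m])
  qed
  then show ?case using A by (intro exI[of _ "2 * A"]) auto
next
  case (Ori r s t)
  obtain B where B: "\<forall>t\<in>set [r, s, t]. \<forall>i\<le>m. \<bar>tm_coeff t i\<bar> \<le> B" using coeff_bound by blast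
  then have "0 \<le> B" by (auto dest!: spec[of _ m])
  define A where "A = B * (int m + 2) + 1"
  have A: "A \<ge> 1" "B * (int m + 2) + 2 \<le> 2 * A" using \<open>0 \<le> B\<close> by (auto simp: A_def)
  have "sat_invariant m (2 * A) (Ori r s t)"
    unfolding sat_invariant_def
  proof (intro allI impI)
    fix v w :: "nat \<Rightarrow> 't"
    assume h: "v m = 1" "w m = 1" "\<forall>i<m. unit_rep (v i) \<and> unit_rep (w i)" "eqv m (2 * A) v w"
    note fl = floor_transfer[of m v w "2 * A" B, folded A_def]
    obtain c where c: "\<And>i. i \<le> m \<Longrightarrow> \<bar>c i\<bar> \<le> A" "unit_rep (lin m c v)" "unit_rep (lin m c w)"
      "proj (lin m c v) = proj (lin m (tm_coeff r) v)" "proj (lin m c w) = proj (lin m (tm_coeff r) w)"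
      using fl[of "tm_coeff r"] h A B by auto
    obtain d where d: "\<And>i. i \<le> m \<Longrightarrow> \<bar>d i\<bar> \<le> A" "unit_rep (lin m d v)" "unit_rep (lin m d w)"
      "proj (lin m d v) = proj (lin m (tm_coeff s) v)" "proj (lin m d w) = proj (lin m (tm_coeff s) w)"
      using fl[of "tm_coeff s"] h A B by auto
    obtain e where e: "\<And>i. i \<le> m \<Longrightarrow> \<bar>e i\<bar> \<le> A" "unit_rep (lin m e v)" "unit_rep (lin m e w)"
      "proj (lin m e v) = proj (lin m (tm_coeff t) v)" "proj (lin m e w) = proj (lin m (tm_coeff t) w)"
      using fl[of "tm_coeff t"] h A B by auto
    have "ori M (proj (lin m c v)) (proj (lin m d v)) (proj (lin m e v)) \<longleftrightarrow>
       ori M (proj (lin m c w)) (proj (lin m d w)) (proj (lin m e w))"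
      unfolding proj_ori[OF c(2) d(2) e(2)] proj_ori[OF c(3) d(3) e(3)]
      using lin_diff_transfer[OF h(4) d(1) c(1)] lin_diff_transfer[OF h(4) e(1) d(1)]
        lin_diff_transfer[OF h(4) c(1) e(1)] by simp
    then show "sat M (proj \<circ> v) (Ori r s t) \<longleftrightarrow> sat M (proj \<circ> w) (Ori r s t)"
      using Ori c(4,5) d(4,5) e(4,5) by (simp add: eval_proj[of _ m])
  qed
  then show ?case using A by (intro exI[of _ "2 * A"]) auto
next
  case (Pred t)
  obtain B where B: "\<forall>t\<in>set [t]. \<forall>i\<le>m. \<bar>tm_coeff t i\<bar> \<le> B" using coeff_bound by blast
  have "sat_invariant m (max 1 B) (Pred t)"
    unfolding sat_invariant_def
  proof (intro allI impI)
    fix v w :: "nat \<Rightarrow> 't"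
    assume h: "eqv m (max 1 B) v w"
    have "\<bar>tm_coeff t i\<bar> \<le> max 1 B" if "i \<le> m" for i using B that by fastforce
    \<comment> \<open>No normalisation is called for here: membership in \<open>G\<close> is a
      property of the unreduced value, since \<open>G\<close> contains the integers.\<close>
    then have "multiple 1 G (lin m (tm_coeff t) v) \<longleftrightarrow> multiple 1 G (lin m (tm_coeff t) w)"
      by (intro eqv_multiple[OF h]) auto
    then show "sat M (proj \<circ> v) (Pred t) \<longleftrightarrow> sat M (proj \<circ> w) (Pred t)"
      using Pred by (simp add: eval_proj[of _ m] proj_pred multiple_1)
  qed
  then show ?case by (intro exI[of _ "max 1 B"]) auto
next
  case (Neg \<phi>)
  then show ?case by (auto simp: sat_invariant_def)
next
  case (Conj \<phi> \<psi>)
  then obtain N N' where "N \<ge> 1" "sat_invariant m N \<phi>" "sat_invariant m N' \<psi>" by auto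
  then have "sat_invariant m (max N N') \<phi>" "sat_invariant m (max N N') \<psi>" "max N N' \<ge> 1"
    using sat_invariant_mono by auto
  then show ?case unfolding sat_invariant_def sat.simps by blast
next
  case (Exi n \<phi>)
  then obtain N where N: "N \<ge> 1" "sat_invariant m N \<phi>" by auto
  have nm: "n < m" using Exi by simp
  from eqv_extend[OF N(1) nm] obtain N' where N': "N' \<ge> N"
    "\<And>v w x. v m = 1 \<Longrightarrow> w m = 1 \<Longrightarrow> eqv m N' v w \<Longrightarrow> unit_rep x \<Longrightarrow>
       \<exists>x'. unit_rep x' \<and> eqv m N (v(n := x)) (w(n := x'))" by blast
  have *: "sat M (proj \<circ> w) (Exi n \<phi>)"
    if h: "v m = 1" "w m = 1" "\<forall>i<m. unit_rep (v i) \<and> unit_rep (w i)" "eqv m N' v w"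
      "sat M (proj \<circ> v) (Exi n \<phi>)" for v w
  proof -
    obtain a where a: "a \<in> carrier M" "sat M ((proj \<circ> v)(n := a)) \<phi>" using h(5) by auto
    obtain x where x: "unit_rep x" "eqv m N (v(n := lift a)) (w(n := x))"
      using N'(2)[OF h(1,2,4) unit_rep_lift[OF a(1)]] by blast
    have "(proj \<circ> v)(n := a) = proj \<circ> v(n := lift a)" using proj_lift[OF a(1)] by (auto simp: fun_eq_iff)
    then have "sat M (proj \<circ> v(n := lift a)) \<phi>" using a(2) by simp
    then have "sat M (proj \<circ> w(n := x)) \<phi>"
      using sat_invariantD[OF N(2) _ _ _ _ x(2)] h nm x(1) unit_rep_lift[OF a(1)] by simp
    then have "sat M ((proj \<circ> w)(n := proj x)) \<phi>" by (simp add: fun_upd_comp)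
    then show ?thesis using proj_closed by auto
  qed
  have "sat_invariant m N' (Exi n \<phi>)"
    unfolding sat_invariant_def
  proof (intro allI impI)
    fix v w :: "nat \<Rightarrow> 't"
    assume h: "v m = 1" "w m = 1" "\<forall>i<m. unit_rep (v i) \<and> unit_rep (w i)" "eqv m N' v w"
    then have "\<forall>i<m. unit_rep (w i) \<and> unit_rep (v i)" by blast
    then show "sat M (proj \<circ> v) (Exi n \<phi>) \<longleftrightarrow> sat M (proj \<circ> w) (Exi n \<phi>)"
      using *[OF h] *[OF h(2,1) _ eqv_sym[OF h(4)]] by blast
  qed
  then show ?case using N N'(1) by (intro exI[of _ N']) auto
qed

end

section \<open>Definable relations\<close>

primrec rename_tm :: "(nat \<Rightarrow> nat) \<Rightarrow> tm \<Rightarrow> tm" where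
  "rename_tm f (Var n) = Var (f n)"
| "rename_tm f Zero = Zero"
| "rename_tm f (Plus s t) = Plus (rename_tm f s) (rename_tm f t)"
| "rename_tm f (Minus t) = Minus (rename_tm f t)"

text \<open>Bound variables are renamed as well; injectivity of \<open>f\<close> excludes
  capture.\<close>

primrec rename :: "(nat \<Rightarrow> nat) \<Rightarrow> fm \<Rightarrow> fm" where
  "rename f (Equal s t) = Equal (rename_tm f s) (rename_tm f t)"
| "rename f (Ori r s t) = Ori (rename_tm f r) (rename_tm f s) (rename_tm f t)"
| "rename f (Pred t) = Pred (rename_tm f t)"
| "rename f (Neg \<phi>) = Neg (rename f \<phi>)"
| "rename f (Conj \<phi> \<psi>) = Conj (rename f \<phi>) (rename f \<psi>)"
| "rename f (Exi n \<phi>) = Exi (f n) (rename f \<phi>)"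

lemma fv_rename_tm: "fv_tm (rename_tm f t) = f ` fv_tm t"
  by (induction t) auto

lemma fv_rename: "inj f \<Longrightarrow> fv (rename f \<phi>) = f ` fv \<phi>"
  by (induction \<phi>) (auto simp: fv_rename_tm inj_eq)

lemma eval_rename: "eval M v (rename_tm f t) = eval M (v \<circ> f) t"
  by (induction t) auto

lemma sat_rename: "inj f \<Longrightarrow> sat M v (rename f \<phi>) \<longleftrightarrow> sat M (v \<circ> f) \<phi>"
proof (induction \<phi> arbitrary: v)
  case (Exi n \<phi>)
  have "(v(f n := a)) \<circ> f = (v \<circ> f)(n := a)" for a
    using Exi.prems by (auto simp: fun_eq_iff inj_eq)
  then have "sat M (v(f n := a)) (rename f \<phi>) \<longleftrightarrow> sat M ((v \<circ> f)(n := a)) \<phi>" for a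
    using Exi by metis
  then show ?case by (simp only: rename.simps sat.simps)
qed (simp_all add: eval_rename)

lemma eval_cong: "(\<And>i. i \<in> fv_tm t \<Longrightarrow> v i = w i) \<Longrightarrow> eval M v t = eval M w t"
  by (induction t) auto

lemma sat_cong: "\<forall>i\<in>fv \<phi>. v i = w i \<Longrightarrow> sat M v \<phi> \<longleftrightarrow> sat M w \<phi>"
proof (induction \<phi> arbitrary: v w)
  case (Equal s t)
  then show ?case using eval_cong[of s v w M] eval_cong[of t v w M] by simp
next
  case (Ori r s t)
  then show ?case
    using eval_cong[of r v w M] eval_cong[of s v w M] eval_cong[of t v w M] by simp
next
  case (Pred t)
  then show ?case using eval_cong[of t v w M] by simp
next
  case (Neg \<phi>)
  from Neg.IH[of v w] Neg.prems show ?case by (simp del: HOL.nnf_simps)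
next
  case (Conj \<phi> \<psi>)
  from Conj.IH(1)[of v w] Conj.IH(2)[of v w] Conj.prems show ?case by (simp add: ball_Un)
next
  case (Exi n \<phi>)
  have "sat M (v(n := a)) \<phi> \<longleftrightarrow> sat M (w(n := a)) \<phi>" for a
    by (rule Exi.IH) (use Exi.prems in auto)
  then show ?case by (simp only: sat.simps)
qed

context cover_model
begin

definition assignment :: "(nat \<Rightarrow> 'a) \<Rightarrow> bool" where
  "assignment v \<longleftrightarrow> range v \<subseteq> carrier M"

lemma assignmentD: "assignment v \<Longrightarrow> v i \<in> carrier M"
  unfolding assignment_def by blast

lemma assignment_upd: "assignment v \<Longrightarrow> a \<in> carrier M \<Longrightarrow> assignment (v(k := a))"
  unfolding assignment_def by auto

text \<open>A semantic notion, so that the defining formulas of types need not be written down but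
  are assembled by closure under connectives and quantifiers. It is restricted to valuations into
  the carrier, where \<open>lift\<close> is controlled.\<close>

definition definable :: "nat set \<Rightarrow> ((nat \<Rightarrow> 'a) \<Rightarrow> bool) \<Rightarrow> bool" where
  "definable S R \<longleftrightarrow> (\<exists>\<phi>. fv \<phi> \<subseteq> S \<and> (\<forall>v. assignment v \<longrightarrow> (sat M v \<phi> \<longleftrightarrow> R v)))"

lemma definable_cong: "definable S R \<Longrightarrow> (\<And>v. assignment v \<Longrightarrow> R' v \<longleftrightarrow> R v) \<Longrightarrow> definable S R'"
proof -
  assume "definable S R" and R': "\<And>v. assignment v \<Longrightarrow> R' v \<longleftrightarrow> R v"
  then obtain \<phi> where "fv \<phi> \<subseteq> S" "\<And>v. assignment v \<Longrightarrow> sat M v \<phi> \<longleftrightarrow> R v"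
    unfolding definable_def by blast
  then show ?thesis unfolding definable_def using R' by (intro exI[of _ \<phi>]) auto
qed

lemma definable_neg: "definable S R \<Longrightarrow> definable S (\<lambda>v. \<not> R v)"
proof -
  assume "definable S R"
  then obtain \<phi> where "fv \<phi> \<subseteq> S" "\<And>v. assignment v \<Longrightarrow> sat M v \<phi> \<longleftrightarrow> R v"
    unfolding definable_def by blast
  then show ?thesis unfolding definable_def by (intro exI[of _ "Neg \<phi>"]) auto
qed

lemma definable_conj: "definable S R \<Longrightarrow> definable S R' \<Longrightarrow> definable S (\<lambda>v. R v \<and> R' v)"
proof -
  assume "definable S R" "definable S R'"
  then obtain \<phi> \<psi> where "fv \<phi> \<subseteq> S" "fv \<psi> \<subseteq> S" "\<And>v. assignment v \<Longrightarrow> sat M v \<phi> \<longleftrightarrow> R v"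
    "\<And>v. assignment v \<Longrightarrow> sat M v \<psi> \<longleftrightarrow> R' v" unfolding definable_def by blast
  then show ?thesis unfolding definable_def by (intro exI[of _ "Conj \<phi> \<psi>"]) auto
qed

lemma definable_disj: "definable S R \<Longrightarrow> definable S R' \<Longrightarrow> definable S (\<lambda>v. R v \<or> R' v)"
  using definable_neg[OF definable_conj[OF definable_neg definable_neg]] by simp

lemma definable_imp: "definable S R \<Longrightarrow> definable S R' \<Longrightarrow> definable S (\<lambda>v. R v \<longrightarrow> R' v)"
  unfolding imp_conv_disj by (intro definable_disj definable_neg)

lemma definable_const: "definable S (\<lambda>v. P)"
proof (cases P)
  case True
  then show ?thesis unfolding definable_def by (intro exI[of _ "Equal Zero Zero"]) auto
next
  case False
  then show ?thesis unfolding definable_def by (intro exI[of _ "Neg (Equal Zero Zero)"]) auto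
qed

lemma definable_bex:
  "finite X \<Longrightarrow> (\<And>x. x \<in> X \<Longrightarrow> definable S (R x)) \<Longrightarrow> definable S (\<lambda>v. \<exists>x\<in>X. R x v)"
proof (induction X rule: finite_induct)
  case empty
  then show ?case by (simp add: definable_const)
next
  case (insert x X)
  then have "definable S (\<lambda>v. R x v \<or> (\<exists>x\<in>X. R x v))" by (intro definable_disj) auto
  then show ?case by simp
qed

lemma definable_ball:
  "finite X \<Longrightarrow> (\<And>x. x \<in> X \<Longrightarrow> definable S (R x)) \<Longrightarrow> definable S (\<lambda>v. \<forall>x\<in>X. R x v)"
  using definable_neg[OF definable_bex[of X S "\<lambda>x v. \<not> R x v"]] definable_neg by simp

text \<open>Variable \<open>k\<close> stores the witness. The second hypothesis says that
  \<open>Q\<close> reads it only through its second argument, so overwriting \<open>k\<close> is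
  harmless.\<close>

lemma definable_exists:
  assumes "definable (insert k S) (\<lambda>v. Q v (v k))"
    and "\<And>v a b. Q (v(k := a)) b \<longleftrightarrow> Q v b"
  shows "definable S (\<lambda>v. \<exists>a\<in>carrier M. Q v a)"
proof -
  obtain \<phi> where \<phi>: "fv \<phi> \<subseteq> insert k S" "\<And>v. assignment v \<Longrightarrow> sat M v \<phi> \<longleftrightarrow> Q v (v k)"
    using assms(1) unfolding definable_def by blast
  have "sat M v (Exi k \<phi>) \<longleftrightarrow> (\<exists>a\<in>carrier M. Q v a)" if "assignment v" for v
    using \<phi>(2)[OF assignment_upd[OF that]] assms(2) by simp
  then show ?thesis unfolding definable_def using \<phi>(1) by (intro exI[of _ "Exi k \<phi>"]) auto
qed

lemma definable_forall:
  assumes "definable (insert k S) (\<lambda>v. Q v (v k))"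
    and "\<And>v a b. Q (v(k := a)) b \<longleftrightarrow> Q v b"
  shows "definable S (\<lambda>v. \<forall>a\<in>carrier M. Q v a)"
  using definable_neg[OF definable_exists[of k S "\<lambda>v a. \<not> Q v a"]] definable_neg[OF assms(1)] assms(2)
  by simp

lemma definable_mono: "definable S R \<Longrightarrow> S \<subseteq> S' \<Longrightarrow> definable S' R"
  unfolding definable_def by blast

text \<open>Integer combinations of representatives and \<open>1\<close>, built one summand at a
  time: the order of the cover has to be defined inside \<open>M\<close>, which is done by following
  the carry of each single addition.\<close>

inductive lterm :: "nat set \<Rightarrow> ((nat \<Rightarrow> 'a) \<Rightarrow> 't) \<Rightarrow> bool" for S where
  zero: "lterm S (\<lambda>v. 0)"
| add_var: "lterm S \<tau> \<Longrightarrow> i \<in> S \<Longrightarrow> lterm S (\<lambda>v. \<tau> v + lift (v i))"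
| diff_var: "lterm S \<tau> \<Longrightarrow> i \<in> S \<Longrightarrow> lterm S (\<lambda>v. \<tau> v - lift (v i))"
| add_one: "lterm S \<tau> \<Longrightarrow> lterm S (\<lambda>v. \<tau> v + 1)"
| diff_one: "lterm S \<tau> \<Longrightarrow> lterm S (\<lambda>v. \<tau> v - 1)"

lemma lterm_add: "lterm S \<sigma> \<Longrightarrow> lterm S \<tau> \<Longrightarrow> lterm S (\<lambda>v. \<tau> v + \<sigma> v)"
  by (induction rule: lterm.induct)
    (simp_all add: add.assoc[symmetric] add_diff_eq lterm.intros del: add.assoc)

lemma lterm_uminus: "lterm S \<sigma> \<Longrightarrow> lterm S (\<lambda>v. - \<sigma> v)"
proof (induction rule: lterm.induct)
  case (diff_var \<tau> i)
  then show ?case using lterm.add_var[of S "\<lambda>v. - \<tau> v" i] by simp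
next
  case (diff_one \<tau>)
  then show ?case using lterm.add_one[of S "\<lambda>v. - \<tau> v"] by simp
next
  case (add_var \<tau> i)
  then show ?case using lterm.diff_var[of S "\<lambda>v. - \<tau> v" i] by simp
next
  case (add_one \<tau>)
  then show ?case using lterm.diff_one[of S "\<lambda>v. - \<tau> v"] by simp
qed (simp add: lterm.zero)

lemma lterm_diff: "lterm S \<tau> \<Longrightarrow> lterm S \<sigma> \<Longrightarrow> lterm S (\<lambda>v. \<tau> v - \<sigma> v)"
  using lterm_add[OF lterm_uminus, of S \<sigma> \<tau>] by simp

lemma lterm_scale: "lterm S \<tau> \<Longrightarrow> lterm S (\<lambda>v. of_int k * \<tau> v)"
proof -
  assume \<tau>: "lterm S \<tau>"
  have nat: "lterm S (\<lambda>v. of_nat n * \<tau> v)" for n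
  proof (induction n)
    case (Suc n)
    then show ?case using lterm_add[OF Suc \<tau>] by (simp add: distrib_right)
  qed (simp add: lterm.zero)
  show ?thesis
  proof (cases k)
    case (nonneg n)
    then show ?thesis using nat[of n] by simp
  next
    case (neg n)
    have "of_int k * x = - (of_nat (Suc n) * x)" for x :: 't
      unfolding neg by (simp add: algebra_simps)
    then show ?thesis using lterm_uminus[OF nat[of "Suc n"]] by simp
  qed
qed

lemma lterm_var: "i \<in> S \<Longrightarrow> lterm S (\<lambda>v. lift (v i))"
  using lterm.add_var[OF lterm.zero] by simp

lemma lterm_one: "lterm S (\<lambda>v. 1)"
  using lterm.add_one[OF lterm.zero] by simp

lemma lterm_of_int: "lterm S (\<lambda>v. of_int k)"
  using lterm_scale[OF lterm_one] by simp

lemma lterm_lin: "(\<And>i. i \<le> m \<Longrightarrow> lterm S (\<lambda>v. f v i)) \<Longrightarrow> lterm S (\<lambda>v. lin m c (f v))"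
proof -
  assume f: "\<And>i. i \<le> m \<Longrightarrow> lterm S (\<lambda>v. f v i)"
  have "lterm S (\<lambda>v. \<Sum>i\<in>I. of_int (c i) * f v i)" if "finite I" "I \<subseteq> {..m}" for I
    using that
  proof (induction I rule: finite_induct)
    case (insert i I)
    then have "lterm S (\<lambda>v. of_int (c i) * f v i + (\<Sum>i\<in>I. of_int (c i) * f v i))"
      by (intro lterm_add lterm_scale f) auto
    then show ?case using insert by simp
  qed (simp add: lterm.zero)
  then show ?thesis unfolding lin_def by simp
qed

lemma lterm_upd: "lterm S \<tau> \<Longrightarrow> k \<notin> S \<Longrightarrow> \<tau> (v(k := a)) = \<tau> v"
  by (induction rule: lterm.induct) auto

lemma lterm_mono: "lterm S \<tau> \<Longrightarrow> S \<subseteq> S' \<Longrightarrow> lterm S' \<tau>"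
  by (induction rule: lterm.induct) (auto intro: lterm.intros)

section \<open>Definability in the model of integer parts, signs and divisibility in the
  cover\<close>

lemma proj_one: "proj 1 = \<one>\<^bsub>M\<^esub>"
  unfolding proj_zero[symmetric] proj_eq by (rule exI[of _ 1]) simp

lemma lterm_term:
  "lterm S \<tau> \<Longrightarrow> \<exists>t. fv_tm t \<subseteq> S \<and> (\<forall>v. assignment v \<longrightarrow> eval M v t = proj (\<tau> v))"
proof (induction rule: lterm.induct)
  case zero
  then show ?case by (intro exI[of _ Zero]) (simp add: proj_zero)
next
  case (add_var \<tau> i)
  then obtain t where "fv_tm t \<subseteq> S" "\<And>v. assignment v \<Longrightarrow> eval M v t = proj (\<tau> v)" by blast
  then show ?case using add_var
    by (intro exI[of _ "Plus t (Var i)"]) (auto simp: proj_add proj_lift assignmentD)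
next
  case (diff_var \<tau> i)
  then obtain t where t: "fv_tm t \<subseteq> S" "\<And>v. assignment v \<Longrightarrow> eval M v t = proj (\<tau> v)" by blast
  have "proj (x - lift a) = proj x \<otimes>\<^bsub>M\<^esub> inv\<^bsub>M\<^esub> a" if "a \<in> carrier M" for x a
    using proj_add[of x "- lift a"] proj_uminus[of "lift a"] proj_lift[OF that] by simp
  then show ?case using diff_var t
    by (intro exI[of _ "Plus t (Minus (Var i))"]) (auto simp: assignmentD)
next
  case (add_one \<tau>)
  have "proj (x + 1) = proj x" for x unfolding proj_eq by (rule exI[of _ 1]) simp
  then show ?case using add_one by simp
next
  case (diff_one \<tau>)
  have "proj (x - 1) = proj x" for x unfolding proj_eq by (rule exI[of _ "-1"]) simp
  then show ?case using diff_one by simp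
qed

lemma definable_in_G: "lterm S \<tau> \<Longrightarrow> definable S (\<lambda>v. \<tau> v \<in> G)"
proof -
  assume "lterm S \<tau>"
  then obtain t where "fv_tm t \<subseteq> S" "\<And>v. assignment v \<Longrightarrow> eval M v t = proj (\<tau> v)"
    using lterm_term by blast
  then show ?thesis unfolding definable_def by (intro exI[of _ "Pred t"]) (auto simp: proj_pred)
qed

lemma null_lift_proj: "unit_rep x \<Longrightarrow> null (lift (proj x) - x)"
  using proj_eq_unit[OF unit_rep_lift[OF proj_closed], of x x] proj_lift[OF proj_closed, of x] by blast

lemma unit_rep_0: "unit_rep 0"
  by (simp add: unit_rep_def pos_one)

lemma lift_inj: "a \<in> carrier M \<Longrightarrow> b \<in> carrier M \<Longrightarrow> null (lift a - lift b) \<longleftrightarrow> a = b"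
  using proj_eq_unit[OF unit_rep_lift unit_rep_lift] proj_lift by simp

text \<open>Representatives in [0, 1) are ordered by the cyclic order cut at the neutral element.
  The neutral element is least, and its disjunct is separate because the cyclic order fails on
  coinciding arguments.\<close>

lemma less_lift:
  assumes a: "a \<in> carrier M" and b: "b \<in> carrier M"
  shows "pos (lift b - lift a) \<longleftrightarrow> a \<noteq> b \<and> (a = \<one>\<^bsub>M\<^esub> \<or> ori M \<one>\<^bsub>M\<^esub> a b)"
proof -
  have nn: "\<not> pos (- lift a)" "\<not> pos (- lift b)"
    using unit_rep_lift a b by (auto simp: unit_rep_def)
  have ori: "ori M \<one>\<^bsub>M\<^esub> a b \<longleftrightarrow> pos (lift a) \<and> pos (lift b - lift a)"
    using proj_ori[OF unit_rep_0 unit_rep_lift[OF a] unit_rep_lift[OF b]] nn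
    by (simp add: proj_zero proj_lift a b)
  have one: "a = \<one>\<^bsub>M\<^esub> \<longleftrightarrow> null (lift a)"
    using proj_eq_unit[OF unit_rep_lift[OF a] unit_rep_0] by (simp add: proj_lift a proj_zero)
  have eq: "a = b \<longleftrightarrow> null (lift b - lift a)"
    using lift_inj[OF a b] null_diff_commute by blast
  have "pos (lift b - lift a)" if "\<not> null (lift b - lift a)" "null (lift a)"
  proof -
    have "\<not> pos (lift a - lift b)"
      using nonpos_add[of "lift a" "- lift b"] nn that(2) by (simp add: null_def)
    then show ?thesis using that(1) by (simp add: null_def)
  qed
  then show ?thesis unfolding ori one eq using nn by (auto simp: null_def)
qed

lemma definable_less_lift:
  assumes "lterm S \<tau>" "lterm S \<sigma>"
  shows "definable S (\<lambda>v. pos (lift (proj (\<tau> v)) - lift (proj (\<sigma> v))))"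
proof -
  obtain s t where "fv_tm s \<subseteq> S" "fv_tm t \<subseteq> S" "\<And>v. assignment v \<Longrightarrow> eval M v s = proj (\<sigma> v)"
    "\<And>v. assignment v \<Longrightarrow> eval M v t = proj (\<tau> v)"
    using lterm_term assms by meson
  then show ?thesis unfolding definable_def less_lift[OF proj_closed proj_closed]
    by (intro exI[of _ "Conj (Neg (Equal s t)) (Neg (Conj (Neg (Equal s Zero)) (Neg (Ori Zero s t))))"])
      auto
qed

lemma floor_le: "unit_rep (x - of_int k) \<Longrightarrow> \<not> pos (of_int j - x) \<longleftrightarrow> j \<le> k"
proof
  assume x: "unit_rep (x - of_int k)"
  show "j \<le> k" if "\<not> pos (of_int j - x)"
  proof (rule ccontr)
    assume "\<not> j \<le> k"
    then have "\<not> pos (of_int (k + 1 - j))" unfolding pos_of_int by simp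
    then have "pos ((1 - (x - of_int k)) + (- of_int (k + 1 - j)))"
      using x by (intro pos_add_nonneg) (auto simp: unit_rep_def)
    then show False using that by (simp add: algebra_simps)
  qed
  show "\<not> pos (of_int j - x)" if "j \<le> k"
  proof -
    have "\<not> pos (of_int (j - k))" unfolding pos_of_int using that by simp
    then have "\<not> pos (- (x - of_int k) + of_int (j - k))"
      using x by (intro nonpos_add) (auto simp: unit_rep_def)
    then show ?thesis by simp
  qed
qed

text \<open>Addition with carry: \<open>lift (proj (x + l))\<close> is the fractional part of
  \<open>x + l\<close>, and adding \<open>l\<close> from [0, 1) raises the integer part exactly if
  this fractional part is below \<open>l\<close>.\<close>

lemma floor_add:
  assumes "unit_rep l"
  shows "\<not> pos (of_int j - (x + l)) \<longleftrightarrow>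
     \<not> pos (of_int j - x) \<or> \<not> pos (of_int (j - 1) - x) \<and> pos (l - lift (proj (x + l)))"
proof -
  obtain k where k: "unit_rep (x - of_int k)" by (rule unit_rep_shift)
  define r where "r = x - of_int k"
  have r: "unit_rep r" using k by (simp add: r_def)
  have pr: "proj (x + l) = proj (r + l)" "proj (x + l) = proj (r + l - 1)"
    unfolding proj_eq by (rule exI[of _ k], simp add: r_def) (rule exI[of _ "k + 1"], simp add: r_def)
  show ?thesis
  proof (cases "pos (1 - (r + l))")
    case True
    have "\<not> pos (- r + - l)" using r assms by (intro nonpos_add) (auto simp: unit_rep_def)
    then have u: "unit_rep (r + l)" using True by (simp add: unit_rep_def)
    then have u': "unit_rep (x + l - of_int k)" by (simp add: r_def algebra_simps)
    have "null ((l - lift (proj (x + l))) - (- r))"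
      using null_lift_proj[OF u] null_diff_commute unfolding pr(1) by (simp add: algebra_simps)
    then have "\<not> pos (l - lift (proj (x + l)))" using r pos_cong by (metis unit_rep_def)
    then show ?thesis unfolding floor_le[OF u'] floor_le[OF k] by auto
  next
    case False
    have "pos ((1 - r) + (1 - l))" using r assms by (intro pos_add) (auto simp: unit_rep_def)
    then have u: "unit_rep (r + l - 1)" using False by (simp add: unit_rep_def algebra_simps)
    then have u': "unit_rep (x + l - of_int (k + 1))" by (simp add: r_def algebra_simps)
    have "null ((l - lift (proj (x + l))) - (1 - r))"
      using null_lift_proj[OF u] null_diff_commute unfolding pr(2) by (simp add: algebra_simps)
    then have "pos (l - lift (proj (x + l)))" using r pos_cong by (metis unit_rep_def)
    then show ?thesis unfolding floor_le[OF u'] floor_le[OF k] by auto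
  qed
qed

text \<open>Subtraction with borrow: the integer part drops by one exactly if \<open>l\<close>
  exceeds the fractional part \<open>lift (proj x)\<close>.\<close>

lemma floor_diff:
  assumes "unit_rep l"
  shows "\<not> pos (of_int j - (x - l)) \<longleftrightarrow>
     \<not> pos (of_int j - x) \<and> \<not> pos (l - lift (proj x)) \<or> \<not> pos (of_int (j + 1) - x)"
proof -
  obtain k where k: "unit_rep (x - of_int k)" by (rule unit_rep_shift)
  define r where "r = x - of_int k"
  have r: "unit_rep r" using k by (simp add: r_def)
  have pr: "proj x = proj r" unfolding proj_eq by (rule exI[of _ k]) (simp add: r_def)
  have "null ((l - lift (proj x)) - (l - r))"
    using null_lift_proj[OF r] null_diff_commute unfolding pr by (simp add: algebra_simps)
  then have c: "pos (l - lift (proj x)) \<longleftrightarrow> pos (l - r)" by (rule pos_cong)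
  show ?thesis
  proof (cases "pos (l - r)")
    case True
    have "pos ((1 - l) + r)" using r assms by (intro pos_add_nonneg) (auto simp: unit_rep_def)
    moreover have "pos (l + (1 - r))" using r assms
      by (subst add.commute, intro pos_add_nonneg) (auto simp: unit_rep_def)
    ultimately have u: "unit_rep (x - l - of_int (k - 1))"
      using pos_asym[of "1 - l + r"] True
      by (auto simp: unit_rep_def r_def algebra_simps dest: pos_asym)
    show ?thesis unfolding floor_le[OF u] floor_le[OF k] using c True by auto
  next
    case False
    have "pos ((1 - r) + l)" using r assms by (intro pos_add_nonneg) (auto simp: unit_rep_def)
    then have u: "unit_rep (x - l - of_int k)"
      using False by (simp add: unit_rep_def r_def algebra_simps)
    show ?thesis unfolding floor_le[OF u] floor_le[OF k] using c False by auto
  qed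
qed

text \<open>Induction on the single additions, for all thresholds \<open>j\<close> simultaneously,
  because a carry or a borrow moves the threshold by one.\<close>

lemma definable_floor: "lterm S \<tau> \<Longrightarrow> definable S (\<lambda>v. \<not> pos (of_int j - \<tau> v))"
proof (induction arbitrary: j rule: lterm.induct)
  case zero
  show ?case by (rule definable_const)
next
  case (add_var \<tau> i)
  have "definable S (\<lambda>v. \<not> pos (of_int j - \<tau> v) \<or> \<not> pos (of_int (j - 1) - \<tau> v) \<and>
      pos (lift (proj (lift (v i))) - lift (proj (\<tau> v + lift (v i)))))"
    by (intro definable_disj definable_conj add_var definable_less_lift lterm_var lterm.add_var)
  then show ?case
    by (rule definable_cong)
      (simp add: floor_add[OF unit_rep_lift[OF assignmentD]] proj_lift assignmentD del: of_int_diff)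
next
  case (diff_var \<tau> i)
  have "definable S (\<lambda>v. \<not> pos (of_int j - \<tau> v) \<and> \<not> pos (lift (proj (lift (v i))) - lift (proj (\<tau> v)))
      \<or> \<not> pos (of_int (j + 1) - \<tau> v))"
    by (intro definable_disj definable_conj definable_neg[OF definable_less_lift] diff_var lterm_var)
  then show ?case
    by (rule definable_cong)
      (simp add: floor_diff[OF unit_rep_lift[OF assignmentD]] proj_lift assignmentD del: of_int_add)
next
  case (add_one \<tau>)
  show ?case using add_one.IH[of "j - 1"] by (simp add: algebra_simps)
next
  case (diff_one \<tau>)
  show ?case using diff_one.IH[of "j + 1"] by (simp add: algebra_simps)
qed

lemma definable_pos: "lterm S \<tau> \<Longrightarrow> definable S (\<lambda>v. pos (\<tau> v))"
  using definable_neg[OF definable_floor[OF lterm_uminus, of S \<tau> 0]] by simp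

lemma definable_null: "lterm S \<tau> \<Longrightarrow> definable S (\<lambda>v. null (\<tau> v))"
  unfolding null_def by (intro definable_conj definable_neg definable_pos lterm_uminus)

lemma lterm_bound:
  "lterm S \<tau> \<Longrightarrow> \<exists>J\<ge>0. \<forall>v. assignment v \<longrightarrow> pos (of_int J - \<tau> v) \<and> pos (of_int J + \<tau> v)"
proof (induction rule: lterm.induct)
  case zero
  then show ?case by (intro exI[of _ 1]) (simp add: pos_one)
next
  case (add_var \<tau> i)
  then obtain J where J: "J \<ge> 0" "\<And>v. assignment v \<Longrightarrow> pos (of_int J - \<tau> v) \<and> pos (of_int J + \<tau> v)" by blast
  have "pos (of_int (J + 1) - (\<tau> v + lift (v i))) \<and> pos (of_int (J + 1) + (\<tau> v + lift (v i)))"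
    if "assignment v" for v
    using pos_add[of "of_int J - \<tau> v" "1 - lift (v i)"] J(2)[OF that] unit_rep_lift[OF assignmentD[OF that]]
      pos_add_nonneg[OF pos_add[OF pos_one], of "of_int J + \<tau> v" "lift (v i)"]
    by (simp add: unit_rep_def algebra_simps)
  then show ?case using J(1) by (intro exI[of _ "J + 1"]) auto
next
  case (diff_var \<tau> i)
  then obtain J where J: "J \<ge> 0" "\<And>v. assignment v \<Longrightarrow> pos (of_int J - \<tau> v) \<and> pos (of_int J + \<tau> v)" by blast
  have "pos (of_int (J + 1) - (\<tau> v - lift (v i))) \<and> pos (of_int (J + 1) + (\<tau> v - lift (v i)))"
    if "assignment v" for v
    using pos_add[of "of_int J + \<tau> v" "1 - lift (v i)"] J(2)[OF that] unit_rep_lift[OF assignmentD[OF that]]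
      pos_add_nonneg[OF pos_add[OF pos_one], of "of_int J - \<tau> v" "lift (v i)"]
    by (simp add: unit_rep_def algebra_simps)
  then show ?case using J(1) by (intro exI[of _ "J + 1"]) auto
next
  case (add_one \<tau>)
  then obtain J where J: "J \<ge> 0" "\<And>v. assignment v \<Longrightarrow> pos (of_int J - \<tau> v) \<and> pos (of_int J + \<tau> v)" by blast
  have "pos (of_int (J + 1) - (\<tau> v + 1)) \<and> pos (of_int (J + 1) + (\<tau> v + 1))"
    if "assignment v" for v
    using J(2)[OF that] pos_add[OF pos_add[OF pos_one pos_one], of "of_int J + \<tau> v"]
    by (simp add: algebra_simps)
  then show ?case using J(1) by (intro exI[of _ "J + 1"]) auto
next
  case (diff_one \<tau>)
  then obtain J where J: "J \<ge> 0" "\<And>v. assignment v \<Longrightarrow> pos (of_int J - \<tau> v) \<and> pos (of_int J + \<tau> v)" by blast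
  have "pos (of_int (J + 1) - (\<tau> v - 1)) \<and> pos (of_int (J + 1) + (\<tau> v - 1))"
    if "assignment v" for v
    using J(2)[OF that] pos_add[OF pos_add[OF pos_one pos_one], of "of_int J - \<tau> v"]
    by (simp add: algebra_simps)
  then show ?case using J(1) by (intro exI[of _ "J + 1"]) auto
qed

text \<open>A bound on \<open>x\<close> bounds every \<open>g\<close> with \<open>x = n g\<close>,
  so the integer part \<open>l\<close> of \<open>g\<close> takes finitely many values and only its
  fractional part, an element of the model, is quantified. Splitting off \<open>l\<close> respects
  membership in \<open>G\<close>, which contains the integers.\<close>

lemma multiple_bounded:
  assumes n: "n > 0" and W: "W \<in> {UNIV, G}" and J: "J \<ge> 0" "pos (of_int J - x)" "pos (of_int J + x)"
  shows "multiple n W x \<longleftrightarrow> (\<exists>a\<in>carrier M. (W = G \<longrightarrow> lift a \<in> G) \<and>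
     (\<exists>l\<in>{-J-1..J}. null (x - of_int n * lift a - of_int (n * l))))"
proof
  assume "multiple n W x"
  then obtain g where g: "g \<in> W" "null (x - of_int n * g)" unfolding multiple_def by blast
  obtain l where l: "unit_rep (g - of_int l)" by (rule unit_rep_shift)
  define a where "a = proj (g - of_int l)"
  have a: "null (lift a - (g - of_int l))" unfolding a_def by (rule null_lift_proj[OF l])
  have aG: "lift a \<in> G" if "W = G"
    using G_cong[OF G_null[OF a]] G_diff G_of_int g(1) that by simp
  have "x - of_int n * lift a - of_int (n * l)
     = (x - of_int n * g) - of_int n * (lift a - (g - of_int l))" by (simp add: algebra_simps)
  then have nl: "null (x - of_int n * lift a - of_int (n * l))"
    using null_diff[OF g(2) null_mult[OF a]] by (simp only:)
  have lJ: "l \<le> J"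
  proof -
    have "\<not> pos (of_int n * (of_int l - g))" using l pos_scale[OF n] by (simp add: unit_rep_def)
    then have "\<not> pos (of_int (n * l) - of_int n * g)" by (simp add: algebra_simps)
    then have "\<not> pos (of_int (n * l) - x)"
      using pos_cong[of "of_int (n * l) - of_int n * g" "of_int (n * l) - x"] g(2) by simp
    then have "pos (of_int J - of_int (n * l))" using J(2) leq_lt_trans by blast
    then have "pos (of_int (J - n * l))" by simp
    then have "n * l < J" unfolding pos_of_int by simp
    then show ?thesis using n J(1) mult_right_mono[of 1 n l] by (cases "l \<ge> 0") auto
  qed
  have Jl: "- J - 1 \<le> l"
  proof -
    have "pos (of_int (l + 1) - g)" using l by (simp add: unit_rep_def algebra_simps)
    then have "pos (of_int n * (of_int (l + 1) - g))" using pos_scale[OF n] by blast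
    then have "pos (of_int (n * (l + 1)) - of_int n * g)" by (simp add: algebra_simps)
    then have "pos (of_int (n * (l + 1)) - x)"
      using pos_cong[of "of_int (n * (l + 1)) - of_int n * g" "of_int (n * (l + 1)) - x"] g(2) by simp
    then have "pos ((of_int (n * (l + 1)) - x) + (of_int J + x))" using J(3) by (rule pos_add)
    then have "pos (of_int (n * (l + 1) + J))" by simp
    then have "- J < n * (l + 1)" unfolding pos_of_int by simp
    then show ?thesis using n J(1) mult_right_mono[of 1 n "- (l + 1)"]
      by (cases "l \<ge> 0") (auto simp: algebra_simps)
  qed
  have "a \<in> carrier M" by (simp add: a_def proj_closed)
  then show "\<exists>a\<in>carrier M. (W = G \<longrightarrow> lift a \<in> G) \<and>
     (\<exists>l\<in>{-J-1..J}. null (x - of_int n * lift a - of_int (n * l)))"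
    using aG nl lJ Jl by (intro bexI[of _ a] conjI impI bexI[of _ l]) auto
next
  assume "\<exists>a\<in>carrier M. (W = G \<longrightarrow> lift a \<in> G) \<and>
     (\<exists>l\<in>{-J-1..J}. null (x - of_int n * lift a - of_int (n * l)))"
  then obtain a l where a: "W = G \<longrightarrow> lift a \<in> G" "null (x - of_int n * lift a - of_int (n * l))"
    by blast
  have "lift a + of_int l \<in> W" using a(1) W G_add G_of_int by auto
  moreover have "null (x - of_int n * (lift a + of_int l))" using a(2) by (simp add: algebra_simps)
  ultimately show "multiple n W x" unfolding multiple_def by blast
qed

lemma definable_multiple:
  assumes \<tau>: "lterm S \<tau>" and n: "n > 0" and W: "W \<in> {UNIV, G}" and k: "k \<notin> S"
  shows "definable S (\<lambda>v. multiple n W (\<tau> v))"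
proof -
  obtain J where J: "J \<ge> 0" "\<And>v. assignment v \<Longrightarrow> pos (of_int J - \<tau> v) \<and> pos (of_int J + \<tau> v)"
    using lterm_bound[OF \<tau>] by blast
  have "definable S (\<lambda>v. \<exists>a\<in>carrier M. (W = G \<longrightarrow> lift a \<in> G) \<and>
     (\<exists>l\<in>{-J-1..J}. null (\<tau> v - of_int n * lift a - of_int (n * l))))"
  proof (rule definable_exists[where k = k])
    have \<tau>': "lterm (insert k S) \<tau>" by (rule lterm_mono[OF \<tau>]) auto
    show "definable (insert k S) (\<lambda>v. (W = G \<longrightarrow> lift (v k) \<in> G) \<and>
     (\<exists>l\<in>{-J-1..J}. null (\<tau> v - of_int n * lift (v k) - of_int (n * l))))"
      by (intro definable_conj definable_imp definable_const definable_in_G definable_bex definable_null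
          lterm_diff lterm_scale lterm_var lterm_of_int \<tau>') auto
  qed (simp add: lterm_upd[OF \<tau> k])
  then show ?thesis
    by (rule definable_cong)
      (rule multiple_bounded[OF n W J(1) J(2)[THEN conjunct1] J(2)[THEN conjunct2]])
qed

section \<open>Types over finite sets\<close>

text \<open>
  Block \<open>t\<close> of an assignment consists of the values of the variables \<open>t * m\<close>, ..., \<open>t * m + m - 1\<close>.
  Its lift leaves coordinate \<open>0\<close> free for the object variable; coordinate \<open>r\<close> carries the unit.
\<close>

definition block :: "nat \<Rightarrow> nat \<Rightarrow> nat \<Rightarrow> (nat \<Rightarrow> 'a) \<Rightarrow> nat \<Rightarrow> 't" where
  "block r m t v i = (if i = r then 1 else if 1 \<le> i \<and> i \<le> m then lift (v (t * m + (i - 1))) else 0)"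

text \<open>Passes between two numberings: in \<open>\<phi>\<close> the object variable is 0 and the
  parameters follow it, whereas a defining formula keeps the tuple \<open>b\<close> in block 0,
  starting at variable 0.\<close>

definition instance_of :: "nat \<Rightarrow> (nat \<Rightarrow> 'a) \<Rightarrow> 'a \<Rightarrow> nat \<Rightarrow> 'a" where
  "instance_of m v x i = (if i = 0 then x else if i \<le> m then v (i - 1) else \<one>\<^bsub>M\<^esub>)"

lemma block_upd: "t < 3 \<Longrightarrow> k \<ge> 3 * m \<Longrightarrow> block r m t (v(k := a)) = block r m t v"
proof
  fix i
  assume t: "t < 3" "k \<ge> 3 * m"
  have "t * m + (i - 1) \<noteq> k" if "1 \<le> i" "i \<le> m"
  proof -
    have "t * m \<le> 2 * m" using t by (intro mult_right_mono) auto
    then show ?thesis using that t by linarith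
  qed
  then show "block r m t (v(k := a)) i = block r m t v i" by (auto simp: block_def)
qed

lemma instance_of_upd: "k \<ge> 3 * m \<Longrightarrow> instance_of m (v(k := a)) x = instance_of m v x"
  by (rule ext) (auto simp: instance_of_def)

lemma lterm_block: "t < 3 \<Longrightarrow> {..<3 * m} \<subseteq> S \<Longrightarrow> lterm S (\<lambda>v. lin r c (block r m t v))"
proof (rule lterm_lin)
  fix i
  assume t: "t < 3" and S: "{..<3 * m} \<subseteq> S"
  show "lterm S (\<lambda>v. block r m t v i)"
  proof (cases "i \<noteq> r \<and> 1 \<le> i \<and> i \<le> m")
    case True
    have "t * m \<le> 2 * m" using t by (intro mult_right_mono) auto
    then have "t * m + (i - 1) < 3 * m" using True by linarith
    then have "lterm S (\<lambda>v. lift (v (t * m + (i - 1))))" using S by (intro lterm_var) auto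
    then show ?thesis using True by (simp add: block_def)
  next
    case False
    then have "(\<lambda>v. block r m t v i) = (\<lambda>v. if i = r then 1 else 0)"
      by (auto simp: block_def fun_eq_iff)
    then show ?thesis using lterm_one lterm.zero by (cases "i = r") auto
  qed
qed

lemma definable_instance:
  assumes "partitioned m \<phi>" "k \<ge> 3 * m" "{..<3 * m} \<subseteq> S" "k \<in> S"
  shows "definable S (\<lambda>v. sat M (instance_of m v (v k)) \<phi>)"
proof -
  \<comment> \<open>Indices above \<open>m\<close>, which may occur bound in \<open>\<phi>\<close>,
    go beyond \<open>k\<close> to keep \<open>f\<close> injective; \<open>k \<ge> 3 * m\<close>
    separates \<open>k\<close> from the parameters.\<close>
  define f where "f i = (if i = 0 then k else if i \<le> m then i - 1 else k + 1 + i)" for i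
  have f: "inj f" using assms(2) unfolding inj_def f_def by (auto split: if_splits)
  have "fv (rename f \<phi>) \<subseteq> S"
  proof -
    have "f i \<in> S" if "i \<le> m" for i
      using that assms(3,4) by (cases "i = 0") (auto simp: f_def)
    then show ?thesis using assms(1) unfolding fv_rename[OF f] partitioned_def by auto
  qed
  moreover have "sat M v (rename f \<phi>) \<longleftrightarrow> sat M (instance_of m v (v k)) \<phi>" for v
    unfolding sat_rename[OF f] using assms(1)
    by (intro sat_cong) (auto simp: f_def instance_of_def partitioned_def)
  ultimately show ?thesis unfolding definable_def by blast
qed

text \<open>The germ of \<open>\<phi>\<close> to the right of the left endpoint, which block 1
  carries. The quantified \<open>e\<close> bounds a right neighbourhood and so replaces a tuple
  naming the next combination above \<open>K x\<close>; \<open>C\<close> selects the class of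
  \<open>x\<close>.\<close>

definition near :: "nat \<Rightarrow> nat \<Rightarrow> int \<Rightarrow> (nat \<Rightarrow> int) \<Rightarrow> ((nat \<Rightarrow> 'a) \<Rightarrow> 't \<Rightarrow> bool) \<Rightarrow> fm \<Rightarrow> (nat \<Rightarrow> 'a) \<Rightarrow> bool"
where
  "near r m K p C \<phi> v \<longleftrightarrow> (\<exists>e\<in>carrier M. pos (of_int K * lift e - lin r p (block r m 1 v)) \<and>
     (\<forall>x\<in>carrier M. pos (of_int K * lift x - lin r p (block r m 1 v)) \<and> pos (lift e - lift x) \<and>
        C v (lift x) \<longrightarrow> sat M (instance_of m v x) \<phi>))"

lemma definable_near:
  assumes \<phi>: "partitioned m \<phi>"
    and C: "definable (insert (3 * m) {..<3 * m}) (\<lambda>v. C v (lift (v (3 * m))))"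
    and Cupd: "\<And>v k a x. k \<ge> 3 * m \<Longrightarrow> C (v(k := a)) x \<longleftrightarrow> C v x"
  shows "definable {..<3 * m} (near r m K p C \<phi>)"
proof -
  let ?x = "3 * m" and ?e = "3 * m + 1" and ?S = "{..<3 * m}"
  have x: "definable (insert ?x (insert ?e ?S)) (\<lambda>v.
      pos (of_int K * lift (v ?x) - lin r p (block r m 1 v)) \<and> pos (lift (v ?e) - lift (v ?x)) \<and>
        C v (lift (v ?x)) \<longrightarrow> sat M (instance_of m v (v ?x)) \<phi>)"
    by (intro definable_imp definable_conj definable_pos lterm_diff lterm_scale lterm_var lterm_block
        definable_instance[OF \<phi>] definable_mono[OF C]) auto
  have "definable (insert ?e ?S) (\<lambda>v. \<forall>x\<in>carrier M.
      pos (of_int K * lift x - lin r p (block r m 1 v)) \<and> pos (lift (v ?e) - lift x) \<and>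
        C v (lift x) \<longrightarrow> sat M (instance_of m v x) \<phi>)"
    by (rule definable_forall[where k = ?x], rule x) (simp add: block_upd instance_of_upd Cupd)
  then have e: "definable (insert ?e ?S) (\<lambda>v. pos (of_int K * lift (v ?e) - lin r p (block r m 1 v)) \<and>
     (\<forall>x\<in>carrier M. pos (of_int K * lift x - lin r p (block r m 1 v)) \<and> pos (lift (v ?e) - lift x) \<and>
        C v (lift x) \<longrightarrow> sat M (instance_of m v x) \<phi>))"
    by (intro definable_conj definable_pos lterm_diff lterm_scale lterm_var lterm_block) auto
  show ?thesis unfolding near_def
    by (rule definable_exists[where k = ?e], rule e) (simp add: block_upd instance_of_upd Cupd)
qed

definition at_point :: "nat \<Rightarrow> nat \<Rightarrow> int \<Rightarrow> (nat \<Rightarrow> int) \<Rightarrow> fm \<Rightarrow> (nat \<Rightarrow> 'a) \<Rightarrow> bool" where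
  "at_point r m K p \<phi> v \<longleftrightarrow> (\<exists>x\<in>carrier M. null (of_int K * lift x - lin r p (block r m 1 v)) \<and>
     sat M (instance_of m v x) \<phi>)"

lemma definable_at_point:
  assumes "partitioned m \<phi>"
  shows "definable {..<3 * m} (at_point r m K p \<phi>)"
  unfolding at_point_def
proof (rule definable_exists[where k = "3 * m"])
  show "definable (insert (3 * m) {..<3 * m})
     (\<lambda>v. null (of_int K * lift (v (3 * m)) - lin r p (block r m 1 v)) \<and>
        sat M (instance_of m v (v (3 * m))) \<phi>)"
    by (intro definable_conj definable_null lterm_diff lterm_scale lterm_var lterm_block
        definable_instance[OF assms]) auto
qed (simp add: block_upd instance_of_upd)

text \<open>The combination supplies a value for \<open>K x\<close>, not for \<open>x\<close>, hence
  the modulus \<open>K * K\<close>: after cancelling \<open>K\<close>, two solutions differ by an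
  element of \<open>K G\<close>.\<close>

definition coset_cond :: "nat \<Rightarrow> nat \<Rightarrow> int \<Rightarrow> (nat \<Rightarrow> int) \<Rightarrow> (nat \<Rightarrow> 'a) \<Rightarrow> 't \<Rightarrow> bool" where
  "coset_cond r m K q v x \<longleftrightarrow> multiple (K * K) G (of_int K * x - lin r q (block r m 2 v))"

text \<open>Avoidance is demanded for the combinations of block 0 alone, that is, of the tuple
  \<open>b\<close> under test, so no further tuple is spent on it; the residue \<open>j\<close> is a
  constant from a finite range.\<close>

definition generic_cond :: "nat \<Rightarrow> nat \<Rightarrow> int \<Rightarrow> int \<Rightarrow> int \<Rightarrow> (nat \<Rightarrow> 'a) \<Rightarrow> 't \<Rightarrow> bool" where
  "generic_cond r m K N j v x \<longleftrightarrow> multiple K UNIV (x - of_int j) \<and>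
     (\<forall>p\<in>combs r 0 (K * N). of_int K * x - lin r p (block r m 0 v) \<notin> G)"

lemma definable_near_coset:
  assumes "partitioned m \<phi>" "K > 0"
  shows "definable {..<3 * m} (near r m K p (coset_cond r m K q) \<phi>)"
proof (rule definable_near[OF assms(1)])
  show "definable (insert (3 * m) {..<3 * m}) (\<lambda>v. coset_cond r m K q v (lift (v (3 * m))))"
    unfolding coset_cond_def using assms(2)
    by (intro definable_multiple[where k = "3 * m + 1"] lterm_diff lterm_scale lterm_var lterm_block)
      auto
qed (simp add: coset_cond_def block_upd)

lemma definable_near_generic:
  assumes "partitioned m \<phi>" "K > 0"
  shows "definable {..<3 * m} (near r m K p (generic_cond r m K N j) \<phi>)"
proof (rule definable_near[OF assms(1)])
  show "definable (insert (3 * m) {..<3 * m}) (\<lambda>v. generic_cond r m K N j v (lift (v (3 * m))))"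
    unfolding generic_cond_def using assms(2)
    by (intro definable_conj definable_ball finite_combs definable_neg definable_in_G
        definable_multiple[where k = "3 * m + 1"] lterm_diff lterm_scale lterm_var lterm_of_int
        lterm_block) auto
qed (simp add: generic_cond_def block_upd)

section \<open>Elements with equal cut and coset satisfy the same instances\<close>

lemma sat_invariant_finite:
  "finite \<Delta> \<Longrightarrow> \<forall>\<phi>\<in>\<Delta>. vars \<phi> \<subseteq> {..<r} \<Longrightarrow> \<exists>N\<ge>1. \<forall>\<phi>\<in>\<Delta>. sat_invariant r N \<phi>"
proof (induction \<Delta> rule: finite_induct)
  case (insert \<phi> \<Delta>)
  then obtain N where N: "N \<ge> 1" "\<forall>\<phi>\<in>\<Delta>. sat_invariant r N \<phi>" by auto
  obtain N' where N': "N' \<ge> 1" "sat_invariant r N' \<phi>" using sat_invariant_ex insert by blast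
  have "\<forall>\<phi>\<in>insert \<phi> \<Delta>. sat_invariant r (max N N') \<phi>"
    using N(2) N'(2) sat_invariant_mono by auto
  then show ?case using N(1) by (intro exI[of _ "max N N'"]) auto
qed auto

text \<open>The two valuations agree outside the object variable, so \<open>eqv_updI\<close> applies
  over the identical remaining coordinates. A difference in \<open>K G\<close> preserves all
  divisibilities by divisors of \<open>K\<close>. A difference in \<open>K U\<close> preserves those
  in \<open>U\<close>, and the avoided cosets then make those in \<open>G\<close> that involve the
  object variable fail for both elements.\<close>

lemma sat_instance_cong:
  assumes inv: "sat_invariant r N \<phi>" and rm: "m < r" and K: "K > 0" "\<And>n. 1 \<le> n \<Longrightarrow> n \<le> N \<Longrightarrow> n dvd K"
    and v: "assignment v" and x: "unit_rep x" "unit_rep x'"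
    and cut: "\<And>p. p \<in> combs r 0 (K * N) \<Longrightarrow>
       (pos (of_int K * x - lin r p (block r m 0 v)) \<longleftrightarrow> pos (of_int K * x' - lin r p (block r m 0 v))) \<and>
       (pos (lin r p (block r m 0 v) - of_int K * x) \<longleftrightarrow> pos (lin r p (block r m 0 v) - of_int K * x'))"
    and W: "W \<in> {UNIV, G}" "g \<in> W" "null (x - x' - of_int K * g)"
    and gen: "W = UNIV \<Longrightarrow> (\<forall>p\<in>combs r 0 (K * N). of_int K * x - lin r p (block r m 0 v) \<notin> G \<and>
                of_int K * x' - lin r p (block r m 0 v) \<notin> G)"
  shows "sat M (instance_of m v (proj x)) \<phi> \<longleftrightarrow> sat M (instance_of m v (proj x')) \<phi>"
proof -
  define b where "b = block r m 0 v"
  have ext: "\<exists>q\<in>combs r 0 (K * N). lin r q b = lin r p b"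
    if "\<And>i. i \<le> r \<Longrightarrow> \<bar>p i\<bar> \<le> K * N" "p 0 = 0" for p
    using combs_ex[of r p "K * N" 0] that by auto
  have inst: "instance_of m v (proj y) = proj \<circ> b(0 := y)" for y
  proof
    fix i
    show "instance_of m v (proj y) i = (proj \<circ> b(0 := y)) i"
      using rm by (auto simp: instance_of_def b_def block_def proj_zero proj_one proj_lift[OF assignmentD[OF v]])
  qed
  have unit: "unit_rep ((b(0 := y)) i)" if "i < r" "unit_rep y" for i y
    using that by (auto simp: b_def block_def unit_rep_0 intro: unit_rep_lift[OF assignmentD[OF v]])
  have "eqv r N (b(0 := x)) (b(0 := x'))"
  proof (rule eqv_updI[where K = K])
    fix p assume "\<And>i. i \<le> r \<Longrightarrow> \<bar>p i\<bar> \<le> K * N" "p 0 = (0::int)"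
    then obtain q where "q \<in> combs r 0 (K * N)" "lin r q b = lin r p b" using ext by blast
    then show "(pos (of_int K * x - lin r p b) \<longleftrightarrow> pos (of_int K * x' - lin r p b)) \<and>
       (pos (lin r p b - of_int K * x) \<longleftrightarrow> pos (lin r p b - of_int K * x'))"
      using cut[of q] by (simp add: b_def)
  next
    fix c a n and U :: "'t set"
    assume a: "\<And>i. i \<le> r \<Longrightarrow> \<bar>c i\<bar> \<le> N" "c 0 = 0" "a \<noteq> 0" "\<bar>a\<bar> \<le> N" "1 \<le> n" "n \<le> N" "U \<in> {UNIV, G}"
    show "multiple n U (of_int a * x + lin r c b) \<longleftrightarrow> multiple n U (of_int a * x' + lin r c b)"
    proof (cases "W = UNIV \<and> U = G")
      case True
      have "\<bar>a\<bar> dvd K" using K(2)[of "\<bar>a\<bar>"] a(3,4) by linarith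
      then obtain d where d: "K = a * d" and dK: "\<bar>d\<bar> \<le> K"
        by (rule cofactor_bound) (use a(3) K(1) in auto)
      let ?p = "\<lambda>i. (- d) * c i"
      have "\<bar>?p i\<bar> \<le> K * N" if "i \<le> r" for i
        using mult_mono[OF dK a(1)[OF that]] K(1) by (simp add: abs_mult)
      moreover have "?p 0 = 0" using a(2) by simp
      ultimately obtain q where q: "q \<in> combs r 0 (K * N)" "lin r q b = lin r ?p b" using ext[of ?p] by blast
      have "of_int K * y - lin r ?p b = of_int d * (of_int a * y + lin r c b)" for y
        unfolding lin_scale d by (simp add: algebra_simps)
      moreover have "of_int K * x - lin r q b \<notin> G" "of_int K * x' - lin r q b \<notin> G"
        using gen True q(1) unfolding b_def by auto
      ultimately have "of_int d * (of_int a * x + lin r c b) \<notin> G" "of_int d * (of_int a * x' + lin r c b) \<notin> G"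
        unfolding q(2) by simp_all
      then have "of_int a * x + lin r c b \<notin> G" "of_int a * x' + lin r c b \<notin> G"
        using G_of_int_mult by blast+
      then show ?thesis using True multiple_imp_G by blast
    next
      case False
      show ?thesis
      proof (rule multiple_shift[OF a(7)])
        show "n dvd a * K" using K(2) a by simp
        show "g \<in> U" using False W a(7) by auto
        have "of_int a * x + lin r c b - (of_int a * x' + lin r c b) - of_int (a * K) * g
           = of_int a * (x - x' - of_int K * g)" by (simp add: algebra_simps)
        then show "null (of_int a * x + lin r c b - (of_int a * x' + lin r c b) - of_int (a * K) * g)"
          using null_mult[OF W(3)] by simp
      qed
    qed
  qed (use K eqv_refl in auto)
  then show ?thesis
    unfolding inst using rm unit x by (intro sat_invariantD[OF inv]) (auto simp: b_def block_def)
qed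


text \<open>By maximality no combination of block 0 lies above the endpoint and at or below
  \<open>K a\<close>. Every \<open>x\<close> of the class \<open>C\<close> with \<open>K x\<close>
  in that stretch thus has the cut of \<open>a\<close> and the truth value of \<open>a\<close>. So
  \<open>a\<close> itself can serve as \<open>e\<close>; conversely, any \<open>e\<close> leaves
  elements of the class below both \<open>a\<close> and \<open>e\<close>, by density.
  \<open>C\<close> is kept abstract so that the coset case and the generic case share the
  argument.\<close>

lemma near_iff:
  assumes inv: "sat_invariant r N \<phi>" and rm: "m < r" and K: "K > 0" "\<And>n. 1 \<le> n \<Longrightarrow> n \<le> N \<Longrightarrow> n dvd K"
    and N: "N \<ge> 0"
    and v: "assignment v" and a: "a \<in> carrier M"
    and below: "pos (of_int K * lift a - lin r p (block r m 1 v))"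
    and max: "\<And>t p'. t \<in> {0, 1} \<Longrightarrow> p' \<in> combs r 0 (K * N) \<Longrightarrow>
       \<not> pos (lin r p' (block r m t v) - of_int K * lift a) \<Longrightarrow>
       \<not> pos (lin r p' (block r m t v) - lin r p (block r m 1 v))"
    and Ca: "C v (lift a)"
    and C_null: "\<And>x x'. null (x - x') \<Longrightarrow> C v x \<Longrightarrow> C v x'"
    and C_close: "\<And>x. C v x \<Longrightarrow> \<exists>W g. W \<in> {UNIV, G} \<and> g \<in> W \<and> null (lift a - x - of_int K * g) \<and>
       (W = UNIV \<longrightarrow> (\<forall>p\<in>combs r 0 (K * N). of_int K * lift a - lin r p (block r m 0 v) \<notin> G \<and>
                of_int K * x - lin r p (block r m 0 v) \<notin> G))"
    and C_dense: "\<And>\<beta>. pos (\<beta> - lin r p (block r m 1 v)) \<Longrightarrow>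
       \<exists>x. pos (of_int K * x - lin r p (block r m 1 v)) \<and> pos (\<beta> - of_int K * x) \<and> C v x"
  shows "near r m K p C \<phi> v \<longleftrightarrow> sat M (instance_of m v a) \<phi>"
proof -
  define \<alpha> where "\<alpha> = lin r p (block r m 1 v)"
  have ua: "unit_rep (lift a)" using a by (rule unit_rep_lift)
  have same: "sat M (instance_of m v a) \<phi> \<longleftrightarrow> sat M (instance_of m v x) \<phi>"
    if x: "x \<in> carrier M" "pos (of_int K * lift x - \<alpha>)" "\<not> pos (lift x - lift a)" "C v (lift x)" for x
  proof -
    obtain W g where W: "W \<in> {UNIV, G}" "g \<in> W" "null (lift a - lift x - of_int K * g)"
      "W = UNIV \<Longrightarrow> (\<forall>p\<in>combs r 0 (K * N). of_int K * lift a - lin r p (block r m 0 v) \<notin> G \<and>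
                of_int K * lift x - lin r p (block r m 0 v) \<notin> G)"
      using C_close[OF x(4)] by blast
    have "\<not> pos (of_int K * (lift x - lift a))" using x(3) pos_scale[OF K(1)] by simp
    then have le: "\<not> pos (of_int K * lift x - of_int K * lift a)" by (simp add: algebra_simps)
    have cut: "(pos (of_int K * lift a - lin r p' (block r m 0 v)) \<longleftrightarrow>
          pos (of_int K * lift x - lin r p' (block r m 0 v))) \<and>
       (pos (lin r p' (block r m 0 v) - of_int K * lift a) \<longleftrightarrow>
          pos (lin r p' (block r m 0 v) - of_int K * lift x))"
      if p': "p' \<in> combs r 0 (K * N)" for p'
    proof (cases "pos (lin r p' (block r m 0 v) - of_int K * lift a)")
      case True
      then have "pos (lin r p' (block r m 0 v) - of_int K * lift x)"
        using le leq_lt_trans by blast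
      then show ?thesis using True lt_imp_leq by blast
    next
      case False
      then have "\<not> pos (lin r p' (block r m 0 v) - \<alpha>)" using max[of 0] p' by (simp add: \<alpha>_def)
      then have "pos (of_int K * lift x - lin r p' (block r m 0 v))"
        "pos (of_int K * lift a - lin r p' (block r m 0 v))"
        using x(2) below leq_lt_trans unfolding \<alpha>_def by blast+
      then show ?thesis using lt_imp_leq by blast
    qed
    have "sat M (instance_of m v (proj (lift a))) \<phi> \<longleftrightarrow> sat M (instance_of m v (proj (lift x))) \<phi>"
      by (rule sat_instance_cong[OF inv rm K v ua unit_rep_lift[OF x(1)] cut W])
    then show ?thesis using a x(1) by (simp add: proj_lift)
  qed
  show ?thesis
  proof
    assume "sat M (instance_of m v a) \<phi>"
    then show "near r m K p C \<phi> v"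
      unfolding near_def using same a below lt_imp_leq unfolding \<alpha>_def by blast
  next
    assume "near r m K p C \<phi> v"
    then obtain e where e: "e \<in> carrier M" "pos (of_int K * lift e - \<alpha>)"
      "\<And>x. x \<in> carrier M \<Longrightarrow> pos (of_int K * lift x - \<alpha>) \<Longrightarrow> pos (lift e - lift x) \<Longrightarrow>
         C v (lift x) \<Longrightarrow> sat M (instance_of m v x) \<phi>"
      unfolding near_def \<alpha>_def by blast
    \<comment> \<open>The smaller of \<open>a\<close> and \<open>e\<close>: an element of the class
      below it is subject both to the hypothesis on \<open>e\<close> and to
      \<open>same\<close>.\<close>
    define d where "d = (if pos (lift e - lift a) then a else e)"
    have d: "d \<in> carrier M" "pos (of_int K * lift d - \<alpha>)"
      "\<not> pos (lift d - lift a)" "\<not> pos (lift d - lift e)"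
      using e(1,2) a below lt_imp_leq[of "lift e" "lift a"] by (auto simp: d_def \<alpha>_def)
    obtain y where y: "pos (of_int K * y - \<alpha>)" "pos (of_int K * lift d - of_int K * y)" "C v y"
      using C_dense[of "of_int K * lift d"] d(2) unfolding \<alpha>_def by blast
    have "pos (of_int K * (lift d - y))" using y(2) by (simp add: algebra_simps)
    then have yd: "pos (lift d - y)" using pos_scale[OF K(1)] by simp
    \<comment> \<open>Density yields \<open>y\<close> only in the cover; to come from the model it
      must lie in [0, 1). It is positive because the endpoint dominates the zero combination, and
      below 1 because it is below \<open>d\<close>.\<close>
    have "0 \<le> K * N" using K(1) N by simp
    then obtain z where z: "z \<in> combs r 0 (K * N)" "\<forall>u. lin r z u = 0"
      using combs_ex[of r "\<lambda>i. 0" "K * N" 0] by auto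
    have "\<not> pos (- (of_int K * lift a))"
      using ua pos_scale[OF K(1), of "- lift a"] by (simp add: unit_rep_def)
    then have "\<not> pos (lin r z (block r m 1 v) - of_int K * lift a)" using z(2) by simp
    then have "\<not> pos (0 - \<alpha>)" using max[of 1 z] z unfolding \<alpha>_def by simp
    then have "pos (of_int K * y - 0)" using y(1) leq_lt_trans by blast
    then have "pos y" using pos_scale[OF K(1)] by simp
    moreover have "pos (1 - y)"
      using yd unit_rep_lift[OF d(1)] lt_trans unfolding unit_rep_def by blast
    ultimately have uy: "unit_rep y" using pos_asym by (simp add: unit_rep_def)
    define x where "x = proj y"
    have nx: "null (lift x - y)" unfolding x_def by (rule null_lift_proj[OF uy])
    have ny: "null (y - lift x)" using nx null_diff_commute by blast
    have x: "x \<in> carrier M" by (simp add: x_def proj_closed)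
    have "null ((of_int K * lift x - \<alpha>) - (of_int K * y - \<alpha>))"
      using null_mult[OF nx, of K] by (simp add: algebra_simps)
    then have 1: "pos (of_int K * lift x - \<alpha>)" using y(1) pos_cong by blast
    have "null ((lift d - lift x) - (lift d - y))" using ny by simp
    then have dx: "pos (lift d - lift x)" using yd pos_cong by blast
    then have 2: "pos (lift e - lift x)" "\<not> pos (lift x - lift a)"
      using d(3,4) lt_leq_trans lt_imp_leq by blast+
    have 3: "C v (lift x)" using C_null[OF ny y(3)] .
    show "sat M (instance_of m v a) \<phi>" using same[OF x 1 2(2) 3] e(3)[OF x 1 2(1) 3] by blast
  qed
qed

section \<open>The finite code of a type and its completeness\<close>

abbreviation tuple_val :: "'a list \<Rightarrow> nat \<Rightarrow> 'a" where
  "tuple_val xs \<equiv> \<lambda>i. if i < length xs then xs ! i else \<one>\<^bsub>M\<^esub>"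

lemma tuple_assignment:
  assumes "b \<in> tuples M m" "b1 \<in> tuples M m" "b2 \<in> tuples M m"
  defines "v \<equiv> tuple_val (b @ concat [b1, b2])"
  shows "assignment v" "block r m 0 v = block r m 0 ((!) b)" "block r m 1 v = block r m 0 ((!) b1)"
    "block r m 2 v = block r m 0 ((!) b2)"
    "sat M (instance_of m v x) \<phi> \<longleftrightarrow> sat_tuple M (x # b) \<phi>"
proof -
  have len: "length b = m" "length b1 = m" "length b2 = m" using assms(1-3) by (auto simp: tuples_def)
  show "assignment v"
    unfolding assignment_def v_def
  proof (rule image_subsetI)
    fix i
    have "\<one>\<^bsub>M\<^esub> \<in> carrier M" using proj_closed[of 0] by (simp add: proj_zero)
    moreover have "set (b @ concat [b1, b2]) \<subseteq> carrier M" using assms(1-3) by (auto simp: tuples_def)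
    ultimately show "(if i < length (b @ concat [b1, b2]) then (b @ concat [b1, b2]) ! i else \<one>\<^bsub>M\<^esub>)
       \<in> carrier M"
      using nth_mem by (metis subsetD)
  qed
  show "block r m 0 v = block r m 0 ((!) b)"
    by (rule ext) (auto simp: block_def v_def len nth_append)
  show "block r m 1 v = block r m 0 ((!) b1)"
    by (rule ext) (auto simp: block_def v_def len nth_append)
  show "block r m 2 v = block r m 0 ((!) b2)"
    by (rule ext) (auto simp: block_def v_def len nth_append)
  have "instance_of m v x = (\<lambda>i. if i < length (x # b) then (x # b) ! i else \<one>\<^bsub>M\<^esub>)"
    by (rule ext) (auto simp: instance_of_def v_def len nth_append nth_Cons')
  then show "sat M (instance_of m v x) \<phi> \<longleftrightarrow> sat_tuple M (x # b) \<phi>"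
    by (simp add: sat_tuple_def)
qed

text \<open>The finite code of a type: \<open>kd\<close> selects the exact, coset or generic case,
  \<open>p\<close> is the combination at the left endpoint, \<open>q\<close> the one naming the
  coset, \<open>j\<close> the residue modulo \<open>K\<close>.\<close>

definition cut_relation ::
    "nat \<Rightarrow> nat \<Rightarrow> int \<Rightarrow> int \<Rightarrow> nat \<times> (nat \<Rightarrow> int) \<times> (nat \<Rightarrow> int) \<times> int \<Rightarrow> fm \<Rightarrow> (nat \<Rightarrow> 'a) \<Rightarrow> bool" where
  "cut_relation r m K N = (\<lambda>(kd, p, q, j) \<phi>.
     if kd = 0 then at_point r m K p \<phi>
     else if kd = 1 then near r m K p (coset_cond r m K q) \<phi>
     else near r m K p (generic_cond r m K N j) \<phi>)"

lemma definable_cut_relation: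
  "partitioned m \<phi> \<Longrightarrow> K > 0 \<Longrightarrow> definable {..<3 * m} (cut_relation r m K N c \<phi>)"
  unfolding cut_relation_def
  by (auto simp: definable_at_point definable_near_coset definable_near_generic split: prod.split)

text \<open>The order of quantifiers is the point: the code and the two tuples depend on
  \<open>a\<close> and \<open>B\<close>, but neither on \<open>b\<close> nor on
  \<open>\<phi>\<close>, and the codes form a finite set depending on neither \<open>a\<close> nor
  \<open>B\<close>. This is uniform definability.\<close>

lemma cut_relation_complete:
  assumes rm: "m < r" and K: "K > 0" "\<And>n. 1 \<le> n \<Longrightarrow> n \<le> N \<Longrightarrow> n dvd K" and N: "N \<ge> 1"
    and B: "finite B" "B \<noteq> {}" "B \<subseteq> tuples M m" and a: "a \<in> carrier M"
  shows "\<exists>c\<in>{0, 1, 2} \<times> combs r 0 (K * N) \<times> combs r 0 (K * N + K * K) \<times> {0..<K}. \<exists>b1\<in>B. \<exists>b2\<in>B.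
     \<forall>\<phi> b. sat_invariant r N \<phi> \<longrightarrow> b \<in> B \<longrightarrow>
       (sat_tuple M (a # b) \<phi> \<longleftrightarrow>
        cut_relation r m K N c \<phi>
          (tuple_val (b @ concat [b1, b2])))"
proof -
  define X where "X = lift a"
  define Y where "Y b = block r m 0 ((!) b)" for b :: "'a list"
  define P where "P = combs r 0 (K * N)"
  let ?v = "\<lambda>b b1 b2. tuple_val (b @ concat [b1, b2])"
  note ta = tuple_assignment(1)[OF subsetD[OF B(3)] subsetD[OF B(3)] subsetD[OF B(3)]]
    tuple_assignment(2-4)[where r = r, OF subsetD[OF B(3)] subsetD[OF B(3)] subsetD[OF B(3)]]
    tuple_assignment(5)[OF subsetD[OF B(3)] subsetD[OF B(3)] subsetD[OF B(3)]]
  have uX: "unit_rep X" unfolding X_def by (rule unit_rep_lift[OF a])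
  have KN: "0 \<le> K * N" using K(1) N by simp
  obtain z where z: "z \<in> P" "\<forall>u. lin r z u = 0"
    using combs_ex[of r "\<lambda>i. 0" "K * N" 0] KN unfolding P_def by auto
  have Q: "\<exists>q\<in>combs r 0 (K * N + K * K). True"
    using combs_ex[of r "\<lambda>i. 0" "K * N + K * K" 0] KN by auto
  have Yr: "Y b r = 1" for b by (simp add: Y_def block_def)
  \<comment> \<open>The maximum is taken over the combinations of all tuples of \<open>B\<close>
    together, so that one \<open>b1\<close> is the left endpoint for every \<open>b\<close>.\<close>
  let ?S = "{(p, b) \<in> P \<times> B. \<not> pos (lin r p (Y b) - of_int K * X)}"
  have "finite (P \<times> B)" using B(1) finite_combs unfolding P_def by blast
  then have "finite ?S" by (rule rev_finite_subset) auto
  have "\<not> pos (- (of_int K * X))"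
    using uX pos_scale[OF K(1), of "- X"] by (simp add: unit_rep_def)
  moreover obtain b0 where "b0 \<in> B" using B(2) by blast
  ultimately have "(z, b0) \<in> ?S" using z by simp
  then have "?S \<noteq> {}" by blast
  with \<open>finite ?S\<close> obtain p b1 where S: "(p, b1) \<in> ?S"
    "\<forall>s\<in>?S. \<not> pos (lin r (fst s) (Y (snd s)) - lin r p (Y b1))"
    using finite_max[of ?S "\<lambda>s. lin r (fst s) (Y (snd s))"] by fastforce
  have p: "p \<in> P" and b1: "b1 \<in> B" and pX: "\<not> pos (lin r p (Y b1) - of_int K * X)" using S(1) by auto
  have max: "\<not> pos (lin r p' (Y b) - lin r p (Y b1))"
    if "p' \<in> P" "b \<in> B" "\<not> pos (lin r p' (Y b) - of_int K * X)" for p' b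
    using S(2) that by fastforce
  show ?thesis
  proof (cases "null (of_int K * X - lin r p (Y b1))")
    case True
    obtain q where q: "q \<in> combs r 0 (K * N + K * K)" using Q by blast
    have "sat_tuple M (a # b) \<phi> \<longleftrightarrow> cut_relation r m K N (0, p, q, 0) \<phi> (?v b b1 b1)"
      if "b \<in> B" for \<phi> b
    proof -
      \<comment> \<open>\<open>K x\<close> determines \<open>x\<close>: the cover has no torsion
        modulo null elements, and representatives in [0, 1) are unique.\<close>
      have uniq: "x = a" if "x \<in> carrier M" "null (of_int K * lift x - lin r p (Y b1))" for x
      proof -
        have "null (of_int K * (lift x - X))"
          using null_diff[OF that(2) True] by (simp add: algebra_simps)
        then have "null (lift x - X)" using null_scale[OF K(1)] by simp
        then show ?thesis using lift_inj[OF that(1) a] unfolding X_def by simp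
      qed
      have "at_point r m K p \<phi> (?v b b1 b1) \<longleftrightarrow>
         (\<exists>x\<in>carrier M. null (of_int K * lift x - lin r p (Y b1)) \<and> sat_tuple M (x # b) \<phi>)"
        unfolding at_point_def ta(3,5)[OF that b1 b1] Y_def[symmetric] ..
      also have "\<dots> \<longleftrightarrow> sat_tuple M (a # b) \<phi>"
        using uniq a True unfolding X_def by blast
      finally have "at_point r m K p \<phi> (?v b b1 b1) \<longleftrightarrow> sat_tuple M (a # b) \<phi>" .
      then show ?thesis by (simp add: cut_relation_def)
    qed
    then show ?thesis using p q b1 K(1) unfolding P_def
      by (intro bexI[of _ "(0, p, q, 0)"] bexI[of _ b1]) auto
  next
    case False
    then have below: "pos (of_int K * X - lin r p (Y b1))"
      using pX by (auto simp: null_def)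
    show ?thesis
    proof (cases "\<exists>p'\<in>P. \<exists>b2\<in>B. of_int K * X - lin r p' (Y b2) \<in> G")
      case True
      then obtain p' b2 where p': "p' \<in> P" "b2 \<in> B" "of_int K * X - lin r p' (Y b2) \<in> G" by blast
      have KK: "K * K > 0" using K(1) by simp
      obtain h k where h: "h \<in> G" "0 \<le> k" "k < K * K"
        "null (of_int K * X - lin r p' (Y b2) - of_int (K * K) * h - of_int k)"
        using divisible_mod[of G _ "K * K"] p'(3) KK by blast
      \<comment> \<open>The integer residue \<open>k\<close> is absorbed by the coefficient of the
        unit at index \<open>r\<close>; hence the bound \<open>K * N + K * K\<close> for the
        combination of the coset.\<close>
      let ?q = "p'(r := p' r + k)"
      have "\<forall>i\<le>r. \<bar>?q i\<bar> \<le> K * N + K * K"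
      proof (intro allI impI)
        fix i assume "i \<le> r"
        then have "\<bar>p' i\<bar> \<le> K * N" using combsD(2)[OF p'(1)[unfolded P_def]] by blast
        then show "\<bar>?q i\<bar> \<le> K * N + K * K" using h(2,3) KK by (cases "i = r") auto
      qed
      moreover have "?q 0 = 0" using combsD(1)[OF p'(1)[unfolded P_def]] rm by simp
      ultimately obtain q where q: "q \<in> combs r 0 (K * N + K * K)" "\<forall>u. lin r q u = lin r ?q u"
        using combs_ex[of r ?q "K * N + K * K" 0] by auto
      have lq: "lin r q (Y b2) = lin r p' (Y b2) + of_int k"
        using q(2) lin_upd_coeff[of r r p' k "Y b2"] Yr by simp
      have mX: "null (of_int K * X - lin r q (Y b2) - of_int (K * K) * h)"
        using h(4) unfolding lq by (simp add: algebra_simps)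
      have "sat_tuple M (a # b) \<phi> \<longleftrightarrow> cut_relation r m K N (1, p, q, 0) \<phi> (?v b b1 b2)"
        if inv: "sat_invariant r N \<phi>" and b: "b \<in> B" for \<phi> b
      proof -
        note tb = ta[OF b b1 p'(2), folded Y_def]
        have "near r m K p (coset_cond r m K q) \<phi> (?v b b1 b2) \<longleftrightarrow> sat M (instance_of m (?v b b1 b2) a) \<phi>"
        proof (rule near_iff[OF inv rm K])
          show "pos (of_int K * lift a - lin r p (block r m 1 (?v b b1 b2)))"
            using below unfolding tb X_def .
          show "\<not> pos (lin r p' (block r m t (?v b b1 b2)) - lin r p (block r m 1 (?v b b1 b2)))"
            if "t \<in> {0, 1}" "p' \<in> combs r 0 (K * N)"
              "\<not> pos (lin r p' (block r m t (?v b b1 b2)) - of_int K * lift a)" for t p'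
            using that max[of p' b] max[of p' b1] b b1 unfolding X_def P_def by (auto simp only: tb insert_iff empty_iff simp_thms)
          show "coset_cond r m K q (?v b b1 b2) (lift a)"
            unfolding coset_cond_def multiple_def tb X_def[symmetric] using mX h(1) by blast
          show "coset_cond r m K q (?v b b1 b2) x'"
            if "null (x - x')" "coset_cond r m K q (?v b b1 b2) x" for x x'
          proof -
            have "null ((of_int K * x - lin r q (block r m 2 (?v b b1 b2)))
                 - (of_int K * x' - lin r q (block r m 2 (?v b b1 b2))))"
              using null_mult[OF that(1), of K] by (simp add: algebra_simps)
            then show ?thesis using that(2) multiple_null unfolding coset_cond_def by blast
          qed
          show "\<exists>W g. W \<in> {UNIV, G} \<and> g \<in> W \<and> null (lift a - x - of_int K * g) \<and>
             (W = UNIV \<longrightarrow> (\<forall>p\<in>combs r 0 (K * N).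
                of_int K * lift a - lin r p (block r m 0 (?v b b1 b2)) \<notin> G \<and>
                of_int K * x - lin r p (block r m 0 (?v b b1 b2)) \<notin> G))"
            if x: "coset_cond r m K q (?v b b1 b2) x" for x
          proof -
            obtain g where g: "g \<in> G" "null (of_int K * x - lin r q (Y b2) - of_int (K * K) * g)"
              using x unfolding coset_cond_def multiple_def tb by blast
            have "of_int K * (X - x - of_int K * (h - g)) =
               (of_int K * X - lin r q (Y b2) - of_int (K * K) * h)
               - (of_int K * x - lin r q (Y b2) - of_int (K * K) * g)" by (simp add: algebra_simps)
            then have "null (of_int K * (X - x - of_int K * (h - g)))"
              using null_diff[OF mX g(2)] by simp
            then have *: "null (lift a - x - of_int K * (h - g))"
              using null_scale[OF K(1)] unfolding X_def by blast
            \<comment> \<open>With \<open>W = G\<close> the clause about \<open>W = UNIV\<close> is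
              vacuous, provided that the two sets differ.\<close>
            have "G \<noteq> UNIV" using infinite_index[of "{0}"] by auto
            then show ?thesis using * G_diff[OF h(1) g(1)] by (intro exI[of _ G] exI[of _ "h - g"]) auto
          qed
          show "\<exists>x. pos (of_int K * x - lin r p (block r m 1 (?v b b1 b2))) \<and> pos (\<beta> - of_int K * x) \<and>
              coset_cond r m K q (?v b b1 b2) x"
            if \<beta>: "pos (\<beta> - lin r p (block r m 1 (?v b b1 b2)))" for \<beta>
          proof -
            obtain g where g: "g \<in> G"
              "pos (of_int K * (X + of_int K * g) - lin r p (block r m 1 (?v b b1 b2)))"
              "pos (\<beta> - of_int K * (X + of_int K * g))"
              using dense_coset[OF \<beta> K(1) K(1)] by blast
            have eq: "of_int K * (X + of_int K * g) - lin r q (Y b2) - of_int (K * K) * (h + g)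
               = of_int K * X - lin r q (Y b2) - of_int (K * K) * h" by (simp add: algebra_simps)
            have "null (of_int K * (X + of_int K * g) - lin r q (Y b2) - of_int (K * K) * (h + g))"
              using mX by (simp only: eq)
            then have "coset_cond r m K q (?v b b1 b2) (X + of_int K * g)"
              unfolding coset_cond_def multiple_def tb using G_add[OF h(1) g(1)] by blast
            then show ?thesis using g by blast
          qed
        qed (use N tb a in auto)
        then show ?thesis unfolding tb(5) by (simp add: cut_relation_def)
      qed
      then show ?thesis using p q b1 p'(2) K(1) unfolding P_def
        by (intro bexI[of _ "(1, p, q, 0)"] bexI[of _ b1] bexI[of _ b2]) auto
    next
      case generic: False
      obtain y k where y: "0 \<le> k" "k < K" "null (X - of_int K * y - of_int k)"
        using divisible_mod[of UNIV X K] K(1) by blast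
      obtain q where q: "q \<in> combs r 0 (K * N + K * K)" using Q by blast
      have mX: "null (X - of_int k - of_int K * y)" using y(3) by (simp add: algebra_simps)
      \<comment> \<open>No coset is named in the generic case; \<open>b1\<close> fills the place of
        the second tuple.\<close>
      have "sat_tuple M (a # b) \<phi> \<longleftrightarrow> cut_relation r m K N (2, p, q, k) \<phi> (?v b b1 b1)"
        if inv: "sat_invariant r N \<phi>" and b: "b \<in> B" for \<phi> b
      proof -
        note tb = ta[OF b b1 b1, folded Y_def]
        have gX: "of_int K * X - lin r p' (Y b) \<notin> G" if "p' \<in> combs r 0 (K * N)" for p'
          using generic that b unfolding P_def by blast
        have "near r m K p (generic_cond r m K N k) \<phi> (?v b b1 b1) \<longleftrightarrow> sat M (instance_of m (?v b b1 b1) a) \<phi>"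
        proof (rule near_iff[OF inv rm K])
          show "pos (of_int K * lift a - lin r p (block r m 1 (?v b b1 b1)))"
            using below unfolding tb X_def .
          show "\<not> pos (lin r p' (block r m t (?v b b1 b1)) - lin r p (block r m 1 (?v b b1 b1)))"
            if "t \<in> {0, 1}" "p' \<in> combs r 0 (K * N)"
              "\<not> pos (lin r p' (block r m t (?v b b1 b1)) - of_int K * lift a)" for t p'
            using that max[of p' b] max[of p' b1] b b1 unfolding X_def P_def by (auto simp only: tb insert_iff empty_iff simp_thms)
          show "generic_cond r m K N k (?v b b1 b1) (lift a)"
            unfolding generic_cond_def multiple_def tb X_def[symmetric] using mX gX by blast
          show "generic_cond r m K N k (?v b b1 b1) x'"
            if x: "null (x - x')" "generic_cond r m K N k (?v b b1 b1) x" for x x'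
          proof -
            have "null ((x - of_int k) - (x' - of_int k))" using x(1) by simp
            then have "multiple K UNIV (x' - of_int k)"
              using x(2) multiple_null unfolding generic_cond_def by blast
            moreover have "of_int K * x' - lin r p' (block r m 0 (?v b b1 b1)) \<notin> G"
              if "p' \<in> combs r 0 (K * N)" for p'
            proof -
              have "(of_int K * x - lin r p' (block r m 0 (?v b b1 b1)))
                 - (of_int K * x' - lin r p' (block r m 0 (?v b b1 b1))) \<in> G"
                using G_null[OF null_mult[OF x(1), of K]] by (simp add: algebra_simps)
              then show ?thesis using x(2) that G_cong unfolding generic_cond_def by blast
            qed
            ultimately show ?thesis unfolding generic_cond_def by blast
          qed
          show "\<exists>W g. W \<in> {UNIV, G} \<and> g \<in> W \<and> null (lift a - x - of_int K * g) \<and>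
             (W = UNIV \<longrightarrow> (\<forall>p\<in>combs r 0 (K * N).
                of_int K * lift a - lin r p (block r m 0 (?v b b1 b1)) \<notin> G \<and>
                of_int K * x - lin r p (block r m 0 (?v b b1 b1)) \<notin> G))"
            if x: "generic_cond r m K N k (?v b b1 b1) x" for x
          proof -
            obtain g where g: "null (x - of_int k - of_int K * g)"
              using x unfolding generic_cond_def multiple_def by blast
            have eq: "X - x - of_int K * (y - g) = (X - of_int k - of_int K * y) - (x - of_int k - of_int K * g)"
              by (simp add: algebra_simps)
            have "null (lift a - x - of_int K * (y - g))"
              using null_diff[OF mX g] unfolding X_def[symmetric] by (simp only: eq)
            then show ?thesis
              using x gX unfolding generic_cond_def tb X_def
              by (intro exI[of _ UNIV] exI[of _ "y - g"]) auto
          qed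
          show "\<exists>x. pos (of_int K * x - lin r p (block r m 1 (?v b b1 b1))) \<and> pos (\<beta> - of_int K * x) \<and>
              generic_cond r m K N k (?v b b1 b1) x"
            if \<beta>: "pos (\<beta> - lin r p (block r m 1 (?v b b1 b1)))" for \<beta>
          proof -
            let ?F = "(\<lambda>p'. lin r p' (Y b)) ` combs r 0 (K * N)"
            have F: "finite ?F" using finite_combs by blast
            obtain w where w: "pos (of_int K * (of_int K * w + of_int k) - lin r p (block r m 1 (?v b b1 b1)))"
              "pos (\<beta> - of_int K * (of_int K * w + of_int k))"
              "\<And>f. f \<in> ?F \<Longrightarrow> of_int K * (of_int K * w + of_int k) - f \<notin> G"
              by (rule dense_generic[OF \<beta> K(1) F, of k]) auto
            have "null ((of_int K * w + of_int k) - of_int k - of_int K * w)" by simp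
            then have "generic_cond r m K N k (?v b b1 b1) (of_int K * w + of_int k)"
              unfolding generic_cond_def multiple_def tb using w(3) by blast
            then show ?thesis using w(1,2) by blast
          qed
        qed (use N tb a in auto)
        then show ?thesis unfolding tb(5) by (simp add: cut_relation_def)
      qed
      then show ?thesis using p q b1 y(1,2) unfolding P_def
        by (intro bexI[of _ "(2, p, q, k)"] bexI[of _ b1]) auto
    qed
  qed
qed

lemma UDTFS_2:
  assumes \<Delta>: "finite \<Delta>" "\<forall>\<phi>\<in>\<Delta>. partitioned m \<phi>"
  shows "UDTFS M m \<Delta> 2"
proof -
  obtain r where r: "m < r" "\<forall>\<phi>\<in>\<Delta>. vars \<phi> \<subseteq> {..<r}"
  proof -
    have "finite (insert m (\<Union>(vars ` \<Delta>)))" using \<Delta>(1) finite_vars by simp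
    then obtain r where "\<forall>i\<in>insert m (\<Union>(vars ` \<Delta>)). i < r" using finite_nat_set_iff_bounded by blast
    then show thesis using that[of r] by auto
  qed
  obtain N where N: "N \<ge> 1" "\<forall>\<phi>\<in>\<Delta>. sat_invariant r N \<phi>"
    using sat_invariant_finite[OF \<Delta>(1) r(2)] by blast
  define K :: int where "K = fact (nat N)"
  have K: "n dvd K" if "1 \<le> n" "n \<le> N" for n
    unfolding K_def using that by (rule int_dvd_fact)
  have K0: "K > 0" unfolding K_def by simp
  define X where "X = {0, 1, 2 :: nat} \<times> combs r 0 (K * N) \<times> combs r 0 (K * N + K * K) \<times> {0..<K}"
  have "finite X" unfolding X_def by (intro finite_cartesian_product finite_combs) auto
  \<comment> \<open>The codes are numbered, as \<open>UDTFS\<close> takes its indices from the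
    natural numbers.\<close>
  then obtain n :: nat and f where f: "X = f ` {i. i < n}"
    using finite_imp_nat_seg_image_inj_on by blast
  define R where "R i = cut_relation r m K N (f i)" for i
  define \<psi> where "\<psi> i \<phi> = (SOME \<eta>. fv \<eta> \<subseteq> {..<3 * m} \<and>
     (\<forall>v. assignment v \<longrightarrow> (sat M v \<eta> \<longleftrightarrow> R i \<phi> v)))" for i \<phi>
  have \<psi>: "fv (\<psi> i \<phi>) \<subseteq> {..<3 * m} \<and> (\<forall>v. assignment v \<longrightarrow> (sat M v (\<psi> i \<phi>) \<longleftrightarrow> R i \<phi> v))"
    if "\<phi> \<in> \<Delta>" for i \<phi>
  proof -
    have "definable {..<3 * m} (R i \<phi>)"
      unfolding R_def using \<Delta>(2) that K0 by (intro definable_cut_relation) auto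
    then show ?thesis unfolding \<psi>_def definable_def by (rule someI_ex)
  qed
  show ?thesis
    unfolding UDTFS_def
  proof (intro exI[of _ "{..<n}"] exI[of _ \<psi>] conjI allI impI ballI)
    show "fv (\<psi> i \<phi>) \<subseteq> {..<(2 + 1) * m}" if "\<phi> \<in> \<Delta>" for i \<phi>
      using \<psi>[OF that] by simp
    fix B q
    assume "finite B \<and> B \<subseteq> tuples M m \<and> 2 \<le> card B \<and> complete_type M \<Delta> B q"
    then have B: "finite B" "B \<noteq> {}" "B \<subseteq> tuples M m" and q: "complete_type M \<Delta> B q" by auto
    have "q \<subseteq> \<Delta> \<times> B \<times> UNIV" using q by (simp add: complete_type_def)
    \<comment> \<open>Over a finite \<open>B\<close> the type is itself finite, so finite
      satisfiability gives one element \<open>a\<close> of \<open>M\<close> realising all of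
      it.\<close>
    then have "finite q" by (rule finite_subset) (use \<Delta>(1) B(1) in auto)
    then obtain a where a: "a \<in> carrier M" "\<forall>(\<phi>, b, s)\<in>q. sat_tuple M (a # b) \<phi> \<longleftrightarrow> s"
      using q unfolding complete_type_def by blast
    have qa: "(\<phi>, b, True) \<in> q \<longleftrightarrow> sat_tuple M (a # b) \<phi>" if "\<phi> \<in> \<Delta>" "b \<in> B" for \<phi> b
    proof
      show "sat_tuple M (a # b) \<phi>" if "(\<phi>, b, True) \<in> q" using a(2) that by auto
      show "(\<phi>, b, True) \<in> q" if s: "sat_tuple M (a # b) \<phi>"
      proof -
        have "(\<phi>, b, False) \<notin> q" using a(2) s by auto
        then show ?thesis using q \<open>\<phi> \<in> \<Delta>\<close> \<open>b \<in> B\<close> unfolding complete_type_def by blast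
      qed
    qed
    obtain c b1 b2 where c: "c \<in> X" "b1 \<in> B" "b2 \<in> B"
      "\<And>\<phi> b. sat_invariant r N \<phi> \<Longrightarrow> b \<in> B \<Longrightarrow>
       (sat_tuple M (a # b) \<phi> \<longleftrightarrow>
        cut_relation r m K N c \<phi>
          (tuple_val (b @ concat [b1, b2])))"
      using cut_relation_complete[OF r(1) K0 K N(1) B a(1)] unfolding X_def by blast
    obtain i where i: "i < n" "c = f i" using c(1) f by blast
    have "(\<phi>, b, True) \<in> q \<longleftrightarrow> sat_tuple M (b @ concat [b1, b2]) (\<psi> i \<phi>)"
      if "\<phi> \<in> \<Delta>" "b \<in> B" for \<phi> b
    proof -
      have "sat_invariant r N \<phi>" using N(2) that(1) by blast
      moreover have "assignment (tuple_val (b @ concat [b1, b2]))"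
        using tuple_assignment(1) B(3) that(2) c(2,3) by blast
      ultimately show ?thesis
        unfolding qa[OF that] sat_tuple_def[of M "b @ concat [b1, b2]"]
        using c(4) that(2) \<psi>[OF that(1)] unfolding R_def i(2) by blast
    qed
    then show "\<exists>bs. length bs = 2 \<and> set bs \<subseteq> B \<and>
       (\<exists>i\<in>{..<n}. \<forall>\<phi>\<in>\<Delta>. \<forall>b\<in>B. (\<phi>, b, True) \<in> q \<longleftrightarrow> sat_tuple M (b @ concat bs) (\<psi> i \<phi>))"
      using i(1) c(2,3) by (intro exI[of _ "[b1, b2]"] conjI bexI[of _ i]) auto
  qed simp
qed

end

section \<open>The universal cover of an oriented abelian group\<close>

context oriented_abelian_group
begin

lemma ori_distinct:
  assumes "a \<in> carrier A" "b \<in> carrier A" "c \<in> carrier A" "ori A a b c"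
  shows "a \<noteq> b" "b \<noteq> c" "a \<noteq> c"
  using assms ori_asym ori_cyclic by blast+

lemma ori_rotate:
  assumes "a \<in> carrier A" "b \<in> carrier A" "c \<in> carrier A"
  shows "ori A a b c \<longleftrightarrow> ori A b c a"
  using assms ori_cyclic by blast

lemma ori_translate_iff:
  assumes "a \<in> carrier A" "b \<in> carrier A" "c \<in> carrier A" "d \<in> carrier A"
  shows "ori A (a \<otimes> d) (b \<otimes> d) (c \<otimes> d) \<longleftrightarrow> ori A a b c"
proof
  assume "ori A (a \<otimes> d) (b \<otimes> d) (c \<otimes> d)"
  then have "ori A (a \<otimes> d \<otimes> inv d) (b \<otimes> d \<otimes> inv d) (c \<otimes> d \<otimes> inv d)"
    using assms by (intro ori_translate[where d = "inv d"]) auto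
  moreover have "x \<otimes> d \<otimes> inv d = x" if "x \<in> carrier A" for x
    using that assms(4) by (simp add: m_assoc)
  ultimately show "ori A a b c" using assms by simp
qed (use assms ori_translate in auto)

text \<open>Cutting the circle at the neutral element makes it the least element of a linear order.\<close>

definition lt :: "'a \<Rightarrow> 'a \<Rightarrow> bool" where
  "lt a b \<longleftrightarrow> a \<noteq> b \<and> (a = \<one> \<or> ori A \<one> a b)"

lemma lt_irrefl [simp]: "\<not> lt a a"
  by (simp add: lt_def)

lemma lt_one_iff [simp]: "lt \<one> a \<longleftrightarrow> a \<noteq> \<one>"
  by (auto simp: lt_def)

lemma not_lt_one [simp]: "a \<in> carrier A \<Longrightarrow> \<not> lt a \<one>"
  using ori_distinct(3)[of \<one> a \<one>] by (auto simp: lt_def)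

lemma ori_one: "a \<in> carrier A \<Longrightarrow> b \<in> carrier A \<Longrightarrow> ori A \<one> a b \<longleftrightarrow> a \<noteq> \<one> \<and> lt a b"
  using ori_distinct[of \<one> a b] by (auto simp: lt_def)

lemma lt_total: "a \<in> carrier A \<Longrightarrow> b \<in> carrier A \<Longrightarrow> a \<noteq> b \<Longrightarrow> lt a b \<or> lt b a"
  using ori_total[of \<one> a b] ori_rotate[of b a \<one>] ori_rotate[of a \<one> b]
  by (auto simp: lt_def)

lemma lt_trans:
  assumes "a \<in> carrier A" "b \<in> carrier A" "c \<in> carrier A" "lt a b" "lt b c"
  shows "lt a c"
proof -
  have b: "b \<noteq> \<one>" using assms not_lt_one by blast
  then have bc: "ori A \<one> b c" using assms by (auto simp: lt_def)
  show ?thesis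
  proof (cases "a = \<one>")
    case True
    then show ?thesis using ori_distinct(3)[OF _ _ _ bc] assms by auto
  next
    case False
    then have "ori A \<one> a b" using assms by (auto simp: lt_def)
    then have "ori A \<one> a c" using ori_trans[of \<one> a b c] bc assms by auto
    then show ?thesis using ori_distinct(2)[of \<one> a c] assms by (auto simp: lt_def)
  qed
qed

lemma lt_asym: "a \<in> carrier A \<Longrightarrow> b \<in> carrier A \<Longrightarrow> lt a b \<Longrightarrow> \<not> lt b a"
  using lt_trans[of a b a] by auto

lemma ori_of_lt:
  assumes "a \<in> carrier A" "b \<in> carrier A" "c \<in> carrier A" "lt a b" "lt b c"
  shows "ori A a b c"
proof (cases "a = \<one>")
  case True
  then show ?thesis using assms not_lt_one by (auto simp: lt_def)
next
  case False
  have b: "b \<noteq> \<one>" using assms not_lt_one by blast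
  have ab: "ori A \<one> a b" using False assms by (auto simp: lt_def)
  have bc: "ori A \<one> b c" using b assms by (auto simp: lt_def)
  have "ori A b c \<one>" using bc ori_rotate assms by blast
  moreover have "ori A b \<one> a" using ab ori_rotate assms by blast
  ultimately have "ori A b c a" using ori_trans[of b c \<one> a] assms by auto
  then show ?thesis using ori_rotate assms by blast
qed

lemma ori_iff_lt:
  assumes "a \<in> carrier A" "b \<in> carrier A" "c \<in> carrier A"
  shows "ori A a b c \<longleftrightarrow> lt a b \<and> lt b c \<or> lt b c \<and> lt c a \<or> lt c a \<and> lt a b"
proof
  assume o: "ori A a b c"
  note d = ori_distinct[OF assms o]
  have "\<not> ori A c b a" using o ori_asym assms by blast
  then have n: "\<not> (lt c b \<and> lt b a)" "\<not> (lt b a \<and> lt a c)" "\<not> (lt a c \<and> lt c b)"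
    using ori_of_lt[of c b a] ori_of_lt[of b a c] ori_of_lt[of a c b] ori_rotate assms by blast+
  show "lt a b \<and> lt b c \<or> lt b c \<and> lt c a \<or> lt c a \<and> lt a b"
    using n d lt_total assms by blast
next
  assume "lt a b \<and> lt b c \<or> lt b c \<and> lt c a \<or> lt c a \<and> lt a b"
  then show "ori A a b c"
    using ori_of_lt[of a b c] ori_of_lt[of b c a] ori_of_lt[of c a b] ori_rotate assms by blast
qed

section \<open>Carries and the central extension by the integers\<close>

lemma ori_shift_one:
  assumes "a \<in> carrier A" "b \<in> carrier A" "c \<in> carrier A" "d \<in> carrier A"
    "ori A a b c" "a \<otimes> d = \<one> \<or> b \<otimes> d = \<one> \<or> c \<otimes> d = \<one>"
  shows "a \<otimes> d = \<one> \<Longrightarrow> lt (b \<otimes> d) (c \<otimes> d)" "b \<otimes> d = \<one> \<Longrightarrow> lt (c \<otimes> d) (a \<otimes> d)"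
    "c \<otimes> d = \<one> \<Longrightarrow> lt (a \<otimes> d) (b \<otimes> d)"
proof -
  have *: "ori A (a \<otimes> d) (b \<otimes> d) (c \<otimes> d)" using ori_translate assms by blast
  then have "ori A (b \<otimes> d) (c \<otimes> d) (a \<otimes> d)" "ori A (c \<otimes> d) (a \<otimes> d) (b \<otimes> d)"
    using ori_rotate assms by (meson m_closed)+
  then show "a \<otimes> d = \<one> \<Longrightarrow> lt (b \<otimes> d) (c \<otimes> d)" "b \<otimes> d = \<one> \<Longrightarrow> lt (c \<otimes> d) (a \<otimes> d)"
    "c \<otimes> d = \<one> \<Longrightarrow> lt (a \<otimes> d) (b \<otimes> d)"
    using * ori_one assms by (metis m_closed)+
qed

text \<open>Otherwise, in additive notation with \<open>d = y - x\<close>, translating the triples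
  \<open>(0, x, y)\<close> and \<open>(0, -x, -y)\<close> so that another member becomes neutral
  gives the cycle \<open>d < -x < -y < -d < x < y < d\<close>.\<close>

lemma lt_inv:
  assumes x: "x \<in> carrier A" and y: "y \<in> carrier A" and "x \<noteq> \<one>" "lt x y"
  shows "lt (inv y) (inv x)"
proof (rule ccontr)
  assume n: "\<not> lt (inv y) (inv x)"
  have y1: "y \<noteq> \<one>" using assms not_lt_one by blast
  have "inv x \<noteq> inv y" using assms inv_inj[THEN inj_onD] lt_irrefl by metis
  then have xy': "lt (inv x) (inv y)" using n lt_total x y by blast
  have 1: "ori A \<one> x y" using assms ori_one by blast
  have "inv x \<noteq> \<one>" using assms(3) x by simp
  then have 2: "ori A \<one> (inv x) (inv y)" using xy' ori_one x y by simp
  define d where "d = y \<otimes> inv x"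
  have d: "d \<in> carrier A" "inv d = x \<otimes> inv y" using x y by (simp_all add: d_def inv_mult m_comm)
  have "lt d (inv x)" using ori_shift_one(2)[of \<one> x y "inv x"] 1 x y by (simp add: d_def)
  moreover have "lt (inv y) (inv d)" using ori_shift_one(3)[of \<one> x y "inv y"] 1 x y d by simp
  moreover have "lt y d" using ori_shift_one(3)[of \<one> "inv x" "inv y" y] 2 x y
    by (simp add: d_def m_comm)
  moreover have "lt (inv d) x" using ori_shift_one(2)[of \<one> "inv x" "inv y" x] 2 x y d
    by (simp add: m_comm)
  ultimately have "lt x x" using lt_trans xy' \<open>lt x y\<close> x y d(1) by (meson inv_closed)
  then show False by simp
qed

text \<open>The cocycle of the unrolling: it is \<open>1\<close> if adding \<open>b\<close> to
  \<open>a\<close> passes the neutral element, which shows in the sum falling below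
  \<open>a\<close>.\<close>

definition carry :: "'a \<Rightarrow> 'a \<Rightarrow> int" where
  "carry a b = (if lt (a \<otimes> b) a then 1 else 0)"

lemma lt_mult_iff:
  assumes "a \<in> carrier A" "b \<in> carrier A" "a \<noteq> \<one>" "b \<noteq> \<one>"
  shows "lt (a \<otimes> b) a \<longleftrightarrow> b = inv a \<or> lt (inv a) b"
proof (cases "a \<otimes> b = \<one>")
  case True
  then have "b = inv a" using assms by (metis inv_comm inv_equality)
  then show ?thesis using assms by simp
next
  case False
  then have ba: "b \<noteq> inv a" using assms by auto
  have "lt (a \<otimes> b) a \<longleftrightarrow> ori A \<one> (a \<otimes> b) a" using False assms ori_one by simp
  also have "\<dots> \<longleftrightarrow> ori A (\<one> \<otimes> inv a) ((a \<otimes> b) \<otimes> inv a) (a \<otimes> inv a)"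
    using assms by (intro ori_translate_iff[symmetric]) auto
  also have "(a \<otimes> b) \<otimes> inv a = b" using assms by (simp add: m_comm[of a b] m_assoc)
  also have "ori A (\<one> \<otimes> inv a) b (a \<otimes> inv a) \<longleftrightarrow> ori A \<one> (inv a) b"
    using assms ori_rotate[of \<one> "inv a" b] by simp
  also have "\<dots> \<longleftrightarrow> lt (inv a) b" using assms ori_one[of "inv a" b] by simp
  finally show ?thesis using ba by simp
qed

text \<open>For nontrivial elements, in additive notation, a carry means \<open>-a \<le> b\<close>;
  inversion reverses the cut order, which turns this into \<open>-b \<le> a\<close>.\<close>

lemma carry_commute:
  assumes "a \<in> carrier A" "b \<in> carrier A"
  shows "carry a b = carry b a"
proof (cases "a = \<one> \<or> b = \<one>")
  case True
  then show ?thesis using assms by (auto simp: carry_def)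
next
  case False
  have "lt (inv a) b \<longleftrightarrow> lt (inv b) a"
    using lt_inv[of "inv a" b] lt_inv[of "inv b" a] False assms by auto
  moreover have "b = inv a \<longleftrightarrow> a = inv b" using assms by auto
  ultimately show ?thesis using False assms lt_mult_iff[of a b] lt_mult_iff[of b a]
    by (simp add: carry_def)
qed

text \<open>Both sides count the full turns in the sum of the three elements. Translating by
  \<open>a\<close> turns the carry of \<open>b\<close> and \<open>d\<close> into a cyclic statement
  about \<open>a\<close>, \<open>p\<close> and \<open>q\<close>, so that only the linear order of
  these three remains to be examined.\<close>

lemma carry_cocycle:
  assumes "a \<in> carrier A" "b \<in> carrier A" "d \<in> carrier A"
  shows "carry a b + carry (a \<otimes> b) d = carry b d + carry a (b \<otimes> d)"
proof -
  define p where "p = a \<otimes> b"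
  define q where "q = a \<otimes> b \<otimes> d"
  have c: "p \<in> carrier A" "q \<in> carrier A" using assms by (auto simp: p_def q_def)
  have tr: "b \<otimes> a = p" "b \<otimes> d \<otimes> a = q" using assms by (auto simp: p_def q_def m_ac)
  have "lt (b \<otimes> d) b \<longleftrightarrow> b \<otimes> d \<noteq> b \<and> (b \<otimes> d = \<one> \<or> ori A \<one> (b \<otimes> d) b)"
    by (simp add: lt_def)
  also have "b \<otimes> d \<noteq> b \<longleftrightarrow> q \<noteq> p" unfolding tr[symmetric] using assms by simp
  also have "b \<otimes> d = \<one> \<longleftrightarrow> q = a" unfolding tr[symmetric] using assms by simp
  also have "ori A \<one> (b \<otimes> d) b \<longleftrightarrow> ori A a q p"
    using ori_translate_iff[of \<one> "b \<otimes> d" b a] assms tr by simp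
  finally have bd: "lt (b \<otimes> d) b \<longleftrightarrow> q \<noteq> p \<and>
      (q = a \<or> lt a q \<and> lt q p \<or> lt q p \<and> lt p a \<or> lt p a \<and> lt a q)"
    using ori_iff_lt[of a q p] assms c by simp
  have q': "a \<otimes> (b \<otimes> d) = q" using assms by (simp add: q_def m_assoc)
  have pd: "p \<otimes> d = q" by (simp add: p_def q_def)
  have key: "(if lt p a then 1 else 0 :: int) + (if lt q p then 1 else 0)
     = (if lt (b \<otimes> d) b then 1 else 0) + (if lt q a then 1 else 0)"
  proof -
    have tot: "x = y \<or> lt x y \<or> lt y x" and asym: "lt x y \<Longrightarrow> \<not> lt y x"
      and trans: "lt x y \<Longrightarrow> lt y z \<Longrightarrow> lt x z" if "{x, y, z} \<subseteq> {a, p, q}" for x y z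
      using that assms(1) c lt_total[of x y] lt_asym[of x y] lt_trans[of x y z] by blast+
    show ?thesis
      unfolding bd using tot[of a p] tot[of a q] tot[of p q] asym[of a p] asym[of a q] asym[of p q]
        trans[of a p q] trans[of a q p] trans[of p a q] trans[of p q a] trans[of q a p] trans[of q p a]
        lt_irrefl
      by (smt (verit) empty_subsetI insert_subset insertCI)
  qed
  show ?thesis
    using key unfolding carry_def p_def[symmetric] pd q' by simp
qed

text \<open>The central extension by the integers with cocycle \<open>carry\<close>;
  \<open>(a, k)\<close> is the point \<open>a\<close> in turn \<open>k\<close>.\<close>

definition cover :: "('a \<times> int) monoid" where
  "cover = \<lparr>carrier = carrier A \<times> UNIV,
     monoid.mult = \<lambda>(a, k) (b, l). (a \<otimes> b, k + l + carry a b), one = (\<one>, 0)\<rparr>"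

lemma cover_simps [simp]:
  "(a, k) \<in> carrier cover \<longleftrightarrow> a \<in> carrier A" "\<one>\<^bsub>cover\<^esub> = (\<one>, 0)"
  "(a, k) \<otimes>\<^bsub>cover\<^esub> (b, l) = (a \<otimes> b, k + l + carry a b)"
  by (auto simp: cover_def)

lemma carry_one [simp]: "a \<in> carrier A \<Longrightarrow> carry \<one> a = 0" "a \<in> carrier A \<Longrightarrow> carry a \<one> = 0"
  by (auto simp: carry_def)

lemma comm_group_cover: "comm_group cover"
proof (rule comm_groupI)
  fix x y z
  assume "x \<in> carrier cover" "y \<in> carrier cover" "z \<in> carrier cover"
  then show "x \<otimes>\<^bsub>cover\<^esub> y \<otimes>\<^bsub>cover\<^esub> z = x \<otimes>\<^bsub>cover\<^esub> (y \<otimes>\<^bsub>cover\<^esub> z)"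
    using carry_cocycle by (cases x; cases y; cases z) (auto simp: m_assoc)
next
  fix x y
  assume "x \<in> carrier cover" "y \<in> carrier cover"
  then show "x \<otimes>\<^bsub>cover\<^esub> y = y \<otimes>\<^bsub>cover\<^esub> x"
    using carry_commute by (cases x; cases y) (auto simp: m_comm)
next
  fix x assume "x \<in> carrier cover"
  then obtain a k where x: "x = (a, k)" "a \<in> carrier A" by (cases x) auto
  show "\<exists>y\<in>carrier cover. y \<otimes>\<^bsub>cover\<^esub> x = \<one>\<^bsub>cover\<^esub>"
    using x by (intro bexI[of _ "(inv a, - k - carry (inv a) a)"]) auto
qed (auto simp: cover_def split: prod.splits)

end

section \<open>Pairs with a dense divisible subgroup\<close>

locale dense_pair = oriented_abelian_group M for M :: "'a pair_structure" (structure) +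
  assumes subgroup_pred: "subgroup (pred M) M"
    and regular: "regularly_dense M"
    and regular_pred: "regularly_dense (M\<lparr>carrier := pred M\<rparr>)"
    and root: "prime p \<Longrightarrow> a \<in> carrier M \<Longrightarrow> \<exists>b\<in>carrier M. b [^] (p::nat) = a"
    and root_pred: "prime p \<Longrightarrow> a \<in> pred M \<Longrightarrow> \<exists>b\<in>pred M. b [^] (p::nat) = a"
    and dense_pred: "ori_dense M (pred M)"
    and infinite_quotient: "infinite (carrier (M Mod pred M))"
begin

lemma pred_closed: "a \<in> pred M \<Longrightarrow> a \<in> carrier M"
  using subgroup.mem_carrier[OF subgroup_pred] .

lemma infinite_cosets: "finite F \<Longrightarrow> F \<subseteq> carrier M \<Longrightarrow> \<exists>x\<in>carrier M. \<forall>y\<in>F. x \<otimes> inv y \<notin> pred M"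
proof (rule ccontr)
  assume F: "finite F" "F \<subseteq> carrier M" and "\<not> (\<exists>x\<in>carrier M. \<forall>y\<in>F. x \<otimes> inv y \<notin> pred M)"
  then have c: "\<exists>y\<in>F. x \<otimes> inv y \<in> pred M" if "x \<in> carrier M" for x using that by blast
  have "carrier (M Mod pred M) \<subseteq> (\<lambda>y. pred M #> y) ` F"
  proof
    fix C assume "C \<in> carrier (M Mod pred M)"
    then obtain x where x: "x \<in> carrier M" "C = pred M #> x" by (auto simp: FactGroup_def RCOSETS_def)
    obtain y where y: "y \<in> F" "x \<otimes> inv y \<in> pred M" using c[OF x(1)] by blast
    have "x = (x \<otimes> inv y) \<otimes> y" using x(1) y(1) F(2) by (simp add: m_assoc subset_iff)
    then have "x \<in> pred M #> y" using y(2) unfolding r_coset_def by blast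
    then have "pred M #> y = pred M #> x"
      using repr_independence[OF _ _ subgroup_pred] y(1) F(2) by blast
    then show "C \<in> (\<lambda>y. pred M #> y) ` F" using x(2) y(1) by blast
  qed
  then show False using infinite_quotient F(1) finite_surj by blast
qed

lemma infinite_carrier: "infinite (carrier M)"
proof
  assume "finite (carrier M)"
  then obtain x where "x \<in> carrier M" "\<forall>y\<in>carrier M. x \<otimes> inv y \<notin> pred M"
    using infinite_cosets[of "carrier M"] by blast
  then have "x \<otimes> inv x \<notin> pred M" by blast
  then show False using \<open>x \<in> carrier M\<close> subgroup.one_closed[OF subgroup_pred] by simp
qed

text \<open>A dense set meets only nonempty open sets, so intervals must first be shown inhabited.
  If nothing lay between the neutral element and \<open>g\<close>, then either \<open>g\<close> has
  order two and translation by \<open>g\<close> leaves no other elements, against infinity; or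
  \<open>g\<close> precedes its double, regular density puts an element between them, and
  translating back by \<open>g\<close> gives one in the empty interval.\<close>

lemma between_one:
  assumes g: "g \<in> carrier M" "g \<noteq> \<one>"
  shows "\<exists>c\<in>carrier M. ori M \<one> c g"
proof (rule ccontr)
  assume no: "\<not> ?thesis"
  show False
  proof (cases "g \<otimes> g = \<one>")
    case True
    have "c \<in> {\<one>, g}" if c: "c \<in> carrier M" for c
    proof (rule ccontr)
      assume "c \<notin> {\<one>, g}"
      then have "ori M g c \<one>" using ori_total[of \<one> c g] no c g by auto
      then have "ori M (g \<otimes> g) (c \<otimes> g) (\<one> \<otimes> g)" using c g by (intro ori_translate) auto
      then show False using no True c g by auto
    qed
    then have "carrier M \<subseteq> {\<one>, g}" by blast
    then show False using infinite_carrier finite_subset by blast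
  next
    case False
    have "g \<otimes> g \<noteq> g" using g by simp
    then have "ori M \<one> g (g \<otimes> g) \<or> ori M (g \<otimes> g) g \<one>"
      using ori_total[of \<one> g "g \<otimes> g"] False g by auto
    moreover have "\<not> ori M (g \<otimes> g) g \<one>"
      using no g ori_rotate[of "g \<otimes> g" g \<one>] ori_rotate[of g \<one> "g \<otimes> g"] by auto
    ultimately have "ori M \<one> g (g \<otimes> g)" by blast
    then obtain c where c: "c \<in> carrier M" "ori M g (c [^] (2::nat)) (g \<otimes> g)"
      using regular g two_is_prime_nat unfolding regularly_dense_def by (meson m_closed)
    then have "ori M (g \<otimes> inv g) (c [^] (2::nat) \<otimes> inv g) (g \<otimes> g \<otimes> inv g)"
      using g by (intro ori_translate[where d = "inv g"]) auto
    then have "ori M \<one> (c [^] (2::nat) \<otimes> inv g) g" using g by (simp add: m_assoc)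
    then show False using no c(1) g by auto
  qed
qed

lemma pred_between:
  assumes x: "x \<in> carrier M" and g: "g \<in> carrier M" "g \<noteq> \<one>"
  shows "\<exists>r\<in>carrier M. r \<otimes> x \<in> pred M \<and> r \<noteq> \<one> \<and> lt r g"
proof -
  let ?I = "ori_interval M x (g \<otimes> x)"
  obtain c where c: "c \<in> carrier M" "ori M \<one> c g" using between_one[OF g] by blast
  have "ori M (\<one> \<otimes> x) (c \<otimes> x) (g \<otimes> x)" using c x g by (intro ori_translate) auto
  then have cI: "c \<otimes> x \<in> ?I" using c x by (simp add: ori_interval_def)
  have "openin (ori_topology M) ?I"
    unfolding ori_topology_def using x g by (intro topology_generated_by_Basis) blast
  moreover have "c \<otimes> x \<in> ori_topology M closure_of pred M"
    using dense_pred c x unfolding ori_dense_def by simp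
  ultimately obtain y where y: "y \<in> pred M" "y \<in> ?I"
    using cI unfolding in_closure_of by blast
  have yc: "y \<in> carrier M" using y(1) by (rule pred_closed)
  have "ori M x y (g \<otimes> x)" using y(2) by (simp add: ori_interval_def)
  then have "ori M (x \<otimes> inv x) (y \<otimes> inv x) (g \<otimes> x \<otimes> inv x)"
    using x g yc by (intro ori_translate[where d = "inv x"]) auto
  then have "ori M \<one> (y \<otimes> inv x) g" using x g by (simp add: m_assoc)
  then have "y \<otimes> inv x \<noteq> \<one> \<and> lt (y \<otimes> inv x) g" using ori_one x g yc by simp
  moreover have "y \<otimes> inv x \<otimes> x = y" using x yc by (simp add: m_assoc)
  ultimately show ?thesis using y(1) x yc by (intro bexI[of _ "y \<otimes> inv x"]) auto
qed

text \<open>Regular density of the subgroup in terms of the cut order. The chain condition now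
  reads: no addition of a further \<open>c\<close> produces a carry.\<close>

lemma pow_between:
  assumes p: "prime (p::nat)" and a: "a \<in> pred M" "b \<in> pred M" "a \<noteq> \<one>" "lt a b"
  shows "\<exists>c\<in>pred M. lt a (c [^] p) \<and> lt (c [^] p) b \<and>
     (\<forall>i\<in>{1..p - 1}. \<not> lt (c [^] (i + 1)) (c [^] i))"
proof -
  let ?G = "M\<lparr>carrier := pred M\<rparr>"
  have pow: "x [^]\<^bsub>?G\<^esub> (n::nat) = x [^] n" for x n by (simp add: nat_pow_def)
  have ac: "a \<in> carrier M" "b \<in> carrier M" using a pred_closed by auto
  have "ori M \<one> a b" using ori_one ac a by simp
  then have "ori ?G \<one>\<^bsub>?G\<^esub> a b" by simp
  then have "\<exists>c\<in>carrier ?G. ori ?G a (c [^]\<^bsub>?G\<^esub> p) b \<and>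
      (\<forall>i\<in>{1..p - 1}. less0 ?G (c [^]\<^bsub>?G\<^esub> i) (c [^]\<^bsub>?G\<^esub> (i + 1)))"
    using a(1,2) by (intro regular_pred[unfolded regularly_dense_def, rule_format, OF p]) auto
  moreover have "less0 ?G x y \<longleftrightarrow> less0 M x y" for x y by (simp add: less0_def)
  ultimately obtain c where c: "c \<in> pred M" "ori M a (c [^] p) b"
    "\<forall>i\<in>{1..p - 1}. less0 M (c [^] i) (c [^] (i + 1))"
    unfolding pow by (auto simp del: nat_pow_Suc)
  have cc: "c \<in> carrier M" using c(1) pred_closed by blast
  have "lt a (c [^] p) \<and> lt (c [^] p) b"
    using c(2) ori_iff_lt[of a "c [^] p" b] ac cc a(4) lt_asym[of a b] by auto
  moreover have "\<not> lt (c [^] (i + 1)) (c [^] i)" if "i \<in> {1..p - 1}" for i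
  proof -
    have "less0 M (c [^] i) (c [^] (i + 1))" using c(3) that by blast
    then have "lt (c [^] i) (c [^] (i + 1))" by (auto simp: less0_def lt_def)
    then show ?thesis using lt_asym cc nat_pow_closed by blast
  qed
  ultimately show ?thesis using c(1) by blast
qed

lemma root_nat:
  assumes S: "S \<subseteq> carrier M" "\<And>p a. prime p \<Longrightarrow> a \<in> S \<Longrightarrow> \<exists>b\<in>S. b [^] (p::nat) = a"
  shows "n > 0 \<Longrightarrow> a \<in> S \<Longrightarrow> \<exists>b\<in>S. b [^] (n::nat) = a"
proof (induction n arbitrary: a rule: less_induct)
  case (less n)
  show ?case
  proof (cases "n = 1")
    case True
    then show ?thesis using less.prems S(1) by (intro bexI[of _ a]) auto
  next
    case False
    then obtain p where p: "prime p" "p dvd n" using prime_factor_nat by blast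
    then obtain k where k: "n = p * k" by blast
    have k0: "k > 0" "k < n" using less.prems(1) k p(1) prime_gt_1_nat[OF p(1)] by auto
    obtain b where b: "b \<in> S" "b [^] p = a" using S(2)[OF p(1) less.prems(2)] by blast
    obtain c where c: "c \<in> S" "c [^] k = b" using less.IH[OF k0(2,1) b(1)] by blast
    have "c [^] n = a" using b c k nat_pow_pow[of c k p] S(1) by (auto simp: mult.commute)
    then show ?thesis using c(1) by blast
  qed
qed

end

text \<open>\<open>L\<close> is a homomorphism from the additive group of a ring to the cover. The
  order is pulled back along it, and its kernel becomes the set of null elements; this is why a
  preorder was allowed from the start.\<close>

locale cover_map = dense_pair M for M :: "'a pair_structure" (structure) +
  fixes L :: "'t::comm_ring_1 \<Rightarrow> 'a \<times> int" and lift :: "'a \<Rightarrow> 't"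
  assumes L_closed: "fst (L x) \<in> carrier M"
    and L_add: "L (x + y) = L x \<otimes>\<^bsub>cover\<^esub> L y"
    and L_one: "L 1 = (\<one>, 1)"
    and L_lift: "a \<in> carrier M \<Longrightarrow> L (lift a) = (a, 0)"
begin

definition proj :: "'t \<Rightarrow> 'a" where
  "proj x = fst (L x)"

definition level :: "'t \<Rightarrow> int" where
  "level x = snd (L x)"

definition pos :: "'t \<Rightarrow> bool" where
  "pos x \<longleftrightarrow> level x \<ge> 0 \<and> (level x \<noteq> 0 \<or> proj x \<noteq> \<one>)"

definition G :: "'t set" where
  "G = {x. proj x \<in> pred M}"

lemma proj_closed: "proj x \<in> carrier M"
  by (simp add: proj_def L_closed)

lemma proj_add: "proj (x + y) = proj x \<otimes> proj y"
  and level_add: "level (x + y) = level x + level y + carry (proj x) (proj y)"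
  using L_add[of x y] by (cases "L x"; cases "L y"; simp add: proj_def level_def)+

lemma proj_one: "proj 1 = \<one>" and level_one: "level 1 = 1"
  by (simp_all add: proj_def level_def L_one)

lemma proj_lift: "a \<in> carrier M \<Longrightarrow> proj (lift a) = a"
  and level_lift: "a \<in> carrier M \<Longrightarrow> level (lift a) = 0"
  by (simp_all add: proj_def level_def L_lift)

lemma proj_zero: "proj 0 = \<one>"
  using proj_add[of 0 0] proj_closed[of 0] by simp

lemma level_zero: "level 0 = 0"
  using level_add[of 0 0] proj_zero by simp

lemma proj_uminus: "proj (- x) = inv (proj x)"
proof -
  have "proj (- x) \<otimes> proj x = \<one>" using proj_add[of "- x" x] proj_zero by simp
  then show ?thesis using inv_equality proj_closed by simp
qed

lemma proj_diff: "proj (x - y) = proj x \<otimes> inv (proj y)"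
  using proj_add[of x "- y"] proj_uminus by simp

text \<open>A nontrivial fractional part \<open>r\<close> borrows a turn:
  \<open>-(k + r) = (-k - 1) + (1 - r)\<close>.\<close>

lemma level_uminus: "level (- x) = (if proj x = \<one> then - level x else - level x - 1)"
proof -
  have "0 = level x + level (- x) + carry (proj x) (inv (proj x))"
    using level_add[of x "- x"] level_zero proj_uminus by simp
  moreover have "carry (proj x) (inv (proj x)) = (if proj x = \<one> then 0 else 1)"
    using proj_closed[of x] by (simp add: carry_def)
  ultimately show ?thesis by (auto split: if_splits)
qed

lemma pos_uminus: "pos (- x) \<longleftrightarrow> level x < 0"
  using proj_closed[of x] by (auto simp: pos_def level_uminus proj_uminus)

lemma proj_of_nat: "proj (of_nat n) = \<one>" and level_of_nat: "level (of_nat n) = int n"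
  by (induction n) (simp_all add: proj_zero level_zero proj_add level_add proj_one level_one)

lemma proj_of_int: "proj (of_int k) = \<one>"
proof (cases k rule: int_cases2)
  case (nonneg n)
  then show ?thesis by (simp add: proj_of_nat)
next
  case (nonpos n)
  then show ?thesis by (simp add: proj_uminus proj_of_nat)
qed

lemma level_of_int: "level (of_int k) = k"
proof (cases k rule: int_cases2)
  case (nonneg n)
  then show ?thesis by (simp add: level_of_nat)
next
  case (nonpos n)
  then show ?thesis by (simp add: level_uminus proj_of_nat level_of_nat)
qed

lemma proj_add_int: "proj (x + of_int k) = proj x" and level_add_int: "level (x + of_int k) = level x + k"
  using proj_closed[of x] by (simp_all add: proj_add level_add proj_of_int level_of_int)

lemma proj_diff_int: "proj (x - of_int k) = proj x" and level_diff_int: "level (x - of_int k) = level x - k"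
  using proj_add_int[of x "- k"] level_add_int[of x "- k"] by simp_all

lemma carry_range: "0 \<le> carry a b" "carry a b \<le> 1"
  by (auto simp: carry_def)

sublocale positive_cone pos
proof
  fix x y
  show "pos (x + y)" if "pos x" "pos y"
  proof (cases "level (x + y) = 0 \<and> proj (x + y) = \<one>")
    case True
    have "level x \<ge> 0" "level y \<ge> 0" using that by (auto simp: pos_def)
    then have z: "level x = 0" "level y = 0" "carry (proj x) (proj y) = 0"
      using True carry_range(1)[of "proj x" "proj y"] by (auto simp: level_add)
    then have "proj x \<noteq> \<one>" using that by (simp add: pos_def)
    then have "carry (proj x) (proj y) = 1" using True by (simp add: proj_add carry_def)
    then show ?thesis using z by simp
  next
    case False
    then show ?thesis using that carry_range(1)[of "proj x" "proj y"] by (auto simp: pos_def level_add)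
  qed
  show "\<not> pos (x + y)" if "\<not> pos x" "\<not> pos y"
  proof -
    have c: "level z < 0 \<or> level z = 0 \<and> proj z = \<one>" if "\<not> pos z" for z
      using that by (auto simp: pos_def)
    have "carry (proj x) (proj y) = 0" if "proj x = \<one> \<or> proj y = \<one>"
      using that proj_closed by auto
    then show ?thesis
      using c[OF that(1)] c[OF that(2)] carry_range(2)[of "proj x" "proj y"] proj_closed[of x] proj_closed[of y]
      by (auto simp: pos_def level_add proj_add)
  qed
  show "\<not> pos (- x)" if "pos x" using that by (auto simp: pos_uminus) (simp add: pos_def)
  show "pos 1" by (simp add: pos_def level_one)
  show "\<exists>k::int. \<not> pos (of_int k - x) \<and> pos (of_int (k + 1) - x)"
  proof (intro exI conjI)
    show "\<not> pos (of_int (level x) - x)"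
      using pos_uminus[of "x - of_int (level x)"] by (simp add: level_diff_int)
    show "pos (of_int (level x + 1) - x)"
      using pos_uminus[of "x - of_int (level x + 1)"] by (simp add: level_diff_int del: of_int_add)
  qed
qed

lemma null_iff: "null x \<longleftrightarrow> level x = 0 \<and> proj x = \<one>"
  by (auto simp: null_def pos_uminus) (auto simp: pos_def)

lemma unit_rep_iff: "unit_rep x \<longleftrightarrow> level x = 0"
  using pos_uminus[of "x - of_int 1"] level_diff_int[of x 1] by (auto simp: unit_rep_def pos_uminus)

lemma proj_eq: "proj x = proj y \<longleftrightarrow> (\<exists>k::int. null (x - y - of_int k))"
proof -
  have "proj x = proj y \<longleftrightarrow> proj (x - y) = \<one>"
  proof
    assume "proj (x - y) = \<one>"
    then have "proj x = \<one> \<otimes> proj y" using proj_add[of "x - y" y] by simp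
    then show "proj x = proj y" using proj_closed by simp
  qed (simp add: proj_diff proj_closed)
  also have "\<dots> \<longleftrightarrow> (\<exists>k. level (x - y) = k \<and> proj (x - y) = \<one>)" by blast
  also have "\<dots> \<longleftrightarrow> (\<exists>k::int. null (x - y - of_int k))"
    unfolding null_iff proj_diff_int level_diff_int by simp
  finally show ?thesis .
qed

text \<open>For elements of level 0, the level of \<open>y - x\<close> is minus the carry of
  \<open>proj x\<close> and \<open>proj (y - x)\<close>, and this carry says that
  \<open>proj y\<close> lies below \<open>proj x\<close>.\<close>

lemma unit_rep_less:
  assumes "unit_rep x" "unit_rep y"
  shows "pos (y - x) \<longleftrightarrow> lt (proj x) (proj y)"
proof -
  have l: "level x = 0" "level y = 0" using assms by (simp_all add: unit_rep_iff)
  have py: "proj y = proj x \<otimes> proj (y - x)" and "level y = level x + level (y - x) + carry (proj x) (proj (y - x))"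
    using proj_add[of x "y - x"] level_add[of x "y - x"] by simp_all
  then have lv: "level (y - x) = - carry (proj x) (proj (y - x))" using l by simp
  have c: "carry (proj x) (proj (y - x)) = (if lt (proj y) (proj x) then 1 else 0)"
    by (simp add: carry_def py[symmetric])
  have "proj (y - x) = \<one> \<longleftrightarrow> proj x = proj y"
    using py proj_closed by auto
  then have "pos (y - x) \<longleftrightarrow> \<not> lt (proj y) (proj x) \<and> proj x \<noteq> proj y"
    unfolding pos_def lv c by auto
  then show ?thesis
    using lt_total[OF proj_closed[of x] proj_closed[of y]] lt_asym[OF proj_closed[of x] proj_closed[of y]] by auto
qed

lemma proj_of_nat_mult: "proj (of_nat n * x) = proj x [^] n"
  by (induction n) (simp_all add: proj_zero proj_add distrib_right m_comm proj_closed)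

section \<open>Divisibility and density of the subgroup in the cover\<close>

lemma G_int: "of_int k \<in> G"
  using subgroup.one_closed[OF subgroup_pred] by (simp add: G_def proj_of_int)

lemma G_add: "x \<in> G \<Longrightarrow> y \<in> G \<Longrightarrow> x + y \<in> G"
  using subgroup.m_closed[OF subgroup_pred] by (simp add: G_def proj_add)

lemma G_uminus: "x \<in> G \<Longrightarrow> - x \<in> G"
  using subgroup.m_inv_closed[OF subgroup_pred] by (simp add: G_def proj_uminus)

lemma G_of_nat_mult: "x \<in> G \<Longrightarrow> of_nat n * x \<in> G"
  by (induction n) (auto simp: distrib_right intro: G_add G_int[of 0, simplified])

lemma divisible_nat:
  assumes W: "W \<in> {UNIV, G}" "x \<in> W" and n: "n > (0::nat)"
  shows "\<exists>y\<in>W. \<exists>k::int. null (x - of_nat n * y - of_int k)"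
proof -
  have ex: "\<exists>y\<in>W. proj x = proj (of_nat n * y)" if S: "S \<subseteq> carrier M" "proj x \<in> S"
    "\<And>p a. prime p \<Longrightarrow> a \<in> S \<Longrightarrow> \<exists>b\<in>S. b [^] (p::nat) = a" "\<And>a. a \<in> S \<Longrightarrow> lift a \<in> W" for S
  proof -
    obtain b where b: "b \<in> S" "b [^] n = proj x" using root_nat[OF S(1,3) n S(2)] by blast
    then have "proj (of_nat n * lift b) = proj x" using S(1) by (auto simp: proj_of_nat_mult proj_lift)
    then show ?thesis using S(4)[OF b(1)] by (intro bexI[of _ "lift b"]) auto
  qed
  have "\<exists>y\<in>W. proj x = proj (of_nat n * y)"
  proof (cases "W = UNIV")
    case True
    then show ?thesis using root proj_closed by (intro ex[of "carrier M"]) auto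
  next
    case False
    then have "W = G" using W by simp
    then show ?thesis using root_pred W(2) pred_closed
      by (intro ex[of "pred M"]) (auto simp: G_def proj_lift)
  qed
  then show ?thesis unfolding proj_eq .
qed

text \<open>For an interval shorter than one turn, density of the subgroup in \<open>M\<close>
  applies after translation to the left endpoint. Any other interval is first shortened to the
  length of some nontrivial representative.\<close>

lemma G_dense:
  assumes "pos (y - x)"
  shows "\<exists>g\<in>G. pos (g - x) \<and> pos (y - g)"
proof -
  have "\<exists>g\<in>G. pos (g - x) \<and> pos (s + x - g)" if s: "unit_rep s" "pos s" for s
  proof -
    have g: "proj s \<noteq> \<one>" using s by (simp add: pos_def unit_rep_iff)
    obtain r where r: "r \<in> carrier M" "r \<otimes> proj x \<in> pred M" "r \<noteq> \<one>" "lt r (proj s)"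
      using pred_between[OF proj_closed[of x] proj_closed[of s] g] by blast
    have u: "unit_rep (lift r)" using r(1) by (simp add: unit_rep_iff level_lift)
    have "lift r + x \<in> G" using r by (simp add: G_def proj_add proj_lift)
    moreover have "pos (lift r)" using r by (simp add: pos_def level_lift proj_lift)
    moreover have "pos (s - lift r)" using unit_rep_less[OF u s(1)] r by (simp add: proj_lift)
    ultimately show ?thesis by (intro bexI[of _ "lift r + x"]) auto
  qed note short = this
  show ?thesis
  proof (cases "pos (1 - (y - x))")
    case True
    then have "unit_rep (y - x)" using lt_imp_leq[OF assms] by (simp add: unit_rep_def)
    then show ?thesis using short[of "y - x"] assms by simp
  next
    case False
    obtain a where a: "a \<in> carrier M" "a \<noteq> \<one>"
      using infinite_carrier by (metis finite.emptyI finite_insert finite_subset insertI1 subsetI)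
    have u: "unit_rep (lift a)" "pos (lift a)"
      using a by (simp_all add: unit_rep_iff pos_def level_lift proj_lift)
    have "pos (1 - lift a)" using u(1) by (simp add: unit_rep_def)
    then have "pos (1 - lift a + (y - x - 1))" using False by (intro pos_add_nonneg) auto
    then have l: "pos (y - (lift a + x))" by (simp add: algebra_simps)
    obtain g where "g \<in> G" "pos (g - x)" "pos (lift a + x - g)" using short[OF u] by blast
    then show ?thesis using l lt_trans by blast
  qed
qed

lemma prime_multiple_unit:
  assumes p: "prime (p::nat)" and xy: "unit_rep x" "unit_rep y" "x \<in> G" "y \<in> G" "pos x" "pos (y - x)"
  shows "\<exists>c\<in>G. pos c \<and> pos (of_nat p * c - x) \<and> pos (y - of_nat p * c)"
proof -
  have "proj x \<noteq> \<one>" using xy by (simp add: pos_def unit_rep_iff)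
  then obtain c where c: "c \<in> pred M" "lt (proj x) (c [^] p)" "lt (c [^] p) (proj y)"
     "\<forall>i\<in>{1..p - 1}. \<not> lt (c [^] (i + 1)) (c [^] i)"
    using pow_between[OF p, of "proj x" "proj y"] xy unit_rep_less[OF xy(1,2)] by (auto simp: G_def)
  have cc: "c \<in> carrier M" using c(1) by (rule pred_closed)
  \<comment> \<open>The chain condition of regular density says that no multiple of \<open>c\<close> up to \<open>p\<close> passes the origin.\<close>
  have lev: "1 \<le> i \<Longrightarrow> i \<le> p \<Longrightarrow> level (of_nat i * lift c) = 0" for i
  proof (induction i rule: dec_induct)
    case base
    then show ?case using cc by (simp add: level_lift)
  next
    case (step i)
    have "of_nat (Suc i) * lift c = of_nat i * lift c + lift c" by (simp add: distrib_right add.commute)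
    then have "level (of_nat (Suc i) * lift c) = carry (c [^] i) c"
      using step cc by (simp add: level_add proj_of_nat_mult proj_lift level_lift)
    also have "\<dots> = 0" using c(4) step by (simp add: carry_def)
    finally show ?case .
  qed
  have p1: "p \<ge> 1" using prime_gt_0_nat[OF p] by simp
  have u: "unit_rep (of_nat p * lift c)" using lev[OF p1] by (simp add: unit_rep_iff)
  have pc: "proj (of_nat p * lift c) = c [^] p" using cc by (simp add: proj_of_nat_mult proj_lift)
  have 1: "pos (of_nat p * lift c - x)" "pos (y - of_nat p * lift c)"
    using unit_rep_less[OF xy(1) u] unit_rep_less[OF u xy(2)] c(2,3) by (simp_all add: pc)
  have "pos (of_int (int p) * lift c)" using pos_add[OF 1(1) xy(5)] by simp
  then have "pos (lift c)" using pos_scale[of "int p" "lift c"] p1 by simp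
  then show ?thesis using 1 c(1) cc by (intro bexI[of _ "lift c"]) (auto simp: G_def proj_lift)
qed

text \<open>Regular density gives multiples of \<open>p\<close> in the first turn only, and
  \<open>1\<close> need not be one. Instead \<open>1\<close> is approximated from below:
  \<open>a = 1 - p b\<close> is positive and less than \<open>c\<close>, where \<open>p c\<close> is
  below the available length \<open>d\<close>. If \<open>g1\<close> is in the interval,
  \<open>g1 = p h + j\<close> and \<open>j = p l - j0\<close>, then \<open>p (h + l - j0 b)\<close>
  equals \<open>g1 + j0 a\<close> up to null elements, and \<open>j0 a < p c < d\<close>.\<close>

lemma prime_dense:
  assumes p: "prime (p::nat)" and "pos (y - x)"
  shows "\<exists>g\<in>G. pos (of_nat p * g - x) \<and> pos (y - of_nat p * g)"
proof -
  have p0: "p > 0" using prime_gt_0_nat[OF p] .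
  obtain g1 where g1: "g1 \<in> G" "pos (g1 - x)" "pos (y - g1)" using G_dense[OF assms(2)] by blast
  define d where "d = y - g1"
  have d: "pos d" using g1 by (simp add: d_def)
  obtain h j where h: "h \<in> G" "null (g1 - of_nat p * h - of_int j)"
    using divisible_nat[of G g1 p] g1(1) p0 by auto
  \<comment> \<open>Capped at \<open>1\<close>, so that all positive elements below \<open>e\<close>
    are in the first turn.\<close>
  define e where "e = (if pos (1 - d) then d else 1)"
  have e: "pos e" "\<not> pos (e - d)" "\<not> pos (e - 1)"
    using d pos_one lt_imp_leq[of d 1] by (auto simp: e_def)
  have unit_below: "unit_rep z" if "pos z" "pos (e - z)" for z
    using that e(3) lt_leq_trans[of e z 1] pos_asym by (auto simp: unit_rep_def)
  obtain e2 where e2: "e2 \<in> G" "pos e2" "pos (e - e2)" using G_dense[of e 0] e(1) by auto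
  obtain e1 where e1: "e1 \<in> G" "pos e1" "pos (e2 - e1)" using G_dense[of e2 0] e2(2) by auto
  have "pos (e - e1)" using e1(3) e2(3) lt_trans by blast
  then obtain c where c: "c \<in> G" "pos c" "pos (e2 - of_nat p * c)"
    using prime_multiple_unit[OF p unit_below unit_below e1(1) e2(1) e1(2,3)] e1(2) e2(2,3) by auto
  have pcd: "pos (d - of_nat p * c)"
    using c(3) e2(3) e(2) lt_trans lt_leq_trans by blast
  have pc1: "pos (1 - of_nat p * c)"
    using c(3) e2(3) e(3) lt_trans lt_leq_trans by blast
  have "\<not> pos (c - of_nat p * c)"
  proof -
    obtain m where m: "p = Suc m" using p0 by (cases p) auto
    have "\<not> pos (of_nat m * (- c))"
      using nonpos_of_nat_mult[of "- c"] pos_asym[OF c(2)] by (cases m) auto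
    then show ?thesis unfolding m by (simp add: algebra_simps)
  qed
  then have c1: "pos (1 - c)" using pc1 leq_lt_trans by blast
  have one_minus: "unit_rep f" if "pos (f - (1 - c))" "pos (1 - f)" for f
    using pos_add[OF that(1) c1] that(2) pos_asym by (simp add: unit_rep_def)
  \<comment> \<open>Two elements of \<open>G\<close> between \<open>1 - c\<close> and
    \<open>1\<close> enclose the wanted multiple of \<open>p\<close> just below
    \<open>1\<close>.\<close>
  obtain f1 where f1: "f1 \<in> G" "pos (f1 - (1 - c))" "pos (1 - f1)" using G_dense[of 1 "1 - c"] c(2) by auto
  obtain f2 where f2: "f2 \<in> G" "pos (f2 - f1)" "pos (1 - f2)" using G_dense[OF f1(3)] by auto
  have f12: "unit_rep f1" "unit_rep f2" "pos f1"
    using one_minus[OF f1(2,3)] one_minus[of f2] lt_trans[OF f1(2) f2(2)] f2(3) pos_add[OF f1(2) c1] by auto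
  obtain b where b: "b \<in> G" "pos (of_nat p * b - f1)" "pos (f2 - of_nat p * b)"
    using prime_multiple_unit[OF p f12(1,2) f1(1) f2(1) f12(3) f2(2)] by blast
  define a where "a = 1 - of_nat p * b"
  have a: "pos a" "pos (c - a)"
  proof -
    show "pos a" unfolding a_def using b(3) f2(3) lt_trans by blast
    have "pos (of_nat p * b - (1 - c))" using b(2) f1(2) lt_trans by blast
    then show "pos (c - a)" by (simp add: a_def algebra_simps)
  qed
  \<comment> \<open>Ranges from \<open>1\<close> to \<open>p\<close>, so that the overshoot
    \<open>j0 a\<close> is positive for every residue of \<open>j\<close>.\<close>
  define j0 where "j0 = nat (int p - j mod int p)"
  have mod: "0 \<le> j mod int p" "j mod int p < int p" using p0 by auto
  then have j0: "0 < j0" "j0 \<le> p" "int j0 = int p - j mod int p" by (auto simp: j0_def)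
  define l where "l = j div int p + 1"
  have jl: "j = int p * l - int j0" unfolding l_def j0(3) by (simp add: algebra_simps)
  define g where "g = h + (of_int l - of_nat j0 * b)"
  have gG: "g \<in> G"
    unfolding g_def using h(1) b(1) G_int G_add G_uminus G_of_nat_mult
    by (metis add_uminus_conv_diff)
  have "(of_int j :: 't) = of_nat p * of_int l - of_nat j0"
    unfolding jl by simp
  then have eq: "of_nat p * g - g1 = of_nat j0 * a - (g1 - of_nat p * h - of_int j)"
    by (simp add: g_def a_def algebra_simps)
  obtain m where m: "j0 = Suc m" using j0(1) by (cases j0) auto
  have ja: "pos (of_nat j0 * a)" unfolding m by (rule pos_of_nat_mult[OF a(1)])
  have jca: "pos (of_nat j0 * (c - a))" unfolding m by (rule pos_of_nat_mult[OF a(2)])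
  have "\<not> pos (of_nat (p - j0) * (- c))"
    using nonpos_of_nat_mult[of "- c" "p - j0 - 1"] pos_asym[OF c(2)] by (cases "p - j0") auto
  then have "pos (of_nat j0 * (c - a) + of_nat (p - j0) * c)"
    using jca by (intro pos_add_nonneg) auto
  moreover have "of_nat p = of_nat j0 + (of_nat (p - j0) :: 't)"
    using j0(2) by (metis le_add_diff_inverse of_nat_add)
  ultimately have "pos (of_nat p * c - of_nat j0 * a)" by (simp add: algebra_simps)
  then have jd: "pos (d - of_nat j0 * a)" using pcd lt_trans by blast
  have "(of_nat p * g - g1) - of_nat j0 * a = - (g1 - of_nat p * h - of_int j)" unfolding eq by simp
  then have n: "null ((of_nat p * g - g1) - of_nat j0 * a)" using h(2) by (simp only: null_minus)
  have "pos (of_nat p * g - g1)" using pos_cong[OF n] ja by simp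
  then have 1: "pos (of_nat p * g - x)" using g1(2) lt_trans by blast
  have "null ((y - of_nat p * g) - (d - of_nat j0 * a))"
  proof -
    have "(y - of_nat p * g) - (d - of_nat j0 * a) = - ((of_nat p * g - g1) - of_nat j0 * a)"
      by (simp add: d_def)
    then show ?thesis using n by (simp only: null_minus)
  qed
  then have "pos (y - of_nat p * g)" using jd pos_cong by blast
  then show ?thesis using gG 1 by blast
qed

text \<open>For \<open>n = p k\<close>, two multiples \<open>k g1 < k g2\<close> are found in the
  interval, and then a multiple of \<open>p\<close> between \<open>g1\<close> and \<open>g2\<close>,
  which multiplication by \<open>k\<close> sends back into the interval.\<close>

lemma nat_dense: "n > (0::nat) \<Longrightarrow> pos (y - x) \<Longrightarrow> \<exists>g\<in>G. pos (of_nat n * g - x) \<and> pos (y - of_nat n * g)"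
proof (induction n arbitrary: x y rule: less_induct)
  case (less n)
  show ?case
  proof (cases "n = 1")
    case True
    then show ?thesis using G_dense[OF less.prems(2)] by simp
  next
    case False
    then obtain p where p: "prime p" "p dvd n" using prime_factor_nat by blast
    then obtain k where k: "n = p * k" by blast
    have k0: "k > 0" "k < n" using less.prems(1) k p(1) prime_gt_1_nat[OF p(1)] by auto
    obtain g1 where g1: "pos (of_nat k * g1 - x)" "pos (y - of_nat k * g1)"
      using less.IH[OF k0(2,1) less.prems(2)] by blast
    obtain g2 where g2: "pos (of_nat k * g2 - of_nat k * g1)" "pos (y - of_nat k * g2)"
      using less.IH[OF k0(2,1) g1(2)] by blast
    have sc: "pos (of_nat k * z) \<longleftrightarrow> pos z" for z using pos_scale[of "int k" z] k0 by simp
    have "pos (of_nat k * (g2 - g1))" using g2(1) by (simp add: algebra_simps)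
    then have "pos (g2 - g1)" by (simp only: sc)
    then obtain g where g: "g \<in> G" "pos (of_nat p * g - g1)" "pos (g2 - of_nat p * g)"
      using prime_dense[OF p(1)] by blast
    have n: "of_nat n * g = of_nat k * (of_nat p * g)" unfolding k by (simp add: algebra_simps)
    have "pos (of_nat k * (of_nat p * g - g1))" "pos (of_nat k * (g2 - of_nat p * g))"
      using g(2,3) by (simp_all only: sc)
    then have "pos (of_nat n * g - of_nat k * g1)" "pos (of_nat k * g2 - of_nat n * g)"
      unfolding n by (simp_all add: right_diff_distrib)
    then show ?thesis using g(1) g1(1) g2(2) lt_trans by blast
  qed
qed

sublocale cover_model pos G M proj lift
proof
  fix x y z :: 't and n :: int
  show "x + y \<in> G" if "x \<in> G" "y \<in> G" using that by (rule G_add)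
  show "- x \<in> G" if "x \<in> G" using that by (rule G_uminus)
  show "1 \<in> G" using G_int[of 1] by simp
  show "x \<in> G" if "null x"
    using that subgroup.one_closed[OF subgroup_pred] by (simp add: null_iff G_def)
  show "\<exists>y\<in>W. \<exists>k::int. null (x - of_int n * y - of_int k)"
    if "W \<in> {UNIV, G}" "x \<in> W" "n > 0" for W
    using divisible_nat[OF that(1,2), of "nat n"] that(3) by simp
  show "\<exists>g\<in>G. pos (of_int n * g - x) \<and> pos (y - of_int n * g)" if "pos (y - x)" "n > 0"
    using nat_dense[of "nat n", OF _ that(1)] that(2) by simp
  show "\<exists>x. \<forall>y\<in>F. x - y \<notin> G" if "finite F" for F :: "'t set"
  proof -
    have "finite (proj ` F)" "proj ` F \<subseteq> carrier M" using that proj_closed by auto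
    from infinite_cosets[OF this] obtain a where
      a: "a \<in> carrier M" "\<forall>b\<in>proj ` F. a \<otimes> inv b \<notin> pred M" by blast
    then have "\<forall>y\<in>F. lift a - y \<notin> G" by (simp add: G_def proj_diff proj_lift)
    then show ?thesis by blast
  qed
  show "proj x \<in> carrier M" by (rule proj_closed)
  show "proj (x + y) = proj x \<otimes> proj y" by (rule proj_add)
  show "proj 0 = \<one>" by (rule proj_zero)
  show "proj (- x) = inv (proj x)" by (rule proj_uminus)
  show "proj x = proj y \<longleftrightarrow> (\<exists>k::int. null (x - y - of_int k))" by (rule proj_eq)
  show "proj (lift a) = a" if "a \<in> carrier M" for a using that by (rule proj_lift)
  show "unit_rep (lift a)" if "a \<in> carrier M" for a using that by (simp add: unit_rep_iff level_lift)
  show "ori M (proj x) (proj y) (proj z) \<longleftrightarrow>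
         pos (y - x) \<and> pos (z - y) \<or> pos (z - y) \<and> pos (x - z) \<or> pos (x - z) \<and> pos (y - x)"
    if "unit_rep x" "unit_rep y" "unit_rep z"
    using that by (simp add: unit_rep_less ori_iff_lt[OF proj_closed proj_closed proj_closed])
  show "proj x \<in> pred M \<longleftrightarrow> x \<in> G" by (simp add: G_def)
qed

end

text \<open>
  The covering group is presented by generators: the ring structure on the finitely supported
  integer-valued functions on monomials only serves to have integer multiples and \<open>algebra_simps\<close>
  at hand. The monomial of degree \<open>0\<close> stands for a full turn, the variable \<open>a\<close> for the element
  \<open>a\<close> in the first turn; all other monomials are mapped to zero.
\<close>

context oriented_abelian_group
begin

definition gen :: "('a \<Rightarrow>\<^sub>0 nat) \<Rightarrow> 'a \<times> int" where
  "gen k = (if k = 0 then (\<one>, 1)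
     else if \<exists>a\<in>carrier A. k = Poly_Mapping.single a 1
     then (THE a. k = Poly_Mapping.single a 1, 0) else (\<one>, 0))"

lemma single_nat_inj: "Poly_Mapping.single a (1::nat) = Poly_Mapping.single b 1 \<longleftrightarrow> a = b"
  by (metis keys_single singleton_inject zero_neq_one)

lemma gen_single: "a \<in> carrier A \<Longrightarrow> gen (Poly_Mapping.single a 1) = (a, 0)"
proof -
  assume a: "a \<in> carrier A"
  have "Poly_Mapping.single a (1::nat) \<noteq> 0"
    by (metis keys_single keys_zero insert_not_empty zero_neq_one)
  moreover have "(THE b. Poly_Mapping.single a (1::nat) = Poly_Mapping.single b 1) = a"
    unfolding single_nat_inj by (rule the_equality) auto
  ultimately show ?thesis using a unfolding gen_def by auto
qed

lemma gen_closed: "gen k \<in> carrier cover"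
proof -
  have "gen k \<in> carrier cover" if "\<exists>a\<in>carrier A. k = Poly_Mapping.single a 1"
    using that gen_single by (metis cover_simps(1))
  then show ?thesis unfolding gen_def by (cases "\<exists>a\<in>carrier A. k = Poly_Mapping.single a 1") auto
qed

text \<open>The homomorphism that extends \<open>gen\<close> to the free abelian group on the
  monomials.\<close>

definition evaluate :: "(('a \<Rightarrow>\<^sub>0 nat) \<Rightarrow>\<^sub>0 int) \<Rightarrow> 'a \<times> int" where
  "evaluate f = finprod cover (\<lambda>k. gen k [^]\<^bsub>cover\<^esub> Poly_Mapping.lookup f k) (Poly_Mapping.keys f)"

lemma pow_gen_closed: "gen k [^]\<^bsub>cover\<^esub> (i::int) \<in> carrier cover"
  by (rule group.int_pow_closed[OF comm_group.axioms(2)[OF comm_group_cover] gen_closed])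

lemma evaluate_superset:
  assumes "finite S" "Poly_Mapping.keys f \<subseteq> S"
  shows "evaluate f = finprod cover (\<lambda>k. gen k [^]\<^bsub>cover\<^esub> Poly_Mapping.lookup f k) S"
proof -
  interpret C: comm_group cover by (rule comm_group_cover)
  show ?thesis
    unfolding evaluate_def using assms pow_gen_closed
    by (intro C.finprod_mono_neutral_cong_left) (auto simp: in_keys_iff simp del: cover_simps)
qed

lemma evaluate_closed: "evaluate f \<in> carrier cover"
proof -
  interpret C: comm_group cover by (rule comm_group_cover)
  show ?thesis unfolding evaluate_def using pow_gen_closed by (intro C.finprod_closed) blast
qed

lemma evaluate_add: "evaluate (f + g) = evaluate f \<otimes>\<^bsub>cover\<^esub> evaluate g"
proof -
  interpret C: comm_group cover by (rule comm_group_cover)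
  let ?S = "Poly_Mapping.keys f \<union> Poly_Mapping.keys g"
  have "finite ?S" by simp
  moreover have "Poly_Mapping.keys (f + g) \<subseteq> ?S" by (rule Poly_Mapping.keys_add)
  ultimately have "evaluate (f + g) =
      finprod cover (\<lambda>k. gen k [^]\<^bsub>cover\<^esub> Poly_Mapping.lookup (f + g) k) ?S"
    by (rule evaluate_superset)
  also have "\<dots> = finprod cover (\<lambda>k. gen k [^]\<^bsub>cover\<^esub> Poly_Mapping.lookup f k \<otimes>\<^bsub>cover\<^esub>
      gen k [^]\<^bsub>cover\<^esub> Poly_Mapping.lookup g k) ?S"
    by (simp only: lookup_add C.int_pow_mult[OF gen_closed])
  also have "\<dots> = finprod cover (\<lambda>k. gen k [^]\<^bsub>cover\<^esub> Poly_Mapping.lookup f k) ?S \<otimes>\<^bsub>cover\<^esub>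
      finprod cover (\<lambda>k. gen k [^]\<^bsub>cover\<^esub> Poly_Mapping.lookup g k) ?S"
    using pow_gen_closed by (intro C.finprod_multf) blast+
  also have "\<dots> = evaluate f \<otimes>\<^bsub>cover\<^esub> evaluate g"
    using evaluate_superset[of ?S f] evaluate_superset[of ?S g] by simp
  finally show ?thesis .
qed

lemma evaluate_single: "evaluate (Poly_Mapping.single k 1) = gen k"
proof -
  interpret C: comm_group cover by (rule comm_group_cover)
  have "evaluate (Poly_Mapping.single k 1) = finprod cover (\<lambda>k'. gen k' [^]\<^bsub>cover\<^esub>
      Poly_Mapping.lookup (Poly_Mapping.single k (1::int)) k') {k}"
    by (rule evaluate_superset) auto
  also have "\<dots> = gen k [^]\<^bsub>cover\<^esub> (1::int)"
    using pow_gen_closed by (subst C.finprod_insert) (auto simp del: cover_simps)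
  also have "\<dots> = gen k" by (rule C.int_pow_1[OF gen_closed])
  finally show ?thesis .
qed

end

text \<open>If there is only one coset, the coset of \<open>a\<close> is the set of
  \<open>p\<close>-th powers itself, and it contains \<open>a\<close>.\<close>

lemma index_one_root:
  fixes A :: "('a, 'b) monoid_scheme" and p :: nat
  assumes "group A" "index A p = 1" "a \<in> carrier A"
  shows "\<exists>b\<in>carrier A. b [^]\<^bsub>A\<^esub> p = a"
proof -
  interpret group A by fact
  define N where "N = (\<lambda>x. x [^]\<^bsub>A\<^esub> p) ` carrier A"
  have "card (carrier (A Mod N)) = 1"
    using assms(2) unfolding index_def N_def[symmetric] Let_def
    by (auto simp: one_enat_def split: if_splits)
  then obtain C where C: "carrier (A Mod N) = {C}" by (rule card_1_singletonE)
  have coset: "N #>\<^bsub>A\<^esub> x = C" if "x \<in> carrier A" for x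
    using that C unfolding FactGroup_def RCOSETS_def by auto
  have "\<one>\<^bsub>A\<^esub> \<in> N" unfolding N_def by (auto intro!: image_eqI[of _ _ "\<one>\<^bsub>A\<^esub>"])
  then have "\<one>\<^bsub>A\<^esub> \<otimes>\<^bsub>A\<^esub> a \<in> N #>\<^bsub>A\<^esub> a" unfolding r_coset_def by blast
  then have "a \<in> N #>\<^bsub>A\<^esub> \<one>\<^bsub>A\<^esub>" using coset[OF assms(3)] coset[OF one_closed] assms(3) by simp
  then show ?thesis unfolding r_coset_def N_def by auto
qed

section \<open>From the axioms of the theories to the conclusion\<close>

lemma pair_theory_dense_pair:
  assumes "M \<in> pair_theory (\<lambda>_. 0, e1) (\<lambda>_. 0, e2)"
  shows "dense_pair M"
proof -
  let ?G = "M\<lparr>carrier := pred M\<rparr>"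
  have h: "models_T (\<lambda>_. 0) e1 M" "subgroup (pred M) M" "ori_dense M (pred M)"
    "models_T (\<lambda>_. 0) e2 ?G" "infinite (carrier (M Mod pred M))"
    using assms by (auto simp: pair_theory_def)
  have A: "oriented_abelian_group M" "oriented_abelian_group ?G"
    using h by (auto simp: models_T_def)
  have g: "group M" "group ?G"
    using A by (auto simp: oriented_abelian_group_def comm_group_def)
  \<comment> \<open>The value \<open>0\<close> in the sequence of indices means index
    \<open>p ^ 0 = 1\<close>, that is, divisibility by \<open>p\<close>.\<close>
  have "enat_power p 0 = 1" for p by (simp add: zero_enat_def one_enat_def)
  then have i: "index M p = 1" "index ?G p = 1" if "prime p" for p
    using h that by (auto simp: models_T_def)
  have pow: "x [^]\<^bsub>?G\<^esub> (n::nat) = x [^]\<^bsub>M\<^esub> n" for x n by (simp add: nat_pow_def)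
  show ?thesis
  proof (rule dense_pair.intro[OF A(1)], rule dense_pair_axioms.intro)
    show "\<exists>b\<in>carrier M. b [^]\<^bsub>M\<^esub> p = a" if "prime p" "a \<in> carrier M" for p :: nat and a
      using index_one_root[OF g(1) i(1)[OF that(1)] that(2)] .
    show "\<exists>b\<in>pred M. b [^]\<^bsub>M\<^esub> p = a" if "prime p" "a \<in> pred M" for p :: nat and a
      using index_one_root[OF g(2) i(2)[OF that(1)], of a] that(2) unfolding pow by simp
    show "regularly_dense M" "regularly_dense ?G"
      using h(1,4) unfolding models_T_def by blast+
  qed (rule h)+
qed

lemma (in dense_pair) UDTFS_2:
  assumes "finite \<Delta>" "\<forall>\<phi>\<in>\<Delta>. partitioned m \<phi>"
  shows "UDTFS M m \<Delta> 2"
proof -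
  interpret cover_map M evaluate "\<lambda>a. Poly_Mapping.single (Poly_Mapping.single a 1) 1"
  proof
    show "fst (evaluate x) \<in> carrier M" for x
      using evaluate_closed[of x] by (cases "evaluate x") simp
    show "evaluate 1 = (\<one>\<^bsub>M\<^esub>, 1)"
      using evaluate_single[of 0] by (simp add: gen_def)
  qed (simp_all add: evaluate_add evaluate_single gen_single[unfolded One_nat_def])
  show ?thesis using assms by (rule UDTFS_2)
qed

lemma VC_property_pair_theory: "VC_property (pair_theory (\<lambda>_. 0, e1) (\<lambda>_. 0, e2)) 2"
  unfolding VC_property_def using dense_pair.UDTFS_2[OF pair_theory_dense_pair] by blast

theorem theorem3p7:
  shows "VC_property (pair_theory (\<lambda>_. 0, \<lambda>_. 0) (\<lambda>_. 0, \<lambda>_. 0) :: 'a pair_structure set) 2 \<and>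
         VC_property (pair_theory (\<lambda>_. 0, \<lambda>_. \<infinity>) (\<lambda>_. 0, \<lambda>_. 0) :: 'a pair_structure set) 2 \<and>
         VC_property (pair_theory (\<lambda>_. 0, \<lambda>_. \<infinity>) (\<lambda>_. 0, \<lambda>_. \<infinity>) :: 'a pair_structure set) 2"
  by (intro conjI VC_property_pair_theory)

end
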